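(* Let $L\subseteq\mathbb{C}^n$ be any linear subspace with matroid $M$, and let $\varphi_L:\mathbb{C}[z_S:S\subseteq[n]]\to\mathbb{C}[x_1,y_1,\dots,x_n,y_n]/\widetilde{I_L}$ be the ring map $z_S\mapsto\prod_{i\in S}x_i\prod_{j\notin S}y_j$. Then $\ker\varphi_L=I_L^{\mathrm{SE}}$. Consequently the bigraded homogeneous coordinate ring of $Y_L\subseteq\mathbb{P}^{2^n-1}$ (under the Segre embedding, with $\deg z_S=(1,|S|)$) is isomorphic to $R_L=\mathbb{C}[z_S:S\subseteq[n]]/I_L^{\mathrm{SE}}$; in particular, if $L=\operatorname{rowspace}(A)\otimes\mathbb{C}$ for a unimodular zonotope $Z=A\cdot[0,1]^n$, then $\mathcal{H}_Z\cong R_L$ as bigraded algebras.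
   Context: The matroid $M$ of a $d$-dimensional subspace $L\subseteq\mathbb{C}^n$ has ground set $[n]$ and bases the $d$-sets $B$ for which the coordinate projection $L\to\mathbb{C}^B$ is an isomorphism. Fix a matrix $A$ whose row space is $L$, with columns $A_i$. For each circuit $C$ of $M$ fix the (unique up to scaling) linear dependence $\sum_{i\in C}\alpha_{C,i}A_i=0$ with all $\alpha_{C,i}\neq0$ (equivalently the linear form $\sum_{i\in C}\alpha_{C,i}x_i$ vanishes on $L$). The multihomogeneous circuit ideal $\widetilde{I_L}\subseteq\mathbb{C}[x_1,y_1,\dots,x_n,y_n]$ is generated by $\widetilde{f_C}=\sum_{i\in C}\alpha_{C,i}x_i\prod_{j\in C\setminus i}y_j$ over all circuits $C$; it cuts out $Y_L\subseteq(\mathbb{P}^1)^n$. For a circuit $C$ and $A'\subseteq[n]\setminus C$ set $f_C^{A'}(z)=\sum_{i\in C}\alpha_{C,i}z_{A'\cup\{i\}}$, and let $I_L^{\mathrm{SE}}\subseteq\mathbb{C}[z_S:S\subseteq[n]]$ be the ideal generated by all $z_Sz_T-z_{S\cup T}z_{S\cap T}$ ($S,T\subseteq[n]$) and all $f_C^{A'}(z)$. The arrangement Schubert variety $Y_L$ is the closure of the image of $L$ under $(a_1,\dots,a_n)\mapsto([a_1:1],\dots,[a_n:1])\in(\mathbb{P}^1)^n$, and the Segre embedding sends $([a_i:b_i])_i\mapsto[\prod_{i\in S}a_i\prod_{j\notin S}b_j]_{S\subseteq[n]}$. A unimodular zonotope is $Z=A\cdot[0,1]^n\subseteq\mathbb{R}^d$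 with $A$ a $d\times n$ integer matrix of rank $d$ with all maximal minors in $\{-1,0,1\}$; its harmonic algebra $\mathcal{H}_Z=\bigoplus_{m\ge0}\mathbb{C}x_0^m\otimes(\operatorname{gr}I(mZ\cap\mathbb{Z}^d))^\perp\subseteq\mathbb{C}[x_0,\dots,x_d]$, bigraded by $\deg x_0=(1,0)$, $\deg x_i=(0,1)$, where $\operatorname{gr}I$ is the ideal of top-degree components of polynomials vanishing on the point set and $\perp$ denotes the Macaulay inverse system (polynomials annihilated, at the origin, by every element of the ideal acting as differential operators). *)

theory Defs
  imports "HOL-Library.Poly_Mapping" "HOL-Analysis.Determinants"
begin

type_synonym 'v mpoly = "('v \<Rightarrow>\<^sub>0 nat) \<Rightarrow>\<^sub>0 complex"

definition Var :: "'v \<Rightarrow> 'v mpoly" where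
  "Var v = Poly_Mapping.single (Poly_Mapping.single v 1) 1"

definition Const :: "complex \<Rightarrow> 'v mpoly" where
  "Const c = Poly_Mapping.single 0 c"

definition monom :: "('v \<Rightarrow>\<^sub>0 nat) \<Rightarrow> complex \<Rightarrow> 'v mpoly" where
  "monom m c = Poly_Mapping.single m c"

definition subst :: "('v \<Rightarrow> 'w mpoly) \<Rightarrow> 'v mpoly \<Rightarrow> 'w mpoly" where
  "subst \<sigma> p = (\<Sum>m\<in>Poly_Mapping.keys p.
      Const (Poly_Mapping.lookup p m) * (\<Prod>v\<in>Poly_Mapping.keys m. \<sigma> v ^ Poly_Mapping.lookup m v))"

definition evalp :: "('v \<Rightarrow> complex) \<Rightarrow> 'v mpoly \<Rightarrow> complex" where
  "evalp f p = (\<Sum>m\<in>Poly_Mapping.keys p.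
      Poly_Mapping.lookup p m * (\<Prod>v\<in>Poly_Mapping.keys m. f v ^ Poly_Mapping.lookup m v))"

definition gen_ideal_in :: "'v mpoly set \<Rightarrow> 'v mpoly set \<Rightarrow> 'v mpoly set" where
  "gen_ideal_in R G = {p. \<exists>F r. finite F \<and> F \<subseteq> G \<and> (\<forall>g\<in>F. r g \<in> R) \<and> p = (\<Sum>g\<in>F. r g * g)}"

abbreviation gen_ideal :: "'v mpoly set \<Rightarrow> 'v mpoly set" where
  "gen_ideal G \<equiv> gen_ideal_in UNIV G"

definition csubspace :: "('n \<Rightarrow> complex) set \<Rightarrow> bool" where
  "csubspace L \<longleftrightarrow> (\<lambda>i. 0) \<in> L \<and> (\<forall>u\<in>L. \<forall>v\<in>L. (\<lambda>i. u i + v i) \<in> L) \<and> (\<forall>c. \<forall>v\<in>L. (\<lambda>i. c * v i) \<in> L)"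

text \<open>Coordinate projection L -> C^B, with C^B modelled as vectors vanishing off B.\<close>
definition coord_proj :: "'n set \<Rightarrow> ('n \<Rightarrow> complex) \<Rightarrow> ('n \<Rightarrow> complex)" where
  "coord_proj B v = (\<lambda>i. if i \<in> B then v i else 0)"

definition matroid_basis :: "('n \<Rightarrow> complex) set \<Rightarrow> 'n set \<Rightarrow> bool" where
  "matroid_basis L B \<longleftrightarrow> bij_betw (coord_proj B) L {w. \<forall>i. i \<notin> B \<longrightarrow> w i = 0}"

definition matroid_indep :: "('n \<Rightarrow> complex) set \<Rightarrow> 'n set \<Rightarrow> bool" where
  "matroid_indep L I \<longleftrightarrow> (\<exists>B. matroid_basis L B \<and> I \<subseteq> B)"

definition matroid_circuit :: "('n \<Rightarrow> complex) set \<Rightarrow> 'n set \<Rightarrow> bool" where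
  "matroid_circuit L C \<longleftrightarrow> \<not> matroid_indep L C \<and> (\<forall>C'. C' \<subset> C \<longrightarrow> matroid_indep L C')"

definition circuit_coeffs :: "('n \<Rightarrow> complex) set \<Rightarrow> ('n set \<Rightarrow> 'n \<Rightarrow> complex) \<Rightarrow> bool" where
  "circuit_coeffs L \<alpha> \<longleftrightarrow> (\<forall>C. matroid_circuit L C \<longrightarrow>
      (\<forall>i\<in>C. \<alpha> C i \<noteq> 0) \<and> (\<forall>v\<in>L. (\<Sum>i\<in>C. \<alpha> C i * v i) = 0))"

definition xv :: "'n \<Rightarrow> ('n + 'n) mpoly" where "xv i = Var (Inl i)"
definition yv :: "'n \<Rightarrow> ('n + 'n) mpoly" where "yv i = Var (Inr i)"

definition ftilde :: "('n set \<Rightarrow> 'n \<Rightarrow> complex) \<Rightarrow> 'n set \<Rightarrow> ('n + 'n) mpoly" where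
  "ftilde \<alpha> C = (\<Sum>i\<in>C. Const (\<alpha> C i) * xv i * (\<Prod>j\<in>C - {i}. yv j))"

definition Itilde :: "('n \<Rightarrow> complex) set \<Rightarrow> ('n set \<Rightarrow> 'n \<Rightarrow> complex) \<Rightarrow> ('n + 'n) mpoly set" where
  "Itilde L \<alpha> = gen_ideal {ftilde \<alpha> C | C. matroid_circuit L C}"

definition phiL :: "'n::finite set \<Rightarrow> ('n + 'n) mpoly" where
  "phiL S = (\<Prod>i\<in>S. xv i) * (\<Prod>j\<in>- S. yv j)"

definition fCA :: "('n set \<Rightarrow> 'n \<Rightarrow> complex) \<Rightarrow> 'n set \<Rightarrow> 'n set \<Rightarrow> 'n set mpoly" where
  "fCA \<alpha> C A' = (\<Sum>i\<in>C. Const (\<alpha> C i) * Var (A' \<union> {i}))"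

definition ISE :: "('n \<Rightarrow> complex) set \<Rightarrow> ('n set \<Rightarrow> 'n \<Rightarrow> complex) \<Rightarrow> 'n set mpoly set" where
  "ISE L \<alpha> = gen_ideal
     ({Var S * Var T - Var (S \<union> T) * Var (S \<inter> T) | S T. True}
      \<union> {fCA \<alpha> C A' | C A'. matroid_circuit L C \<and> A' \<inter> C = {}})"

text \<open>Homogeneous vanishing ideal of the Segre image of Y_L: polynomials in the z_S vanishing
  on the affine cone over the Segre image of the points ([a_1:1],...,[a_n:1]), a in L.
  (A polynomial vanishes on the Zariski closure Y_L iff it vanishes on this dense subset.)\<close>
definition IY :: "('n \<Rightarrow> complex) set \<Rightarrow> 'n set mpoly set" where
  "IY L = {p. \<forall>a\<in>L. \<forall>t::complex. evalp (\<lambda>S. t * (\<Prod>i\<in>S. a i)) p = 0}"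

definition full_row_rank :: "('d::finite \<Rightarrow> 'n::finite \<Rightarrow> int) \<Rightarrow> bool" where
  "full_row_rank A \<longleftrightarrow> (\<forall>c::'d \<Rightarrow> real. (\<forall>j. (\<Sum>i\<in>UNIV. c i * real_of_int (A i j)) = 0) \<longrightarrow> (\<forall>i. c i = 0))"

definition unimodular :: "('d::finite \<Rightarrow> 'n::finite \<Rightarrow> int) \<Rightarrow> bool" where
  "unimodular A \<longleftrightarrow> full_row_rank A \<and>
     (\<forall>g::'d \<Rightarrow> 'n. det (\<chi> i k. real_of_int (A i (g k)) :: real^'d^'d) \<in> {-1, 0, 1})"

definition rowspaceC :: "('d::finite \<Rightarrow> 'n \<Rightarrow> int) \<Rightarrow> ('n \<Rightarrow> complex) set" where
  "rowspaceC A = {v. \<exists>c::'d \<Rightarrow> complex. v = (\<lambda>j. \<Sum>i\<in>UNIV. c i * of_int (A i j))}"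

definition zono_pts :: "('d::finite \<Rightarrow> 'n::finite \<Rightarrow> int) \<Rightarrow> nat \<Rightarrow> ('d \<Rightarrow> int) set" where
  "zono_pts A m = {p. \<exists>t::'n \<Rightarrow> real. (\<forall>j. 0 \<le> t j \<and> t j \<le> real m) \<and>
       (\<forall>i. real_of_int (p i) = (\<Sum>j\<in>UNIV. t j * real_of_int (A i j)))}"

text \<open>Variables of C[x_0,...,x_d]: None = x_0, Some i = x_i.
  A polynomial lies in C[x_1..x_d] iff x_0 does not occur.\<close>
definition xpoly :: "'d option mpoly \<Rightarrow> bool" where
  "xpoly p \<longleftrightarrow> (\<forall>m\<in>Poly_Mapping.keys p. Poly_Mapping.lookup m None = 0)"

definition vanish_ideal :: "('d::finite \<Rightarrow> 'n::finite \<Rightarrow> int) \<Rightarrow> nat \<Rightarrow> 'd option mpoly set" where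
  "vanish_ideal A m = {f. xpoly f \<and> (\<forall>p\<in>zono_pts A m.
      evalp (\<lambda>v. case v of None \<Rightarrow> 0 | Some i \<Rightarrow> of_int (p i)) f = 0)}"

definition tdeg :: "('v \<Rightarrow>\<^sub>0 nat) \<Rightarrow> nat" where
  "tdeg m = (\<Sum>v\<in>Poly_Mapping.keys m. Poly_Mapping.lookup m v)"

text \<open>Top-degree homogeneous component (0 for the zero polynomial).\<close>
definition topcomp :: "'v mpoly \<Rightarrow> 'v mpoly" where
  "topcomp f = (\<Sum>m\<in>{m\<in>Poly_Mapping.keys f. tdeg m = Max (tdeg ` Poly_Mapping.keys f)}.
       monom m (Poly_Mapping.lookup f m))"

definition grI :: "('d::finite \<Rightarrow> 'n::finite \<Rightarrow> int) \<Rightarrow> nat \<Rightarrow> 'd option mpoly set" where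
  "grI A m = gen_ideal_in {p. xpoly p} (topcomp ` vanish_ideal A m)"

definition dmono :: "('v \<Rightarrow>\<^sub>0 nat) \<Rightarrow> 'v mpoly \<Rightarrow> 'v mpoly" where
  "dmono m g = (\<Sum>m'\<in>{m'\<in>Poly_Mapping.keys g. \<forall>v. Poly_Mapping.lookup m v \<le> Poly_Mapping.lookup m' v}.
      monom (m' - m) (Poly_Mapping.lookup g m' *
        (\<Prod>v\<in>Poly_Mapping.keys m. of_nat (fact (Poly_Mapping.lookup m' v)
                      div fact (Poly_Mapping.lookup m' v - Poly_Mapping.lookup m v)))))"

definition diffop :: "'v mpoly \<Rightarrow> 'v mpoly \<Rightarrow> 'v mpoly" where
  "diffop f g = (\<Sum>m\<in>Poly_Mapping.keys f. Const (Poly_Mapping.lookup f m) * dmono m g)"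

definition inv_system :: "'d option mpoly set \<Rightarrow> 'd option mpoly set" where
  "inv_system J = {g. xpoly g \<and> (\<forall>f\<in>J. Poly_Mapping.lookup (diffop f g) 0 = 0)}"

definition harmonic_algebra :: "('d::finite \<Rightarrow> 'n::finite \<Rightarrow> int) \<Rightarrow> 'd option mpoly set" where
  "harmonic_algebra A = {h. \<exists>(g::nat \<Rightarrow> 'd option mpoly) N.
      (\<forall>k. g k \<in> inv_system (grI A k)) \<and> h = (\<Sum>k\<le>N. Var None ^ k * g k)}"

definition bihom :: "nat \<Rightarrow> nat \<Rightarrow> 'd::finite option mpoly \<Rightarrow> bool" where
  "bihom a b p \<longleftrightarrow> (\<forall>m\<in>Poly_Mapping.keys p. Poly_Mapping.lookup m None = a \<and>
       (\<Sum>i\<in>UNIV. Poly_Mapping.lookup m (Some i)) = b)"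

end

theory Submission
  imports Defs "HOL-Computational_Algebra.Formal_Power_Series"
begin

text \<open>Modulo the toric binomials a monomial of degree \<open>m\<close> in the \<open>z\<^sub>S\<close> only depends on the exponent
  vector \<open>k \<le> m\<close> of its image \<open>\<Prod>i. x\<^sub>i ^ k\<^sub>i\<close>, and the circuit generators become the relations
  \<open>\<Sum>i\<in>C. \<alpha>\<^sub>i [k + e\<^sub>i] = 0\<close>. Order the coordinates and call \<open>k\<close> normal if no coordinate \<open>c\<close> with
  \<open>k\<^sub>c > 0\<close> lies in the closure of the earlier coordinates \<open>j\<close> with \<open>k\<^sub>j < m\<close>. Circuit relations rewrite
  every \<open>k\<close> into normal ones, and normal monomials are linearly independent on \<open>L\<close> by deletion and
  contraction; so the ideal of all relations that hold on \<open>L\<close> is generated by the toric and the circuit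
  relations. Evaluation on \<open>L\<close> factors through \<open>\<phi>\<^sub>L\<close> modulo the circuit ideal, which squeezes all three
  ideals together.

  For a unimodular zonotope the lattice points of \<open>mZ\<close> are the combinations \<open>\<Sum>i. k\<^sub>i a\<^sub>i\<close> with \<open>k \<le> m\<close>.
  The inverse system of \<open>gr I(mZ)\<close> consists of the leading forms of functionals spanned by the
  evaluations at these points, equivalently by the difference operators \<open>\<Prod>i. (E\<^sub>i - 1) ^ k\<^sub>i\<close> with
  \<open>k \<le> m\<close>, whose leading forms are the products of linear forms \<open>\<Prod>i. l\<^sub>i ^ k\<^sub>i\<close>. Every relation
  between these products comes from circuit relations, and those lift to difference operators modulo
  higher order because circuits have coefficients \<open>\<plusminus>1\<close>; hence no further leading forms occur, and
  the harmonic algebra is generated by the elements \<open>x\<^sub>0 \<Prod>i\<in>S. l\<^sub>i\<close>.\<close>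

section \<open>Multivariate polynomials and ideals\<close>

abbreviation "lookup \<equiv> Poly_Mapping.lookup"
abbreviation "keys \<equiv> Poly_Mapping.keys"
abbreviation "single \<equiv> Poly_Mapping.single"

lemma sum_monomials:
  fixes p :: "'v mpoly"
  shows "(\<Sum>m\<in>keys p. single m (lookup p m)) = p"
proof (rule poly_mapping_eqI)
  fix k
  have "lookup (\<Sum>m\<in>keys p. single m (lookup p m)) k = (\<Sum>m\<in>keys p. if m = k then lookup p m else 0)"
    unfolding lookup_sum by (intro sum.cong) (auto simp: lookup_single when_def)
  then show "lookup (\<Sum>m\<in>keys p. single m (lookup p m)) k = lookup p k"
    by (auto simp: not_in_keys_iff_lookup_eq_zero)
qed

text \<open>The zero polynomial is the monomial with coefficient 0, so no separate base case arises
  and linear statements only have to be checked on monomials.\<close>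

lemma mpoly_induct [case_names monomial add]:
  fixes P :: "'v mpoly \<Rightarrow> bool"
  assumes "\<And>m c. P (single m c)" and "\<And>p q. P p \<Longrightarrow> P q \<Longrightarrow> P (p + q)"
  shows "P p"
proof -
  have "P (\<Sum>m\<in>F. single m (lookup p m))" if "finite F" for F
    using that
  proof (induction F)
    case empty
    have "P (single 0 0)" by (rule assms(1))
    then show ?case by simp
  qed (simp add: assms)
  from this[of "keys p"] show ?thesis by (simp add: sum_monomials)
qed

lemma Const_add: "Const (a + b) = Const a + Const b"
  and Const_mult: "Const (a * b) = Const a * Const b"
  and Const_0 [simp]: "Const 0 = 0"
  and Const_1 [simp]: "Const 1 = 1"
  by (simp_all add: Const_def single_add mult_single)

lemma Const_uminus: "Const (- a) = - Const a"
  by (simp add: Const_def single_uminus)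

lemma Const_sum: "Const (sum f A) = (\<Sum>x\<in>A. Const (f x))"
  by (induction A rule: infinite_finite_induct) (auto simp: Const_add)

lemma Const_times_single: "Const c * single m d = single m (c * d)"
  by (simp add: Const_def mult_single)

lemma lookup_Const_times: "lookup (Const c * p) m = c * lookup p m"
proof (induction p rule: mpoly_induct)
  case (monomial m' d)
  then show ?case by (simp add: Const_times_single lookup_single when_def)
next
  case (add p q)
  then show ?case by (simp add: distrib_left lookup_add)
qed

definition mono_val :: "('v \<Rightarrow> 'b::comm_monoid_mult) \<Rightarrow> ('v \<Rightarrow>\<^sub>0 nat) \<Rightarrow> 'b" where
  "mono_val f m = (\<Prod>v\<in>keys m. f v ^ lookup m v)"

lemma mono_val_superset:
  assumes "finite V" "keys m \<subseteq> V"
  shows "mono_val f m = (\<Prod>v\<in>V. f v ^ lookup m v)"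
  unfolding mono_val_def
  by (rule prod.mono_neutral_left) (use assms in \<open>auto simp: not_in_keys_iff_lookup_eq_zero\<close>)

lemma mono_val_UNIV: "mono_val f m = (\<Prod>v\<in>UNIV. f v ^ lookup m v)" for f :: "'v::finite \<Rightarrow> _"
  by (rule mono_val_superset) auto

lemma mono_val_0 [simp]: "mono_val f 0 = 1"
  by (simp add: mono_val_def)

lemma mono_val_add: "mono_val f (m + m') = mono_val f m * mono_val f m'"
proof -
  let ?V = "keys m \<union> keys m'"
  have "keys (m + m') \<subseteq> ?V" by (rule keys_add)
  then show ?thesis
    by (simp add: mono_val_superset[of ?V] lookup_add power_add prod.distrib)
qed

lemma mono_val_single [simp]: "mono_val f (single v k) = f v ^ k"
  by (cases "k = 0") (simp_all add: mono_val_def)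

text \<open>The common pattern behind \<open>evalp\<close> (coefficient map the identity) and
  \<open>subst\<close> (coefficient map \<open>Const\<close>), and later the substitution of
  exponential series (\<open>fps_const\<close>). That inserting values is a ring homomorphism is
  thus shown once.\<close>

locale insertion =
  fixes h :: "complex \<Rightarrow> 'b::comm_ring_1" and f :: "'v \<Rightarrow> 'b"
  assumes h_add: "h (a + b) = h a + h b"
    and h_mult: "h (a * b) = h a * h b"
    and h_one: "h 1 = 1"
begin

definition ins :: "'v mpoly \<Rightarrow> 'b" where
  "ins p = (\<Sum>m\<in>keys p. h (lookup p m) * mono_val f m)"

lemma h_zero: "h 0 = 0"
  using h_add[of 0 0] by simp

lemma ins_superset:
  assumes "finite K" "keys p \<subseteq> K"
  shows "ins p = (\<Sum>m\<in>K. h (lookup p m) * mono_val f m)"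
  unfolding ins_def
  by (rule sum.mono_neutral_left) (use assms in \<open>auto simp: not_in_keys_iff_lookup_eq_zero h_zero\<close>)

lemma ins_add: "ins (p + q) = ins p + ins q"
proof -
  let ?K = "keys p \<union> keys q"
  have "keys (p + q) \<subseteq> ?K" by (rule keys_add)
  then show ?thesis
    by (simp add: ins_superset[of ?K] lookup_add h_add distrib_right sum.distrib)
qed

lemma ins_single: "ins (single m c) = h c * mono_val f m"
  by (cases "c = 0") (simp_all add: ins_def h_zero)

lemma ins_0 [simp]: "ins 0 = 0"
  by (simp add: ins_def)

lemma ins_Const: "ins (Const c) = h c"
  by (simp add: Const_def ins_single)

lemma ins_1 [simp]: "ins 1 = 1"
  using ins_Const[of 1] by (simp add: h_one)

lemma ins_Var: "ins (Var v) = f v"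
  by (simp add: Var_def ins_single h_one)

lemma ins_mult: "ins (p * q) = ins p * ins q"
proof (induction p rule: mpoly_induct)
  case (monomial m c)
  show ?case
  proof (induction q rule: mpoly_induct)
    case (monomial m' c')
    then show ?case by (simp add: mult_single ins_single h_mult mono_val_add mult_ac)
  qed (simp add: distrib_left ins_add)
qed (simp add: distrib_right ins_add)

lemma ins_uminus: "ins (- p) = - ins p"
  using ins_add[of p "- p"] by (simp add: eq_neg_iff_add_eq_0 add.commute)

lemma ins_diff: "ins (p - q) = ins p - ins q"
  using ins_add[of p "- q"] by (simp add: ins_uminus)

lemma ins_sum: "ins (sum g A) = (\<Sum>x\<in>A. ins (g x))"
  by (induction A rule: infinite_finite_induct) (simp_all add: ins_add)

lemma ins_prod: "ins (prod g A) = (\<Prod>x\<in>A. ins (g x))"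
  by (induction A rule: infinite_finite_induct) (simp_all add: ins_mult)

lemma ins_power: "ins (p ^ k) = ins p ^ k"
  by (induction k) (simp_all add: ins_mult)

lemmas ins_simps = ins_add ins_mult ins_diff ins_uminus ins_sum ins_prod ins_power ins_Const ins_Var

end

text \<open>The \<open>rewrites\<close> clause turns the generic facts into facts about the given
  \<open>evalp\<close>; the same is done for \<open>subst\<close> below.\<close>

interpretation ev: insertion "\<lambda>c. c" f
  rewrites "insertion.ins (\<lambda>c. c) f = evalp f"
  for f :: "'v \<Rightarrow> complex"
proof -
  show *: "insertion (\<lambda>c::complex. c)" by unfold_locales auto
  show "insertion.ins (\<lambda>c. c) f = evalp f"
    by (rule ext) (simp add: insertion.ins_def[OF *] evalp_def mono_val_def)
qed

interpretation sb: insertion Const \<sigma>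
  rewrites "insertion.ins Const \<sigma> = subst \<sigma>"
  for \<sigma> :: "'v \<Rightarrow> 'w mpoly"
proof -
  show *: "insertion (Const :: complex \<Rightarrow> 'w mpoly)"
    by unfold_locales (auto simp: Const_add Const_mult)
  show "insertion.ins Const \<sigma> = subst \<sigma>"
    by (rule ext) (simp add: insertion.ins_def[OF *] subst_def mono_val_def)
qed

lemma evalp_mono_val: "evalp f (mono_val g m) = mono_val (\<lambda>v. evalp f (g v)) m"
  by (simp add: mono_val_def ev.ins_simps)

lemma evalp_subst: "evalp f (subst \<sigma> p) = evalp (\<lambda>v. evalp f (\<sigma> v)) p"
  by (induction p rule: mpoly_induct)
    (simp_all add: sb.ins_single ev.ins_single ev.ins_simps sb.ins_simps evalp_mono_val)

text \<open>Induction on the exponent, adjoining one new variable with its full power at a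
  time.\<close>

lemma single_eq_Const_mono_val: "single m c = Const c * mono_val Var m"
proof -
  have "mono_val Var m = (single m 1 :: 'a mpoly)"
  proof (induction m rule: update_induct)
    case const
    show ?case by simp
  next
    case (update f a b)
    have "Poly_Mapping.update a b f = single a b + f"
      using update by (intro poly_mapping_eqI)
        (auto simp: lookup_update lookup_add lookup_single when_def in_keys_iff)
    moreover have "Var a ^ b = (single (single a b) 1 :: 'a mpoly)"
    proof (induction b)
      case (Suc b)
      then show ?case by (simp add: Var_def mult_single flip: single_add)
    qed simp
    ultimately show ?case
      using update by (simp add: mono_val_add mult_single)
  qed
  then show ?thesis by (simp add: Const_times_single)
qed

section \<open>Closure properties of generated ideals\<close>

lemma gen_ideal_0 [simp]: "0 \<in> gen_ideal G"
  unfolding gen_ideal_in_def by (auto intro!: exI[of _ "{}"])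

lemma gen_ideal_gen: "g \<in> G \<Longrightarrow> g \<in> gen_ideal G"
  unfolding gen_ideal_in_def by (auto intro!: exI[of _ "{g}"] exI[of _ "\<lambda>_. 1"])

lemma gen_ideal_add:
  assumes "p \<in> gen_ideal G" "q \<in> gen_ideal G"
  shows "p + q \<in> gen_ideal G"
proof -
  from assms obtain F r F' r' where F: "finite F" "F \<subseteq> G" "p = (\<Sum>g\<in>F. r g * g)"
    and F': "finite F'" "F' \<subseteq> G" "q = (\<Sum>g\<in>F'. r' g * g)"
    unfolding gen_ideal_in_def by auto
  have "p = (\<Sum>g\<in>F \<union> F'. (if g \<in> F then r g else 0) * g)"
    unfolding F(3) using F(1) F'(1) by (intro sum.mono_neutral_cong_left) auto
  moreover have "q = (\<Sum>g\<in>F \<union> F'. (if g \<in> F' then r' g else 0) * g)"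
    unfolding F'(3) using F(1) F'(1) by (intro sum.mono_neutral_cong_left) auto
  ultimately have "p + q = (\<Sum>g\<in>F \<union> F'. ((if g \<in> F then r g else 0) + (if g \<in> F' then r' g else 0)) * g)"
    by (simp add: sum.distrib distrib_right)
  then show ?thesis
    unfolding gen_ideal_in_def using F F'
    by (auto intro!: exI[of _ "F \<union> F'"]
        exI[of _ "\<lambda>g. (if g \<in> F then r g else 0) + (if g \<in> F' then r' g else 0)"])
qed

lemma gen_ideal_mult:
  assumes "p \<in> gen_ideal G" shows "q * p \<in> gen_ideal G"
proof -
  from assms obtain F r where F: "finite F" "F \<subseteq> G" "p = (\<Sum>g\<in>F. r g * g)"
    unfolding gen_ideal_in_def by auto
  have "q * p = (\<Sum>g\<in>F. (q * r g) * g)"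
    by (simp add: F(3) sum_distrib_left mult.assoc)
  then show ?thesis
    unfolding gen_ideal_in_def using F by (auto intro!: exI[of _ F] exI[of _ "\<lambda>g. q * r g"])
qed

lemma gen_ideal_uminus: "p \<in> gen_ideal G \<Longrightarrow> - p \<in> gen_ideal G"
  using gen_ideal_mult[of p G "- 1"] by simp

lemma gen_ideal_diff: "p \<in> gen_ideal G \<Longrightarrow> q \<in> gen_ideal G \<Longrightarrow> p - q \<in> gen_ideal G"
  using gen_ideal_add[of p G "- q"] gen_ideal_uminus[of q G] by simp

lemma gen_ideal_sum: "(\<And>x. x \<in> A \<Longrightarrow> g x \<in> gen_ideal G) \<Longrightarrow> sum g A \<in> gen_ideal G"
  by (induction A rule: infinite_finite_induct) (auto intro: gen_ideal_add)

lemma gen_ideal_induct [consumes 1, case_names zero add mult]: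
  assumes "p \<in> gen_ideal G" and "P 0" and "\<And>p q. P p \<Longrightarrow> P q \<Longrightarrow> P (p + q)"
    and "\<And>g r. g \<in> G \<Longrightarrow> P (r * g)"
  shows "P p"
proof -
  from assms obtain F r where F: "finite F" "F \<subseteq> G" "p = (\<Sum>g\<in>F. r g * g)"
    unfolding gen_ideal_in_def by auto
  have "P (\<Sum>g\<in>F. r g * g)"
    using F(1,2) by (induction F) (auto intro: assms)
  then show ?thesis by (simp add: F)
qed

section \<open>The matroid of a subspace\<close>

lemma csubspace_zero: "csubspace L \<Longrightarrow> (\<lambda>i. 0) \<in> L"
  and csubspace_add: "csubspace L \<Longrightarrow> u \<in> L \<Longrightarrow> v \<in> L \<Longrightarrow> (\<lambda>i. u i + v i) \<in> L"
  and csubspace_scale: "csubspace L \<Longrightarrow> v \<in> L \<Longrightarrow> (\<lambda>i. c * v i) \<in> L"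
  unfolding csubspace_def by blast+

lemma csubspace_diff: "csubspace L \<Longrightarrow> u \<in> L \<Longrightarrow> v \<in> L \<Longrightarrow> (\<lambda>i. u i - v i) \<in> L"
  using csubspace_add[of L u "\<lambda>i. - 1 * v i"] csubspace_scale[of L v "- 1"] by simp

lemma csubspace_sum:
  fixes f :: "'a \<Rightarrow> 'n \<Rightarrow> complex"
  assumes "csubspace L" "\<And>x. x \<in> A \<Longrightarrow> f x \<in> L"
  shows "(\<lambda>i. \<Sum>x\<in>A. f x i) \<in> L"
proof (cases "finite A")
  case True
  then show ?thesis
    using assms(2)
  proof (induction A)
    case empty
    show ?case unfolding sum.empty by (rule csubspace_zero[OF assms(1)])
  next
    case (insert x F)
    have "f x \<in> L" by (rule insert.prems) (rule insertI1)
    moreover have "(\<lambda>i. \<Sum>x\<in>F. f x i) \<in> L"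
      by (rule insert.IH) (rule insert.prems, rule insertI2)
    ultimately have "(\<lambda>i. f x i + (\<Sum>x\<in>F. f x i)) \<in> L"
      by (rule csubspace_add[OF assms(1)])
    then show ?case by (simp add: insert.hyps)
  qed
next
  case False
  then show ?thesis
    unfolding sum.infinite[OF False] by (intro csubspace_zero[OF assms(1)])
qed

text \<open>Surjectivity of the projection to the coordinates in \<open>I\<close>. For a subspace
  this is independence in the matroid (\<open>matroid_indep_iff\<close>), and it avoids naming a
  basis.\<close>

definition coord_onto :: "('n \<Rightarrow> complex) set \<Rightarrow> 'n set \<Rightarrow> bool" where
  "coord_onto L I \<longleftrightarrow> (\<forall>w. \<exists>v\<in>L. \<forall>i\<in>I. v i = w i)"

text \<open>The matroid closure, read off from the vectors of \<open>L\<close> rather than from the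
  columns of a matrix.\<close>

definition mclosure :: "('n \<Rightarrow> complex) set \<Rightarrow> 'n set \<Rightarrow> 'n set" where
  "mclosure L J = {c. \<forall>v\<in>L. (\<forall>j\<in>J. v j = 0) \<longrightarrow> v c = 0}"

lemma coord_onto_subset: "coord_onto L I \<Longrightarrow> J \<subseteq> I \<Longrightarrow> coord_onto L J"
  unfolding coord_onto_def by (meson subsetD)

text \<open>A vector of \<open>L\<close> that vanishes on \<open>I\<close> but not at
  \<open>c\<close> corrects the value at \<open>c\<close> without disturbing the values on
  \<open>I\<close>.\<close>

lemma coord_onto_insert:
  fixes L :: "('n \<Rightarrow> complex) set"
  assumes "csubspace L" "coord_onto L I" "c \<notin> mclosure L I"
  shows "coord_onto L (insert c I)"
  unfolding coord_onto_def
proof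
  fix w :: "'n \<Rightarrow> complex"
  from assms(2) obtain v where v: "v \<in> L" "\<forall>i\<in>I. v i = w i"
    unfolding coord_onto_def by blast
  from assms(3) obtain u where u: "u \<in> L" "\<forall>j\<in>I. u j = 0" "u c \<noteq> 0"
    unfolding mclosure_def by blast
  let ?x = "\<lambda>i. v i + (w c - v c) / u c * u i"
  have "?x \<in> L"
    using csubspace_add[OF assms(1) v(1) csubspace_scale[OF assms(1) u(1)]] .
  moreover have "\<forall>i\<in>insert c I. ?x i = w i"
    using u v by auto
  ultimately show "\<exists>x\<in>L. \<forall>i\<in>insert c I. x i = w i" by (intro bexI[of _ ?x])
qed

text \<open>Extension to a basis: an inclusion-maximal independent superset has full closure, since
  otherwise \<open>coord_onto_insert\<close> would enlarge it.\<close>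

lemma coord_onto_maximal:
  fixes L :: "('n::finite \<Rightarrow> complex) set"
  assumes "csubspace L" "coord_onto L I"
  obtains B where "I \<subseteq> B" "coord_onto L B" "mclosure L B = UNIV"
proof -
  let ?F = "{B. I \<subseteq> B \<and> coord_onto L B}"
  have "finite ?F" "?F \<noteq> {}" using assms by auto
  from finite_has_maximal[OF this] obtain B where "B \<in> ?F"
    and max: "\<forall>B'\<in>?F. B \<subseteq> B' \<longrightarrow> B = B'" by (rule bexE)
  then have B: "I \<subseteq> B" "coord_onto L B" by simp_all
  have "c \<in> mclosure L B" for c
  proof (rule ccontr)
    assume c: "c \<notin> mclosure L B"
    then have "coord_onto L (insert c B)"
      by (rule coord_onto_insert[OF assms(1) B(2)])
    then have "insert c B = B" using B max[rule_format, of "insert c B"] by auto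
    with c show False by (auto simp: mclosure_def)
  qed
  with B that show thesis by blast
qed

text \<open>Independence is surjectivity of the coordinate projection; full closure says that its
  kernel on \<open>L\<close> is trivial, which is injectivity.\<close>

lemma matroid_basis_iff:
  fixes L :: "('n \<Rightarrow> complex) set"
  assumes "csubspace L"
  shows "matroid_basis L B \<longleftrightarrow> coord_onto L B \<and> mclosure L B = UNIV"
proof
  assume *: "matroid_basis L B"
  have "coord_onto L B"
    unfolding coord_onto_def
  proof
    fix w :: "'n \<Rightarrow> complex"
    have "coord_proj B w \<in> {w. \<forall>i. i \<notin> B \<longrightarrow> w i = 0}"
      by (simp add: coord_proj_def)
    then have "coord_proj B w \<in> coord_proj B ` L"
      using * unfolding matroid_basis_def bij_betw_def by blast
    then obtain v where "v \<in> L" "coord_proj B w = coord_proj B v" by blast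
    moreover have "v i = w i" if "i \<in> B" for i
      using fun_cong[OF \<open>coord_proj B w = coord_proj B v\<close>, of i] that by (simp add: coord_proj_def)
    ultimately show "\<exists>v\<in>L. \<forall>i\<in>B. v i = w i" by blast
  qed
  moreover have "v = (\<lambda>i. 0)" if "v \<in> L" "\<forall>j\<in>B. v j = 0" for v :: "'n \<Rightarrow> complex"
  proof -
    have "coord_proj B v = coord_proj B (\<lambda>i. 0)"
      using that by (simp add: coord_proj_def fun_eq_iff)
    moreover have "inj_on (coord_proj B) L"
      using * by (simp add: matroid_basis_def bij_betw_def)
    ultimately show ?thesis
      using that(1) csubspace_zero[OF assms] by (simp add: inj_onD)
  qed
  ultimately show "coord_onto L B \<and> mclosure L B = UNIV"
    by (auto simp: mclosure_def fun_eq_iff)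
next
  assume *: "coord_onto L B \<and> mclosure L B = UNIV"
  have "inj_on (coord_proj B) L"
  proof (rule inj_onI)
    fix u v assume uv: "u \<in> L" "v \<in> L" "coord_proj B u = coord_proj B v"
    have "u j - v j = 0" if "j \<in> B" for j
      using fun_cong[OF uv(3), of j] that by (simp add: coord_proj_def)
    moreover have "\<forall>v\<in>L. (\<forall>j\<in>B. v j = 0) \<longrightarrow> v c = 0" for c
      using * unfolding mclosure_def by auto
    ultimately have "u c - v c = 0" for c
      using bspec[OF _ csubspace_diff[OF assms uv(1,2)], of "\<lambda>v. (\<forall>j\<in>B. v j = 0) \<longrightarrow> v c = 0"] by simp
    then show "u = v" by (simp add: fun_eq_iff)
  qed
  moreover have "coord_proj B ` L = {w. \<forall>i. i \<notin> B \<longrightarrow> w i = 0}"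
  proof (intro equalityI subsetI)
    fix w :: "'n \<Rightarrow> complex" assume w: "w \<in> {w. \<forall>i. i \<notin> B \<longrightarrow> w i = (0::complex)}"
    from * obtain v where "v \<in> L" "\<forall>i\<in>B. v i = w i" unfolding coord_onto_def by blast
    with w have "w = coord_proj B v" by (auto simp: coord_proj_def)
    with \<open>v \<in> L\<close> show "w \<in> coord_proj B ` L" by blast
  qed (auto simp: coord_proj_def)
  ultimately show "matroid_basis L B" by (simp add: matroid_basis_def bij_betw_def)
qed

lemma matroid_indep_iff:
  fixes L :: "('n::finite \<Rightarrow> complex) set"
  assumes "csubspace L"
  shows "matroid_indep L I \<longleftrightarrow> coord_onto L I"
proof
  assume "matroid_indep L I"
  then show "coord_onto L I"
    unfolding matroid_indep_def matroid_basis_iff[OF assms] by (blast intro: coord_onto_subset)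
next
  assume "coord_onto L I"
  then obtain B where "I \<subseteq> B" "coord_onto L B" "mclosure L B = UNIV"
    by (rule coord_onto_maximal[OF assms])
  then show "matroid_indep L I"
    unfolding matroid_indep_def matroid_basis_iff[OF assms] by blast
qed

lemma coord_onto_dual:
  fixes L :: "('n \<Rightarrow> complex) set"
  assumes "coord_onto L J"
  obtains u :: "'n \<Rightarrow> 'n \<Rightarrow> complex" where "\<And>j. u j \<in> L" "\<And>i j. i \<in> J \<Longrightarrow> u j i = (if i = j then 1 else 0)"
proof -
  have "\<forall>j. \<exists>v\<in>L. \<forall>i\<in>J. v i = (if i = j then 1 else 0)"
    using assms unfolding coord_onto_def by (intro allI) (erule allE)
  then obtain u where "\<forall>j. u j \<in> L \<and> (\<forall>i\<in>J. u j i = (if i = j then 1 else 0))"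
    unfolding Bex_def by metis
  then show thesis by (intro that[of u]) simp_all
qed

text \<open>Choose \<open>I\<close> inside \<open>J\<close> minimal with \<open>c\<close> in its
  closure. Minimality supplies, for each \<open>j\<close> in \<open>I\<close>, a vector of
  \<open>L\<close> dual to \<open>j\<close>; hence \<open>I\<close> is independent and
  \<open>insert c I\<close> is a circuit.\<close>

lemma circuit_in_closure:
  fixes L :: "('n::finite \<Rightarrow> complex) set"
  assumes L: "csubspace L" and c: "c \<in> mclosure L J" "c \<notin> J"
  obtains C where "matroid_circuit L C" "c \<in> C" "C \<subseteq> insert c J"
proof -
  let ?F = "{J'. J' \<subseteq> J \<and> c \<in> mclosure L J'}"
  have "finite ?F" "?F \<noteq> {}" using c by auto
  from finite_has_minimal[OF this] obtain I where "I \<in> ?F"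
    and min': "\<forall>I'\<in>?F. I' \<subseteq> I \<longrightarrow> I = I'" by (rule bexE)
  then have I: "I \<subseteq> J" "c \<in> mclosure L I" by simp_all
  have min: "I' = I" if "I' \<in> ?F" "I' \<subseteq> I" for I'
    using min' that by blast
  have ex: "\<exists>u\<in>L. u j = 1 \<and> (\<forall>i\<in>I - {j}. u i = 0)" if "j \<in> I" for j
  proof -
    have "c \<notin> mclosure L (I - {j})" using min[of "I - {j}"] that I by blast
    then obtain v where v: "v \<in> L" "\<forall>i\<in>I - {j}. v i = 0" "v c \<noteq> 0"
      unfolding mclosure_def by blast
    \<comment> \<open>Otherwise \<open>v\<close> would vanish on all of \<open>I\<close>, and then
      at \<open>c\<close> too.\<close>
    have "v j \<noteq> 0"
    proof
      assume "v j = 0"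
      with v(2) have "\<forall>i\<in>I. v i = 0" by auto
      with I(2) v(1,3) show False by (simp add: mclosure_def)
    qed
    moreover have "(\<lambda>i. 1 / v j * v i) \<in> L" by (rule csubspace_scale[OF L v(1)])
    ultimately show ?thesis
      using v(2) by (intro bexI[of _ "\<lambda>i. 1 / v j * v i"]) auto
  qed
  then obtain u :: "'n \<Rightarrow> 'n \<Rightarrow> complex" where u': "\<And>j. j \<in> I \<Longrightarrow> u j \<in> L \<and> u j j = 1 \<and> (\<forall>i\<in>I - {j}. u j i = 0)"
    by metis
  then have u: "\<And>j. j \<in> I \<Longrightarrow> u j \<in> L" "\<And>j. j \<in> I \<Longrightarrow> u j j = 1"
    "\<And>i j. j \<in> I \<Longrightarrow> i \<in> I \<Longrightarrow> i \<noteq> j \<Longrightarrow> u j i = 0"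
    by auto
  have onto: "coord_onto L I"
    unfolding coord_onto_def
  proof
    fix w :: "'n \<Rightarrow> complex"
    let ?v = "\<lambda>i. \<Sum>j\<in>I. w j * u j i"
    have "?v \<in> L" by (rule csubspace_sum[OF L], rule csubspace_scale[OF L], rule u)
    moreover have "?v i = w i" if "i \<in> I" for i
    proof -
      have "?v i = (\<Sum>j\<in>I. if j = i then w j else 0)"
        using u that by (intro sum.cong) auto
      then show ?thesis using that by simp
    qed
    ultimately show "\<exists>v\<in>L. \<forall>i\<in>I. v i = w i" by (intro bexI[of _ ?v]) simp_all
  qed
  have cI: "c \<notin> I" using I c by blast
  have "\<not> coord_onto L (insert c I)"
  proof
    assume "coord_onto L (insert c I)"
    then obtain v where v: "v \<in> L" "\<forall>i\<in>insert c I. v i = (if i = c then 1 else 0)"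
      unfolding coord_onto_def by (elim allE[of _ "\<lambda>i. if i = c then 1 else 0"]) blast
    then have "\<forall>i\<in>I. v i = 0" "v c = 1" using cI by auto
    with I(2) v(1) show False unfolding mclosure_def by auto
  qed
  \<comment> \<open>A proper subset either lies in \<open>I\<close> or misses some \<open>j\<close>
    in \<open>I\<close>; in the second case \<open>c\<close> is outside the closure of
    \<open>I - {j}\<close> and can be adjoined.\<close>
  moreover have "coord_onto L C'" if C': "C' \<subset> insert c I" for C'
  proof (cases "I \<subseteq> C'")
    case True
    with C' have "C' \<subseteq> I" by blast
    with onto show ?thesis by (rule coord_onto_subset)
  next
    case False
    then obtain j where j: "j \<in> I" "j \<notin> C'" by blast
    then have "c \<notin> mclosure L (I - {j})" using min[of "I - {j}"] I by blast
    then have "coord_onto L (insert c (I - {j}))"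
      by (intro coord_onto_insert[OF L] coord_onto_subset[OF onto]) auto
    moreover have "C' \<subseteq> insert c (I - {j})" using C' j by blast
    ultimately show ?thesis by (rule coord_onto_subset)
  qed
  ultimately have "matroid_circuit L (insert c I)"
    by (simp add: matroid_circuit_def matroid_indep_iff[OF L])
  with I that show thesis by blast
qed

section \<open>Linear relations between monomials on a subspace\<close>

text \<open>Kept generic in the value type so that one definition covers monomials in coordinates,
  products of linear forms, products of difference operators and products of power series.\<close>

definition mono_fun :: "('n::finite \<Rightarrow> nat) \<Rightarrow> ('n \<Rightarrow> 'b::comm_monoid_mult) \<Rightarrow> 'b" where
  "mono_fun k v = (\<Prod>i\<in>UNIV. v i ^ k i)"

text \<open>The list fixes the order of the coordinates. An exponent below the bound
  \<open>m\<close> is followed by contraction, the passage to the hyperplane section; an exponent of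
  at least \<open>m\<close> is followed by deletion, which keeps \<open>L\<close> and merely drops
  the coordinate.\<close>

fun normal_exp :: "nat \<Rightarrow> ('n \<Rightarrow> complex) set \<Rightarrow> 'n list \<Rightarrow> ('n \<Rightarrow> nat) \<Rightarrow> bool" where
  "normal_exp m L [] k \<longleftrightarrow> True"
| "normal_exp m L (c # cs) k \<longleftrightarrow>
     (k c = 0 \<or> (\<exists>v\<in>L. v c \<noteq> 0)) \<and> normal_exp m (if k c < m then {v\<in>L. v c = 0} else L) cs k"

lemma csubspace_hyperplane: "csubspace L \<Longrightarrow> csubspace {v\<in>L. v c = 0}"
  unfolding csubspace_def by auto

text \<open>Serves to extend an identity across a hyperplane after division by the coordinate that
  defines it.\<close>

lemma isCont_eq_0_at_0:
  fixes g :: "real \<Rightarrow> complex"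
  assumes "continuous_on UNIV g" "\<And>s. s \<noteq> 0 \<Longrightarrow> g s = 0"
  shows "g 0 = 0"
proof -
  have "g \<midarrow>0\<rightarrow> g 0" using assms(1) by (simp add: continuous_on_eq_continuous_at isCont_def)
  moreover have "g \<midarrow>0\<rightarrow> 0"
    by (rule tendsto_eventually) (auto simp: eventually_at_filter assms)
  ultimately show ?thesis by (rule LIM_unique)
qed

text \<open>Outer induction on the coordinate list, inner induction on the exponent \<open>e\<close>
  of its head \<open>c\<close>. Once all smaller exponents are eliminated, the relation is divided
  by \<open>v c ^ e\<close>; restricting to \<open>v c = 0\<close> isolates the terms of exponent
  exactly \<open>e\<close>, whose tails are normal for the section. Indexing the terms by an
  arbitrary type lets ordinary polynomial monomials be treated as well.\<close>

lemma normal_monomials_independent_aux: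
  fixes L :: "('n \<Rightarrow> complex) set" and d :: "'a \<Rightarrow> complex" and k :: "'a \<Rightarrow> 'n \<Rightarrow> nat"
  assumes "csubspace L" "distinct cs" "finite K"
    and "\<And>x c. x \<in> K \<Longrightarrow> k x c \<le> m"
    and "\<And>x. x \<in> K \<Longrightarrow> normal_exp m L cs (k x)"
    and "\<And>x y. x \<in> K \<Longrightarrow> y \<in> K \<Longrightarrow> (\<forall>c\<in>set cs. k x c = k y c) \<Longrightarrow> x = y"
    and "\<And>v. v \<in> L \<Longrightarrow> (\<Sum>x\<in>K. d x * (\<Prod>c\<in>set cs. v c ^ k x c)) = 0"
    and "x \<in> K"
  shows "d x = 0"
  using assms
proof (induction cs arbitrary: L K x)
  case Nil
  have "y = x" if "y \<in> K" for y
    by (rule Nil.prems(6)[OF that Nil.prems(8)]) simp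
  with Nil.prems(8) have "K = {x}" by blast
  then show ?case using Nil.prems(7)[OF csubspace_zero[OF Nil.prems(1)]] by simp
next
  case (Cons c cs)
  note L = Cons.prems(1) and fin = Cons.prems(3) and le = Cons.prems(4)
    and nf = Cons.prems(5) and inj = Cons.prems(6) and rel = Cons.prems(7)
  define M where "M x v = (\<Prod>c\<in>set cs. v c ^ k x c)" for x :: 'a and v :: "'n \<Rightarrow> complex"
  have c: "c \<notin> set cs" "distinct cs" using Cons.prems(2) by auto
  have rel': "(\<Sum>x\<in>K. d x * (v c ^ k x c * M x v)) = 0" if "v \<in> L" for v
    using rel[OF that] c by (simp add: M_def)
  have vanish: "d x = 0" if "x \<in> K" "k x c = e" for x e
    using that
  proof (induction e arbitrary: x rule: less_induct)
    case (less e)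
    define K' where "K' = {x\<in>K. k x c \<ge> e}"
    define Ke where "Ke = {x\<in>K. k x c = e}"
    have fin': "finite K'" "finite Ke" using fin by (auto simp: K'_def Ke_def)
    have relK': "(\<Sum>x\<in>K'. d x * (v c ^ k x c * M x v)) = 0" if "v \<in> L" for v
    proof -
      have "(\<Sum>x\<in>K. d x * (v c ^ k x c * M x v)) = (\<Sum>x\<in>K'. d x * (v c ^ k x c * M x v))"
        by (rule sum.mono_neutral_right) (use fin less.IH in \<open>auto simp: K'_def not_le\<close>)
      with rel'[OF that] show ?thesis by simp
    qed
    have nonzero: "(\<Sum>x\<in>K'. d x * (v c ^ (k x c - e) * M x v)) = 0" if "v \<in> L" "v c \<noteq> 0" for v
    proof -
      have "(\<Sum>x\<in>K'. d x * (v c ^ k x c * M x v))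
          = v c ^ e * (\<Sum>x\<in>K'. d x * (v c ^ (k x c - e) * M x v))"
        unfolding sum_distrib_left
      proof (rule sum.cong[OF refl])
        fix x assume "x \<in> K'"
        then have "v c ^ k x c = v c ^ e * v c ^ (k x c - e)"
          by (simp add: K'_def flip: power_add)
        then show "d x * (v c ^ k x c * M x v) = v c ^ e * (d x * (v c ^ (k x c - e) * M x v))"
          by simp
      qed
      with relK'[OF that(1)] that(2) show ?thesis by simp
    qed
    show ?case
    proof (cases "\<exists>u\<in>L. u c \<noteq> 0")
      case False
      then have z: "v c = 0" if "v \<in> L" for v using that by blast
      have k0: "k x c = 0" if "x \<in> K" for x using nf[OF that] z by auto
      have eq: "(if 0 < m then {v\<in>L. v c = 0} else L) = L" using z by auto
      show ?thesis
      proof (rule Cons.IH[OF L c(2) fin])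
        show "normal_exp m L cs (k x)" if "x \<in> K" for x
          using nf[OF that] k0[OF that] eq by simp
        show "x = y" if "x \<in> K" "y \<in> K" "\<forall>c\<in>set cs. k x c = k y c" for x y
          using inj[OF that(1,2)] that k0 by simp
        show "(\<Sum>x\<in>K. d x * (\<Prod>c\<in>set cs. v c ^ k x c)) = 0" if "v \<in> L" for v
          using rel'[OF that] k0 by (simp add: M_def)
      qed (use le less.prems in auto)
    next
      case True
      then obtain u where u: "u \<in> L" "u c \<noteq> 0" by blast
      \<comment> \<open>The division was justified only off the hyperplane. Along the line
        \<open>v + s * u\<close> the coordinate \<open>c\<close> is nonzero for
        \<open>s \<noteq> 0\<close>, and continuity gives the value at \<open>s = 0\<close>.\<close>
      have all: "(\<Sum>x\<in>K'. d x * (v c ^ (k x c - e) * M x v)) = 0" if v: "v \<in> L" for v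
      proof (cases "v c = 0")
        case True
        define w where "w s = (\<lambda>i. v i + complex_of_real s * u i)" for s
        define g where "g s = (\<Sum>x\<in>K'. d x * (w s c ^ (k x c - e) * M x (w s)))" for s
        have "g 0 = 0"
        proof (rule isCont_eq_0_at_0)
          show "continuous_on UNIV g"
            unfolding g_def w_def M_def by (intro continuous_intros)
          show "g s = 0" if "s \<noteq> 0" for s
          proof -
            have "w s \<in> L" unfolding w_def by (intro csubspace_add[OF L v] csubspace_scale[OF L u(1)])
            moreover have "w s c \<noteq> 0" using True u that by (simp add: w_def)
            ultimately show ?thesis unfolding g_def by (rule nonzero)
          qed
        qed
        then show ?thesis by (simp add: g_def w_def)
      qed (use nonzero v in blast)
      \<comment> \<open>For \<open>e = m\<close> no larger exponent remains, so nothing has to be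
        restricted; this matches the recursion of \<open>normal_exp\<close>.\<close>
      define L' where "L' = (if e < m then {v\<in>L. v c = 0} else L)"
      have L'L: "L' \<subseteq> L" by (auto simp: L'_def)
      have relKe: "(\<Sum>x\<in>Ke. d x * M x v) = 0" if "v \<in> L'" for v
      proof -
        have "(\<Sum>x\<in>K'. d x * (v c ^ (k x c - e) * M x v)) = (\<Sum>x\<in>Ke. d x * M x v)"
        proof (rule sum.mono_neutral_cong_right)
          show "\<forall>x\<in>K' - Ke. d x * (v c ^ (k x c - e) * M x v) = 0"
          proof
            fix x assume x: "x \<in> K' - Ke"
            then have "e < k x c" "x \<in> K" by (auto simp: K'_def Ke_def)
            moreover from this have "e < m" using le[of x c] by simp
            then have "v c = 0" using that by (simp add: L'_def)
            ultimately show "d x * (v c ^ (k x c - e) * M x v) = 0" by simp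
          qed
        qed (use fin' in \<open>auto simp: K'_def Ke_def\<close>)
        with all that L'L show ?thesis by auto
      qed
      show ?thesis
      proof (rule Cons.IH[of L' Ke])
        show "csubspace L'" using L csubspace_hyperplane by (auto simp: L'_def)
        show "normal_exp m L' cs (k x)" if "x \<in> Ke" for x
          using nf[of x] that by (auto simp: Ke_def L'_def)
        show "x = y" if "x \<in> Ke" "y \<in> Ke" "\<forall>c\<in>set cs. k x c = k y c" for x y
          using inj[of x y] that by (auto simp: Ke_def)
        show "(\<Sum>x\<in>Ke. d x * (\<Prod>c\<in>set cs. v c ^ k x c)) = 0" if "v \<in> L'" for v
          using relKe[OF that] by (simp add: M_def)
      qed (use le less.prems fin' c in \<open>auto simp: Ke_def\<close>)
    qed
  qed
  show ?case by (rule vanish) (use Cons.prems in auto)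
qed

lemma normal_monomials_independent:
  fixes L :: "('n::finite \<Rightarrow> complex) set" and d :: "('n \<Rightarrow> nat) \<Rightarrow> complex"
  assumes "csubspace L" "distinct cs" "set cs = UNIV" "finite K"
    and "\<And>k c. k \<in> K \<Longrightarrow> k c \<le> m"
    and "\<And>k. k \<in> K \<Longrightarrow> normal_exp m L cs k"
    and "\<And>v. v \<in> L \<Longrightarrow> (\<Sum>k\<in>K. d k * mono_fun k v) = 0"
    and "k \<in> K"
  shows "d k = 0"
  by (rule normal_monomials_independent_aux[of L cs K "\<lambda>k. k" m d k])
    (use assms in \<open>auto simp: mono_fun_def\<close>)

text \<open>The hyperplane sections met along the recursion add up: vanishing of the coordinates
  passed with exponent below \<open>m\<close> is exactly the premise of the closure condition on the
  original \<open>L\<close>.\<close>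

lemma not_normal_exp_split:
  assumes "\<not> normal_exp m L cs k"
  obtains as c bs where "cs = as @ c # bs" "k c > 0" "c \<in> mclosure L {j\<in>set as. k j < m}"
proof -
  have "\<exists>as c bs. cs = as @ c # bs \<and> k c > 0 \<and> c \<in> mclosure L {j\<in>set as. k j < m}"
    using assms
  proof (induction cs arbitrary: L)
    case Nil
    then show ?case by simp
  next
    case (Cons a cs)
    show ?case
    proof (cases "k a = 0 \<or> (\<exists>v\<in>L. v a \<noteq> 0)")
      case False
      then have "k a > 0" "a \<in> mclosure L {j\<in>set []. k j < m}" by (auto simp: mclosure_def)
      then show ?thesis by (metis append_Nil)
    next
      case True
      with Cons.prems have "\<not> normal_exp m (if k a < m then {v\<in>L. v a = 0} else L) cs k" by simp
      from Cons.IH[OF this] obtain as c bs where *: "cs = as @ c # bs" "k c > 0"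
        "c \<in> mclosure (if k a < m then {v\<in>L. v a = 0} else L) {j\<in>set as. k j < m}" by blast
      from *(3) have "c \<in> mclosure L {j\<in>set (a # as). k j < m}"
        by (auto simp: mclosure_def split: if_splits)
      with * show ?thesis by (intro exI[of _ "a # as"] exI[of _ c] exI[of _ bs]) auto
    qed
  qed
  with that show thesis by blast
qed

definition exp_inc :: "('n \<Rightarrow> nat) \<Rightarrow> 'n \<Rightarrow> 'n \<Rightarrow> nat" where
  "exp_inc k i = k(i := Suc (k i))"

lemma mono_fun_exp_inc: "mono_fun (exp_inc k i) v = v i * mono_fun k v"
  for v :: "'n::finite \<Rightarrow> 'b::comm_monoid_mult"
proof -
  have "(\<Prod>x\<in>UNIV - {i}. v x ^ exp_inc k i x) = (\<Prod>x\<in>UNIV - {i}. v x ^ k x)"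
    by (rule prod.cong) (auto simp: exp_inc_def)
  then show ?thesis
    unfolding mono_fun_def
    by (subst (1 2) prod.remove[of UNIV i]) (auto simp: exp_inc_def mult_ac)
qed

text \<open>Circuit relations rewrite every exponent vector into normal ones, and the remaining
  normal combination vanishes on \<open>L\<close>, so its coefficients are zero. \<open>I\<close>
  need only be closed under sums and scalars and \<open>\<Psi>\<close> is arbitrary: the lemma is
  applied to chain monomials modulo \<open>ISE\<close> and to difference operators modulo higher
  order.\<close>

lemma monomial_relations_generated_by_circuits:
  fixes L :: "('n::finite \<Rightarrow> complex) set" and \<Psi> :: "('n \<Rightarrow> nat) \<Rightarrow> 'w mpoly"
  assumes L: "csubspace L" and \<alpha>: "circuit_coeffs L \<alpha>"
    and K: "finite K" "\<And>k c. k \<in> K \<Longrightarrow> k c \<le> m"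
    and swap: "\<And>k c j. exp_inc k c \<in> K \<Longrightarrow> j \<noteq> c \<Longrightarrow> k j < m \<Longrightarrow> exp_inc k j \<in> K"
    and I0: "0 \<in> I" and Iadd: "\<And>p q. p \<in> I \<Longrightarrow> q \<in> I \<Longrightarrow> p + q \<in> I"
    and Iscale: "\<And>b p. p \<in> I \<Longrightarrow> Const b * p \<in> I"
    and rel: "\<And>C k. matroid_circuit L C \<Longrightarrow> \<forall>i\<in>C. exp_inc k i \<in> K \<Longrightarrow>
      (\<Sum>i\<in>C. Const (\<alpha> C i) * \<Psi> (exp_inc k i)) \<in> I"
    and zero: "\<And>v. v \<in> L \<Longrightarrow> (\<Sum>k\<in>K. d k * mono_fun k v) = 0"
  shows "(\<Sum>k\<in>K. Const (d k) * \<Psi> k) \<in> I"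
proof -
  obtain cs :: "'n list" where cs: "set cs = UNIV" "distinct cs"
    using finite_distinct_list[of "UNIV :: 'n set"] by auto
  define N where "N = {k\<in>K. normal_exp m L cs k}"
  have finN: "finite N" using K by (simp add: N_def)
  \<comment> \<open>The same coefficients \<open>r\<close> must represent \<open>P\<close> modulo
    \<open>I\<close> and the function \<open>F\<close> on \<open>L\<close>. Keeping both together
    lets linear independence of functions act on the formal side at the end.\<close>
  define good where "good P F \<longleftrightarrow> (\<exists>r. P - (\<Sum>k\<in>N. Const (r k) * \<Psi> k) \<in> I \<and>
      (\<forall>v\<in>L. F v = (\<Sum>k\<in>N. r k * mono_fun k v)))" for P :: "'w mpoly" and F :: "('n \<Rightarrow> complex) \<Rightarrow> complex"
  have good_I: "good P (\<lambda>v. 0)" if "P \<in> I" for P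
    unfolding good_def using that by (intro exI[of _ "\<lambda>k. 0"]) simp
  have good_add: "good (P + Q) (\<lambda>v. F v + G v)" if PQ: "good P F" "good Q G" for P Q F G
  proof -
    from PQ obtain r r' where r: "P - (\<Sum>k\<in>N. Const (r k) * \<Psi> k) \<in> I"
        "\<forall>v\<in>L. F v = (\<Sum>k\<in>N. r k * mono_fun k v)"
      and r': "Q - (\<Sum>k\<in>N. Const (r' k) * \<Psi> k) \<in> I"
        "\<forall>v\<in>L. G v = (\<Sum>k\<in>N. r' k * mono_fun k v)"
      unfolding good_def by blast
    have "(P - (\<Sum>k\<in>N. Const (r k) * \<Psi> k)) + (Q - (\<Sum>k\<in>N. Const (r' k) * \<Psi> k))
        = P + Q - (\<Sum>k\<in>N. Const (r k + r' k) * \<Psi> k)"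
      by (simp add: Const_add distrib_right sum.distrib)
    with Iadd[OF r(1) r'(1)] r(2) r'(2) show ?thesis
      unfolding good_def
      by (intro exI[of _ "\<lambda>k. r k + r' k"]) (simp add: distrib_right sum.distrib)
  qed
  have good_scale: "good (Const b * P) (\<lambda>v. b * F v)" if P: "good P F" for P F b
  proof -
    from P obtain r where r: "P - (\<Sum>k\<in>N. Const (r k) * \<Psi> k) \<in> I"
        "\<forall>v\<in>L. F v = (\<Sum>k\<in>N. r k * mono_fun k v)"
      unfolding good_def by blast
    have "Const b * (P - (\<Sum>k\<in>N. Const (r k) * \<Psi> k))
        = Const b * P - (\<Sum>k\<in>N. Const (b * r k) * \<Psi> k)"
      by (simp add: Const_mult right_diff_distrib sum_distrib_left mult.assoc)
    with Iscale[OF r(1), of b] r(2) show ?thesis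
      unfolding good_def
      by (intro exI[of _ "\<lambda>k. b * r k"]) (simp add: sum_distrib_left mult.assoc)
  qed
  have good_sum: "good (\<Sum>x\<in>A. Const (b x) * P x) (\<lambda>v. \<Sum>x\<in>A. b x * F x v)"
    if "finite A" "\<And>x. x \<in> A \<Longrightarrow> good (P x) (F x)"
    for A :: "'x set" and b :: "'x \<Rightarrow> complex" and P :: "'x \<Rightarrow> 'w mpoly"
      and F :: "'x \<Rightarrow> ('n \<Rightarrow> complex) \<Rightarrow> complex"
    using that
  proof (induction A)
    case empty
    then show ?case using good_I[OF I0] by simp
  next
    case (insert x A)
    have "good (Const (b x) * P x + (\<Sum>x\<in>A. Const (b x) * P x))
        (\<lambda>v. b x * F x v + (\<Sum>x\<in>A. b x * F x v))"
      by (rule good_add[OF good_scale insert.IH]) (use insert.prems in auto)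
    then show ?case using insert.hyps by simp
  qed
  \<comment> \<open>The termination measure weights each exponent by the position of its coordinate.
    Replacing \<open>c\<close> by an earlier coordinate of a circuit lowers it.\<close>
  define pos where "pos c = length (takeWhile (\<lambda>x. x \<noteq> c) cs)" for c
  define wt where "wt k = (\<Sum>i\<in>UNIV. k i * pos i)" for k :: "'n \<Rightarrow> nat"
  have wt_inc: "wt (exp_inc k i) = wt k + pos i" for k i
  proof -
    have "exp_inc k i j * pos j = k j * pos j + (if j = i then pos j else 0)" for j
      by (simp add: exp_inc_def)
    then show ?thesis by (simp add: wt_def sum.distrib)
  qed
  have good_Psi: "good (\<Psi> k) (mono_fun k)" if "k \<in> K" for k
    using that
  proof (induction "wt k" arbitrary: k rule: less_induct)
    case less
    show ?case
    proof (cases "normal_exp m L cs k")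
      case True
      with less.prems have "k \<in> N" by (simp add: N_def)
      then have "(\<Sum>k'\<in>N. Const (if k' = k then 1 else 0) * \<Psi> k') = \<Psi> k"
        "(\<Sum>k'\<in>N. (if k' = k then 1 else 0) * mono_fun k' v) = mono_fun k v" for v :: "'n \<Rightarrow> complex"
        using finN by (simp_all add: if_distrib[of Const] if_distrib[of "\<lambda>x. x * _"] cong: if_cong)
      with I0 show ?thesis
        unfolding good_def by (intro exI[of _ "\<lambda>k'. if k' = k then 1 else 0"]) simp
    next
      case False
      then obtain as c bs where split: "cs = as @ c # bs" "k c > 0"
        "c \<in> mclosure L {j\<in>set as. k j < m}" by (rule not_normal_exp_split)
      have cas: "c \<notin> set as" using cs(2) split(1) by auto
      with circuit_in_closure[OF L split(3)] obtain C where
        C: "matroid_circuit L C" "c \<in> C" "C \<subseteq> insert c {j\<in>set as. k j < m}" by auto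
      \<comment> \<open>Taking one unit off \<open>c\<close> exposes \<open>k\<close> as the term of
        index \<open>c\<close> in the circuit relation at \<open>k0\<close>. The other terms stay
        within the bound because their coordinates satisfy \<open>k j < m\<close>.\<close>
      define k0 where "k0 = k(c := k c - 1)"
      have kk0: "k = exp_inc k0 c" using split(2) by (auto simp: k0_def exp_inc_def)
      have Cin: "j = c \<or> j \<noteq> c \<and> j \<in> set as \<and> k0 j < m" if "j \<in> C" for j
        using that C(3) cas by (auto simp: k0_def)
      have inK: "exp_inc k0 j \<in> K" if "j \<in> C" for j
        using Cin[OF that] swap[of k0 c j] less.prems kk0 by auto
      have poslt: "pos j < pos c" if "j \<in> set as" for j
      proof -
        have "takeWhile (\<lambda>x. x \<noteq> c) cs = as"
          unfolding split(1) using cas by (subst takeWhile_append2) auto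
        moreover have "takeWhile (\<lambda>x. x \<noteq> j) cs = takeWhile (\<lambda>x. x \<noteq> j) as"
          using that by (simp add: split(1))
        moreover have "length (takeWhile (\<lambda>x. x \<noteq> j) as) < length as"
        proof -
          from split_list_first[OF that] obtain xs ys where "as = xs @ j # ys" "j \<notin> set xs" by blast
          then show ?thesis by (subst \<open>as = _\<close>, subst takeWhile_append2) auto
        qed
        ultimately show ?thesis by (simp add: pos_def)
      qed
      have IH: "good (\<Psi> (exp_inc k0 j)) (mono_fun (exp_inc k0 j))" if "j \<in> C - {c}" for j
      proof (rule less.hyps)
        show "wt (exp_inc k0 j) < wt k"
          using Cin[of j] poslt that by (auto simp: kk0 wt_inc)
      qed (use inK that in auto)
      have ac: "\<alpha> C c \<noteq> 0" and sum0: "\<And>v. v \<in> L \<Longrightarrow> (\<Sum>i\<in>C. \<alpha> C i * v i) = 0"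
        using \<alpha> C unfolding circuit_coeffs_def by auto
      let ?R = "\<Sum>i\<in>C. Const (\<alpha> C i) * \<Psi> (exp_inc k0 i)"
      have "?R \<in> I" using rel[OF C(1)] inK by blast
      \<comment> \<open>The circuit relation solved for the term of index \<open>c\<close>: the
        first summand lies in \<open>I\<close>, the others have smaller weight.\<close>
      have "good (Const (1 / \<alpha> C c) * ?R + (\<Sum>j\<in>C - {c}. Const (- (\<alpha> C j / \<alpha> C c)) * \<Psi> (exp_inc k0 j)))
          (\<lambda>v. 1 / \<alpha> C c * 0 + (\<Sum>j\<in>C - {c}. - (\<alpha> C j / \<alpha> C c) * mono_fun (exp_inc k0 j) v))"
        by (intro good_add good_scale good_I \<open>?R \<in> I\<close> good_sum IH) auto
      moreover have "Const (1 / \<alpha> C c) * ?R + (\<Sum>j\<in>C - {c}. Const (- (\<alpha> C j / \<alpha> C c)) * \<Psi> (exp_inc k0 j)) = \<Psi> k"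
      proof -
        have "Const (1 / \<alpha> C c) * ?R = (\<Sum>i\<in>C. Const (\<alpha> C i / \<alpha> C c) * \<Psi> (exp_inc k0 i))"
          by (simp add: sum_distrib_left flip: mult.assoc Const_mult)
        also have "\<dots> = \<Psi> k + (\<Sum>i\<in>C - {c}. Const (\<alpha> C i / \<alpha> C c) * \<Psi> (exp_inc k0 i))"
          using C(2) ac by (subst sum.remove[of C c]) (auto simp: kk0)
        finally show ?thesis by (simp add: Const_uminus sum_negf)
      qed
      moreover have "(\<Sum>j\<in>C - {c}. - (\<alpha> C j / \<alpha> C c) * mono_fun (exp_inc k0 j) v) = mono_fun k v"
        if "v \<in> L" for v
      proof -
        have "(\<Sum>j\<in>C - {c}. \<alpha> C j * v j) = - (\<alpha> C c * v c)"
          using sum0[OF that] C(2) by (subst (asm) sum.remove[of C c]) (auto simp: eq_neg_iff_add_eq_0 add.commute)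
        then have "- (mono_fun k0 v / \<alpha> C c) * (\<Sum>j\<in>C - {c}. \<alpha> C j * v j) = v c * mono_fun k0 v"
          using ac by simp
        then show ?thesis
          by (simp add: kk0 mono_fun_exp_inc sum_distrib_left mult_ac)
      qed
      ultimately show ?thesis
        unfolding good_def by simp
    qed
  qed
  have "good (\<Sum>k\<in>K. Const (d k) * \<Psi> k) (\<lambda>v. \<Sum>k\<in>K. d k * mono_fun k v)"
    by (intro good_sum good_Psi K)
  then obtain r where r: "(\<Sum>k\<in>K. Const (d k) * \<Psi> k) - (\<Sum>k\<in>N. Const (r k) * \<Psi> k) \<in> I"
    "\<forall>v\<in>L. (\<Sum>k\<in>K. d k * mono_fun k v) = (\<Sum>k\<in>N. r k * mono_fun k v)"
    unfolding good_def by blast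
  \<comment> \<open>The left side of the second identity is zero by assumption, so the normal
    monomials would satisfy a relation on \<open>L\<close>.\<close>
  have "r k = 0" if "k \<in> N" for k
  proof (rule normal_monomials_independent[OF L cs(2,1) finN])
    show "(\<Sum>k\<in>N. r k * mono_fun k v) = 0" if "v \<in> L" for v
      using r(2) zero that by auto
  qed (use that K in \<open>auto simp: N_def\<close>)
  with r(1) show ?thesis by simp
qed

section \<open>The square-free Segre ideal\<close>

definition exp_add_set :: "('n \<Rightarrow> nat) \<Rightarrow> 'n set \<Rightarrow> 'n \<Rightarrow> nat" where
  "exp_add_set k S i = (if i \<in> S then Suc (k i) else k i)"

text \<open>The standard monomial of the toric relations: its factors are the level sets of
  \<open>k\<close>, a decreasing chain of subsets, so for \<open>k\<close> bounded by
  \<open>m\<close> it depends only on degree and exponent vector.\<close>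

definition chain_mono :: "nat \<Rightarrow> ('n \<Rightarrow> nat) \<Rightarrow> 'n set mpoly" where
  "chain_mono m k = (\<Prod>j\<in>{1..m}. Var {i. j \<le> k i})"

lemma chain_mono_Suc: "chain_mono (Suc m) k = chain_mono m k * Var {i. Suc m \<le> k i}"
  by (simp add: chain_mono_def atLeastAtMostSuc_conv mult.commute)

lemma chain_mono_0 [simp]: "chain_mono 0 k = 1"
  by (simp add: chain_mono_def)

lemma ISE_mult: "p \<in> ISE L \<alpha> \<Longrightarrow> q * p \<in> ISE L \<alpha>"
  and ISE_add: "p \<in> ISE L \<alpha> \<Longrightarrow> q \<in> ISE L \<alpha> \<Longrightarrow> p + q \<in> ISE L \<alpha>"
  and ISE_diff: "p \<in> ISE L \<alpha> \<Longrightarrow> q \<in> ISE L \<alpha> \<Longrightarrow> p - q \<in> ISE L \<alpha>"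
  and ISE_0: "0 \<in> ISE L \<alpha>"
  unfolding ISE_def by (rule gen_ideal_mult gen_ideal_add gen_ideal_diff gen_ideal_0; assumption)+

lemma ISE_sum: "(\<And>x. x \<in> A \<Longrightarrow> g x \<in> ISE L \<alpha>) \<Longrightarrow> sum g A \<in> ISE L \<alpha>"
  unfolding ISE_def by (rule gen_ideal_sum)

lemma ISE_toric: "Var S * Var T - Var (S \<union> T) * Var (S \<inter> T) \<in> ISE L \<alpha>"
  unfolding ISE_def by (rule gen_ideal_gen) blast

lemma ISE_fCA: "matroid_circuit L C \<Longrightarrow> A' \<inter> C = {} \<Longrightarrow> fCA \<alpha> C A' \<in> ISE L \<alpha>"
  unfolding ISE_def by (rule gen_ideal_gen) blast

lemma ISE_trans: "p - q \<in> ISE L \<alpha> \<Longrightarrow> q - r \<in> ISE L \<alpha> \<Longrightarrow> p - r \<in> ISE L \<alpha>"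
  using ISE_add[of "p - q" L \<alpha> "q - r"] by simp

text \<open>The set \<open>S\<close> is pushed through the chain from the largest level set on. At
  each level the toric relation leaves the union, which is the new level set, and passes the
  intersection on.\<close>

lemma chain_mono_times_Var_aux:
  "chain_mono r k * Var S - chain_mono r (exp_add_set k S) * Var (S \<inter> {i. r \<le> k i}) \<in> ISE L \<alpha>"
proof (induction r)
  case 0
  then show ?case by (simp add: ISE_0)
next
  case (Suc r)
  let ?k' = "exp_add_set k S"
  let ?T = "\<lambda>j. {i. j \<le> k i}"
  have un: "(S \<inter> ?T r) \<union> ?T (Suc r) = {i. Suc r \<le> ?k' i}"
    and int: "(S \<inter> ?T r) \<inter> ?T (Suc r) = S \<inter> ?T (Suc r)"
    by (auto simp: exp_add_set_def)
  have "chain_mono (Suc r) k * Var S - chain_mono r ?k' * (Var (S \<inter> ?T r) * Var (?T (Suc r))) \<in> ISE L \<alpha>"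
    using ISE_mult[OF Suc, of "Var (?T (Suc r))"]
    by (simp add: chain_mono_Suc right_diff_distrib mult_ac)
  moreover have "chain_mono r ?k' * (Var (S \<inter> ?T r) * Var (?T (Suc r)))
      - chain_mono (Suc r) ?k' * Var (S \<inter> ?T (Suc r)) \<in> ISE L \<alpha>"
    using ISE_mult[OF ISE_toric[of "S \<inter> ?T r" "?T (Suc r)" L \<alpha>], of "chain_mono r ?k'"]
    unfolding un int by (simp add: chain_mono_Suc right_diff_distrib mult_ac)
  ultimately show ?case by (rule ISE_trans)
qed

text \<open>As no exponent exceeds \<open>r\<close>, what is left after the last level is precisely
  level \<open>Suc r\<close> of the new exponent vector.\<close>

lemma chain_mono_times_Var:
  assumes "\<And>i. k i \<le> r"
  shows "chain_mono r k * Var S - chain_mono (Suc r) (exp_add_set k S) \<in> ISE L \<alpha>"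
proof -
  have "i \<in> S" if "Suc r \<le> k i" for i
    using assms[of i] that by simp
  then have "S \<inter> {i. r \<le> k i} = {i. Suc r \<le> exp_add_set k S i}"
    by (auto simp: exp_add_set_def)
  with chain_mono_times_Var_aux[of r k S L \<alpha>] show ?thesis by (simp add: chain_mono_Suc)
qed

section \<open>Straightening monomials into chains\<close>

definition zdeg :: "('n::finite set \<Rightarrow>\<^sub>0 nat) \<Rightarrow> nat" where
  "zdeg m = (\<Sum>S\<in>UNIV. lookup m S)"

definition zexp :: "('n::finite set \<Rightarrow>\<^sub>0 nat) \<Rightarrow> 'n \<Rightarrow> nat" where
  "zexp m i = (\<Sum>S | i \<in> S. lookup m S)"

lemma zexp_le_zdeg: "zexp m i \<le> zdeg m"
  unfolding zdeg_def zexp_def by (rule sum_mono2) auto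

lemma zdeg_add: "zdeg (m + m') = zdeg m + zdeg m'"
  by (simp add: zdeg_def lookup_add sum.distrib)

lemma zdeg_single: "zdeg (single S k) = k"
  by (simp add: zdeg_def lookup_single when_def)

lemma zexp_add_single: "zexp (m + single S 1) = exp_add_set (zexp m) S"
  by (rule ext) (auto simp: zexp_def exp_add_set_def lookup_add sum.distrib lookup_single when_def)

text \<open>The variables are split off one at a time and inserted into the chain of the rest;
  \<open>zexp_le_zdeg\<close> provides the bound that insertion needs.\<close>

lemma monomial_straighten: "mono_val Var m - chain_mono (zdeg m) (zexp m) \<in> ISE L \<alpha>"
proof (induction "zdeg m" arbitrary: m)
  case 0
  then have "m = 0" by (intro poly_mapping_eqI) (simp add: zdeg_def)
  then show ?case by (simp add: zdeg_def ISE_0)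
next
  case (Suc d)
  have "\<exists>S. lookup m S \<noteq> 0"
  proof (rule ccontr)
    assume "\<not> ?thesis"
    with Suc.hyps(2) show False by (simp add: zdeg_def)
  qed
  then obtain S where S: "lookup m S \<noteq> 0" by blast
  define m' where "m' = m - single S 1"
  have m: "m = m' + single S 1"
    using S by (intro poly_mapping_eqI) (auto simp: m'_def lookup_add lookup_minus lookup_single when_def)
  then have d: "zdeg m = Suc (zdeg m')" by (simp add: zdeg_add zdeg_single)
  with Suc.hyps have "mono_val Var m' - chain_mono (zdeg m') (zexp m') \<in> ISE L \<alpha>" by simp
  from ISE_mult[OF this, of "Var S"]
  have "mono_val Var m - chain_mono (zdeg m') (zexp m') * Var S \<in> ISE L \<alpha>"
    by (simp add: m mono_val_add right_diff_distrib mult.commute)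
  moreover have "chain_mono (zdeg m') (zexp m') * Var S - chain_mono (zdeg m) (zexp m) \<in> ISE L \<alpha>"
    unfolding d unfolding m zexp_add_single by (rule chain_mono_times_Var[OF zexp_le_zdeg])
  ultimately show ?case by (rule ISE_trans)
qed

lemma mono_fun_exp_add_set:
  "mono_fun (exp_add_set k S) v = mono_fun k v * (\<Prod>i\<in>S. v i)"
  for v :: "'n::finite \<Rightarrow> 'b::comm_monoid_mult"
proof -
  have "(\<Prod>i\<in>S. v i) = (\<Prod>i\<in>UNIV. if i \<in> S then v i else 1)"
    by (simp add: prod.If_cases)
  then show ?thesis
    unfolding mono_fun_def by (simp add: exp_add_set_def flip: prod.distrib) (rule prod.cong, auto simp: mult_ac)
qed

text \<open>Stated over semirings because it is used both for points of the affine cone and for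
  products of linear forms with \<open>x_0\<close> in place of \<open>t\<close>.\<close>

lemma mono_val_segre:
  fixes m :: "'n::finite set \<Rightarrow>\<^sub>0 nat" and v :: "'n \<Rightarrow> 'b::comm_semiring_1"
  shows "mono_val (\<lambda>S. t * (\<Prod>i\<in>S. v i)) m = t ^ zdeg m * mono_fun (zexp m) v"
proof -
  have "(\<Prod>S\<in>UNIV. \<Prod>i\<in>S. v i ^ lookup m S) = (\<Prod>S\<in>UNIV. \<Prod>i\<in>UNIV. if i \<in> S then v i ^ lookup m S else 1)"
    by (simp add: prod.If_cases)
  also have "\<dots> = (\<Prod>i\<in>UNIV. \<Prod>S\<in>UNIV. if i \<in> S then v i ^ lookup m S else 1)"
    by (rule prod.swap)
  also have "\<dots> = mono_fun (zexp m) v"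
    unfolding mono_fun_def zexp_def by (simp add: prod.If_cases power_sum)
  finally show ?thesis
    by (simp add: mono_val_UNIV power_mult_distrib prod.distrib zdeg_def power_sum flip: prod_power_distrib)
qed

lemma finite_bounded_exps: "finite {k :: 'n::finite \<Rightarrow> nat. \<forall>i. k i \<le> D}"
proof -
  have "{k :: 'n \<Rightarrow> nat. \<forall>i. k i \<le> D} = PiE UNIV (\<lambda>_. {..D})"
    by (auto simp: PiE_def)
  then show ?thesis by (simp add: finite_PiE)
qed

text \<open>The coordinates \<open>A\<close> already at the bound \<open>D\<close> are disjoint from
  \<open>C\<close>, whose members must still grow. Lowering \<open>A\<close> by one leaves a chain
  of degree \<open>D - 1\<close>, and its product with the generator \<open>fCA \<alpha> C A\<close>
  straightens to the desired sum.\<close>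

lemma chain_mono_circuit_relation:
  fixes L :: "('n::finite \<Rightarrow> complex) set"
  assumes C: "matroid_circuit L C" and k: "\<And>i j. i \<in> C \<Longrightarrow> exp_inc k i j \<le> D"
  shows "(\<Sum>i\<in>C. Const (\<alpha> C i) * chain_mono D (exp_inc k i)) \<in> ISE L \<alpha>"
proof (cases "C = {}")
  case True
  then show ?thesis by (simp add: ISE_0)
next
  case False
  have lt: "k j < D" if "j \<in> C" for j
    using k[OF that, of j] by (simp add: exp_inc_def)
  have le: "k j \<le> D" for j
  proof -
    from False obtain i where "i \<in> C" by blast
    from k[OF this, of j] show ?thesis by (simp add: exp_inc_def split: if_splits)
  qed
  from False lt obtain D' where D': "D = Suc D'" by (metis all_not_in_conv gr0_implies_Suc less_zeroE not_gr_zero)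
  define A where "A = {i. k i = D}"
  have AC: "A \<inter> C = {}" using lt by (auto simp: A_def)
  define k' where "k' i = (if i \<in> A then k i - 1 else k i)" for i
  have k': "k' i \<le> D'" for i
    using le[of i] by (auto simp: k'_def A_def D')
  have inc: "exp_add_set k' (A \<union> {i}) = exp_inc k i" if "i \<in> C" for i
    using that AC by (auto simp: fun_eq_iff exp_add_set_def exp_inc_def k'_def) (auto simp: A_def D')
  have "(\<Sum>i\<in>C. Const (\<alpha> C i) * (chain_mono D' k' * Var (A \<union> {i}) - chain_mono D (exp_inc k i))) \<in> ISE L \<alpha>"
    using chain_mono_times_Var[OF k'] by (intro ISE_sum ISE_mult) (simp add: D' flip: inc)
  moreover have "chain_mono D' k' * fCA \<alpha> C A \<in> ISE L \<alpha>"
    by (intro ISE_mult ISE_fCA C AC)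
  ultimately have "chain_mono D' k' * fCA \<alpha> C A
      - (\<Sum>i\<in>C. Const (\<alpha> C i) * (chain_mono D' k' * Var (A \<union> {i}) - chain_mono D (exp_inc k i))) \<in> ISE L \<alpha>"
    by (intro ISE_diff)
  also have "chain_mono D' k' * fCA \<alpha> C A
      - (\<Sum>i\<in>C. Const (\<alpha> C i) * (chain_mono D' k' * Var (A \<union> {i}) - chain_mono D (exp_inc k i)))
      = (\<Sum>i\<in>C. Const (\<alpha> C i) * chain_mono D (exp_inc k i))"
    by (simp add: fCA_def right_diff_distrib sum_subtractf sum_distrib_left mult_ac)
  finally show ?thesis .
qed

text \<open>For fixed \<open>v\<close> the value is a polynomial in \<open>t\<close>; vanishing for
  all \<open>t\<close> means that each of its coefficients, one for each degree \<open>D\<close>,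
  vanishes.\<close>

lemma evalp_segre_eq_0_iff:
  "(\<forall>t. evalp (\<lambda>S. t * (\<Prod>i\<in>S. v i)) p = 0)
    \<longleftrightarrow> (\<forall>D. (\<Sum>m | m \<in> keys p \<and> zdeg m = D. lookup p m * mono_fun (zexp m) v) = 0)"
  for v :: "'n::finite \<Rightarrow> complex"
proof -
  define c where "c D = (\<Sum>m | m \<in> keys p \<and> zdeg m = D. lookup p m * mono_fun (zexp m) v)" for D
  define n where "n = Max (insert 0 (zdeg ` keys p))"
  have n: "zdeg m \<le> n" if "m \<in> keys p" for m using that by (simp add: n_def)
  have eq: "evalp (\<lambda>S. t * (\<Prod>i\<in>S. v i)) p = (\<Sum>D\<le>n. c D * t ^ D)" for t
  proof -
    have "evalp (\<lambda>S. t * (\<Prod>i\<in>S. v i)) p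
        = (\<Sum>m\<in>keys p. lookup p m * mono_fun (zexp m) v * t ^ zdeg m)"
      unfolding evalp_def mono_val_def[symmetric] mono_val_segre by (simp add: mult_ac)
    also have "\<dots> = (\<Sum>D\<le>n. \<Sum>m | m \<in> keys p \<and> zdeg m = D. lookup p m * mono_fun (zexp m) v * t ^ zdeg m)"
      by (rule sum.group[symmetric]) (use n in auto)
    also have "\<dots> = (\<Sum>D\<le>n. c D * t ^ D)"
      by (simp add: c_def sum_distrib_right)
    finally show ?thesis .
  qed
  have "c D = 0" if "D > n" for D
  proof -
    have "{m. m \<in> keys p \<and> zdeg m = D} = {}" using n that by fastforce
    then show ?thesis by (simp only: c_def sum.empty)
  qed
  then have "(\<forall>D. c D = 0) \<longleftrightarrow> (\<forall>D\<le>n. c D = 0)" by (meson not_le)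
  then show ?thesis
    by (simp add: eq polyfun_eq_0 flip: c_def)
qed

text \<open>In each degree a polynomial vanishing on the cone gives a linear relation between the
  monomials on \<open>L\<close>, to which the circuit theorem applies with
  \<open>\<Psi> = chain_mono D\<close>. Straightening then turns the chains back into the original
  monomials.\<close>

lemma IY_subset_ISE:
  fixes L :: "('n::finite \<Rightarrow> complex) set"
  assumes L: "csubspace L" and \<alpha>: "circuit_coeffs L \<alpha>" and p: "p \<in> IY L"
  shows "p \<in> ISE L \<alpha>"
proof -
  let ?K = "\<lambda>D. {k :: 'n \<Rightarrow> nat. \<forall>i. k i \<le> D}"
  have deg: "(\<Sum>m | m \<in> keys p \<and> zdeg m = D. Const (lookup p m) * chain_mono D (zexp m)) \<in> ISE L \<alpha>" for D
  proof -
    \<comment> \<open>Distinct monomials in the \<open>z\<close> variables may have the same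
      exponent vector; only their total coefficient is visible on \<open>L\<close>.\<close>
    define d where "d k = (\<Sum>m | m \<in> {m\<in>keys p. zdeg m = D} \<and> zexp m = k. lookup p m)" for k
    have "(\<Sum>k\<in>?K D. Const (d k) * chain_mono D k) \<in> ISE L \<alpha>"
    proof (rule monomial_relations_generated_by_circuits[OF L \<alpha> finite_bounded_exps])
      show "exp_inc k j \<in> ?K D" if "exp_inc k c \<in> ?K D" "j \<noteq> c" "k j < D" for k c j
      proof -
        have "k i \<le> D" for i
          using that(1) by (auto simp: exp_inc_def split: if_splits dest!: spec[of _ i])
        with that(3) show ?thesis by (auto simp: exp_inc_def)
      qed
      show "(\<Sum>k\<in>?K D. d k * mono_fun k v) = 0" if "v \<in> L" for v
      proof -
        have "(\<Sum>k\<in>?K D. d k * mono_fun k v)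
            = (\<Sum>k\<in>?K D. \<Sum>m | m \<in> {m\<in>keys p. zdeg m = D} \<and> zexp m = k. lookup p m * mono_fun (zexp m) v)"
          by (simp add: d_def sum_distrib_right)
        also have "\<dots> = (\<Sum>m\<in>{m\<in>keys p. zdeg m = D}. lookup p m * mono_fun (zexp m) v)"
          using zexp_le_zdeg by (intro sum.group finite_bounded_exps) auto
        also have "\<dots> = 0"
          using p that evalp_segre_eq_0_iff[of v p] by (auto simp: IY_def)
        finally show ?thesis .
      qed
    qed (auto intro: ISE_0 ISE_add ISE_mult chain_mono_circuit_relation)
    also have "(\<Sum>k\<in>?K D. Const (d k) * chain_mono D k)
        = (\<Sum>k\<in>?K D. \<Sum>m | m \<in> {m\<in>keys p. zdeg m = D} \<and> zexp m = k. Const (lookup p m) * chain_mono D (zexp m))"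
      by (simp add: d_def sum_distrib_right Const_sum)
    also have "\<dots> = (\<Sum>m\<in>{m\<in>keys p. zdeg m = D}. Const (lookup p m) * chain_mono D (zexp m))"
      using zexp_le_zdeg by (intro sum.group finite_bounded_exps) auto
    finally show ?thesis by simp
  qed
  have "(\<Sum>m\<in>keys p. Const (lookup p m) * chain_mono (zdeg m) (zexp m))
      = (\<Sum>D\<in>zdeg ` keys p. \<Sum>m | m \<in> keys p \<and> zdeg m = D. Const (lookup p m) * chain_mono (zdeg m) (zexp m))"
    by (rule sum.group[symmetric]) auto
  also have "\<dots> = (\<Sum>D\<in>zdeg ` keys p. \<Sum>m | m \<in> keys p \<and> zdeg m = D. Const (lookup p m) * chain_mono D (zexp m))"
    by (intro sum.cong) auto
  also have "\<dots> \<in> ISE L \<alpha>" by (intro ISE_sum deg)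
  finally have chains: "(\<Sum>m\<in>keys p. Const (lookup p m) * chain_mono (zdeg m) (zexp m)) \<in> ISE L \<alpha>" .
  have "(\<Sum>m\<in>keys p. Const (lookup p m) * (mono_val Var m - chain_mono (zdeg m) (zexp m))) \<in> ISE L \<alpha>"
    by (intro ISE_sum ISE_mult monomial_straighten)
  note ISE_add[OF this chains]
  moreover have "(\<Sum>m\<in>keys p. Const (lookup p m) * (mono_val Var m - chain_mono (zdeg m) (zexp m)))
      + (\<Sum>m\<in>keys p. Const (lookup p m) * chain_mono (zdeg m) (zexp m))
      = (\<Sum>m\<in>keys p. single m (lookup p m))"
    by (simp add: single_eq_Const_mono_val right_diff_distrib sum_subtractf)
  ultimately show ?thesis by (simp add: sum_monomials)
qed

section \<open>The kernel of \<open>phiL\<close> modulo the circuit ideal\<close>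

lemma phiL_eq_prod: "phiL S = (\<Prod>i\<in>UNIV. if i \<in> S then xv i else yv i)"
  by (simp add: phiL_def prod.If_cases)

text \<open>All terms share the factor from the coordinates outside \<open>C\<close>:
  \<open>x\<close> on \<open>A\<close>, \<open>y\<close> elsewhere.\<close>

lemma subst_phiL_fCA:
  assumes "A \<inter> C = {}"
  shows "subst phiL (fCA \<alpha> C A) = ((\<Prod>i\<in>A. xv i) * (\<Prod>j\<in>- (A \<union> C). yv j)) * ftilde \<alpha> C"
proof -
  have "phiL (A \<union> {i}) = ((\<Prod>i\<in>A. xv i) * (\<Prod>j\<in>- (A \<union> C). yv j)) * (xv i * (\<Prod>j\<in>C - {i}. yv j))"
    if "i \<in> C" for i
  proof -
    have "- (A \<union> {i}) = - (A \<union> C) \<union> (C - {i})" using assms that by auto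
    moreover have "(\<Prod>j\<in>- (A \<union> C) \<union> (C - {i}). yv j) = (\<Prod>j\<in>- (A \<union> C). yv j) * (\<Prod>j\<in>C - {i}. yv j)"
      by (rule prod.union_disjoint) auto
    moreover have "i \<notin> A" using assms that by auto
    ultimately show ?thesis by (simp add: phiL_def mult_ac)
  qed
  then show ?thesis
    by (simp add: fCA_def ftilde_def sb.ins_simps sum_distrib_left mult_ac)
qed

text \<open>The toric binomials map to zero, compared coordinate by coordinate, and the circuit
  generators map to multiples of \<open>ftilde\<close>.\<close>

lemma subst_phiL_ISE:
  assumes "p \<in> ISE L \<alpha>"
  shows "subst phiL p \<in> Itilde L \<alpha>"
  using assms unfolding ISE_def
proof (induction rule: gen_ideal_induct)
  case zero
  show ?case by (simp add: Itilde_def)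
next
  case (add p q)
  then show ?case by (simp add: Itilde_def sb.ins_add gen_ideal_add)
next
  case (mult g r)
  have "subst phiL g \<in> Itilde L \<alpha>"
    using mult
  proof
    assume "g \<in> {Var S * Var T - Var (S \<union> T) * Var (S \<inter> T) | S T. True}"
    then obtain S T where g: "g = Var S * Var T - Var (S \<union> T) * Var (S \<inter> T)" by blast
    have "phiL S * phiL T = phiL (S \<union> T) * phiL (S \<inter> T)"
      unfolding phiL_eq_prod prod.distrib[symmetric] by (rule prod.cong) auto
    then show ?thesis by (simp add: g sb.ins_simps Itilde_def)
  next
    assume "g \<in> {fCA \<alpha> C A' | C A'. matroid_circuit L C \<and> A' \<inter> C = {}}"
    then obtain C A' where "g = fCA \<alpha> C A'" "matroid_circuit L C" "A' \<inter> C = {}" by blast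
    then show ?thesis
      unfolding Itilde_def \<open>g = _\<close> subst_phiL_fCA[OF \<open>A' \<inter> C = {}\<close>]
      by (intro gen_ideal_mult gen_ideal_gen) blast
  qed
  then show ?case by (simp add: sb.ins_mult Itilde_def gen_ideal_mult)
qed

text \<open>With \<open>x_i = y_i * a_i\<close> each \<open>ftilde\<close> becomes the circuit
  relation at \<open>a\<close> times the product of the \<open>y_j\<close> over
  \<open>C\<close>.\<close>

lemma evalp_Itilde:
  fixes L :: "('n::finite \<Rightarrow> complex) set"
  assumes "p \<in> Itilde L \<alpha>" "circuit_coeffs L \<alpha>" "a \<in> L" "\<And>i. f (Inl i) = f (Inr i) * a i"
  shows "evalp f p = 0"
  using assms(1) unfolding Itilde_def
proof (induction rule: gen_ideal_induct)
  case (mult g r)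
  then obtain C where C: "g = ftilde \<alpha> C" "matroid_circuit L C" by blast
  have "(\<Sum>i\<in>C. \<alpha> C i * f (Inl i) * (\<Prod>j\<in>C - {i}. f (Inr j)))
      = (\<Sum>i\<in>C. \<alpha> C i * a i) * (\<Prod>j\<in>C. f (Inr j))"
    unfolding sum_distrib_right
  proof (rule sum.cong[OF refl])
    fix i assume "i \<in> C"
    then have "(\<Prod>j\<in>C. f (Inr j)) = f (Inr i) * (\<Prod>j\<in>C - {i}. f (Inr j))"
      by (simp add: prod.remove)
    then show "\<alpha> C i * f (Inl i) * (\<Prod>j\<in>C - {i}. f (Inr j)) = \<alpha> C i * a i * (\<Prod>j\<in>C. f (Inr j))"
      by (simp add: assms(4) mult_ac)
  qed
  moreover have "(\<Sum>i\<in>C. \<alpha> C i * a i) = 0"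
    using assms(2,3) C(2) by (simp add: circuit_coeffs_def)
  ultimately show ?case
    by (simp add: C(1) ev.ins_mult) (simp add: ftilde_def xv_def yv_def ev.ins_simps)
qed (simp_all add: ev.ins_add)

text \<open>Every point of the affine cone, including the scalar \<open>t\<close>, arises as the
  values of all \<open>phiL S\<close> at a point with \<open>x_i = y_i * a_i\<close>, where the
  circuit ideal vanishes.\<close>

lemma Itilde_kernel_subset_IY:
  fixes L :: "('n::finite \<Rightarrow> complex) set"
  assumes p: "subst phiL p \<in> Itilde L \<alpha>" and \<alpha>: "circuit_coeffs L \<alpha>"
  shows "p \<in> IY L"
  unfolding IY_def
proof (intro CollectI ballI allI)
  fix a :: "'n \<Rightarrow> complex" and t :: complex assume a: "a \<in> L"
  obtain i0 :: 'n where True by blast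
  \<comment> \<open>The scalar \<open>t\<close> is placed in a single coordinate, so that the
    product of all \<open>s i\<close> is \<open>t\<close>, even for \<open>t = 0\<close>.\<close>
  define s where "s i = (if i = i0 then t else 1)" for i
  define f where "f = case_sum (\<lambda>i. s i * a i) s"
  have s: "(\<Prod>i\<in>UNIV. s i) = t" by (simp add: s_def)
  have "evalp f (phiL S) = t * (\<Prod>i\<in>S. a i)" for S
  proof -
    have "evalp f (phiL S) = (\<Prod>i\<in>UNIV. s i * (if i \<in> S then a i else 1))"
      unfolding phiL_eq_prod by (auto simp: ev.ins_simps xv_def yv_def f_def intro!: prod.cong)
    then show ?thesis by (simp add: prod.distrib s prod.If_cases)
  qed
  then have "evalp (\<lambda>S. t * (\<Prod>i\<in>S. a i)) p = evalp f (subst phiL p)"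
    by (simp add: evalp_subst)
  also have "\<dots> = 0"
    by (rule evalp_Itilde[OF p \<alpha> a]) (simp add: f_def)
  finally show "evalp (\<lambda>S. t * (\<Prod>i\<in>S. a i)) p = 0" .
qed

section \<open>The apolar pairing and difference operators\<close>

text \<open>No coordinate of a full coordinate space lies in the closure of the earlier ones. This
  specialises the independence theorem to ordinary monomials.\<close>

lemma normal_exp_full:
  assumes "distinct cs" "{v. \<forall>i. i \<notin> set cs \<longrightarrow> v i = 0} \<subseteq> L"
  shows "normal_exp m L cs k"
  using assms
proof (induction cs arbitrary: L)
  case (Cons c cs)
  let ?e = "\<lambda>i. if i = c then 1 else (0::complex)"
  have "?e \<in> L" using Cons.prems(2) by auto
  then have "\<exists>v\<in>L. v c \<noteq> 0" by (intro bexI[of _ ?e]) simp_all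
  moreover have "normal_exp m {v\<in>L. v c = 0} cs k"
    by (rule Cons.IH) (use Cons.prems in auto)
  moreover have "normal_exp m L cs k"
    by (rule Cons.IH) (use Cons.prems in auto)
  ultimately show ?case by simp
qed simp

text \<open>Linear independence of all monomials as functions, obtained from normal monomials on the
  whole space.\<close>

lemma mpoly_eq_0_if_evalp_0:
  fixes q :: "'v::finite mpoly"
  assumes "\<And>x. evalp x q = 0"
  shows "q = 0"
proof (rule poly_mapping_eqI)
  fix m0
  obtain cs :: "'v list" where cs: "set cs = UNIV" "distinct cs"
    using finite_distinct_list[of "UNIV :: 'v set"] by auto
  have "lookup q m0 = 0" if "m0 \<in> keys q"
  proof (rule normal_monomials_independent_aux[where L = UNIV and cs = cs and K = "keys q" and k = lookup and x = m0])
    show "csubspace UNIV" by (simp add: csubspace_def)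
    show "lookup x c \<le> Max ((\<lambda>(m, v). lookup m v) ` (keys q \<times> UNIV))" if "x \<in> keys q" for x c
      using that by (intro Max_ge) (auto intro!: image_eqI[of _ _ "(x, c)"])
    show "normal_exp (Max ((\<lambda>(m, v). lookup m v) ` (keys q \<times> UNIV))) UNIV cs (lookup x)" for x
      by (rule normal_exp_full) (use cs in auto)
    show "x = y" if "\<forall>c\<in>set cs. lookup x c = lookup y c" for x y :: "'v \<Rightarrow>\<^sub>0 nat"
      using that cs by (intro poly_mapping_eqI) auto
    show "(\<Sum>x\<in>keys q. lookup q x * (\<Prod>c\<in>set cs. v c ^ lookup x c)) = 0" for v
      using assms[of v] by (simp add: cs evalp_def mono_val_UNIV flip: mono_val_def)
  qed (use that cs in auto)
  then show "lookup q m0 = lookup 0 m0"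
    by (cases "m0 \<in> keys q") (auto simp: not_in_keys_iff_lookup_eq_zero)
qed

text \<open>Linear extension of values on monomials. Both the apolar pairing and the evaluation
  functionals are of this form.\<close>

definition lin_ext :: "(('v \<Rightarrow>\<^sub>0 nat) \<Rightarrow> complex) \<Rightarrow> 'v mpoly \<Rightarrow> complex" where
  "lin_ext \<phi> p = (\<Sum>m\<in>keys p. lookup p m * \<phi> m)"

lemma lin_ext_superset:
  "finite K \<Longrightarrow> keys p \<subseteq> K \<Longrightarrow> lin_ext \<phi> p = (\<Sum>m\<in>K. lookup p m * \<phi> m)"
  unfolding lin_ext_def
  by (rule sum.mono_neutral_left) (auto simp: not_in_keys_iff_lookup_eq_zero)

lemma lin_ext_0 [simp]: "lin_ext \<phi> 0 = 0"
  by (simp add: lin_ext_def)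

lemma lin_ext_add: "lin_ext \<phi> (p + q) = lin_ext \<phi> p + lin_ext \<phi> q"
proof -
  have "keys (p + q) \<subseteq> keys p \<union> keys q" by (rule keys_add)
  then show ?thesis
    by (simp add: lin_ext_superset[of "keys p \<union> keys q"] lookup_add distrib_right sum.distrib)
qed

lemma lin_ext_single: "lin_ext \<phi> (single m c) = c * \<phi> m"
  by (cases "c = 0") (simp_all add: lin_ext_def)

lemma keys_Const_times: "keys (Const c * p) \<subseteq> keys p"
  by (auto simp: in_keys_iff lookup_Const_times)

lemma lin_ext_Const_times: "lin_ext \<phi> (Const c * p) = c * lin_ext \<phi> p"
  by (simp add: lin_ext_superset[OF finite_keys keys_Const_times] lookup_Const_times
      mult.assoc flip: sum_distrib_left) (simp add: lin_ext_def)

lemma lin_ext_sum: "lin_ext \<phi> (sum f A) = (\<Sum>x\<in>A. lin_ext \<phi> (f x))"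
  by (induction A rule: infinite_finite_induct) (simp_all add: lin_ext_add)

lemma lin_ext_diff: "lin_ext \<phi> (p - q) = lin_ext \<phi> p - lin_ext \<phi> q"
  using lin_ext_add[of \<phi> "p - q" q] by simp

lemma lin_ext_comb: "lin_ext (\<lambda>m. \<Sum>x\<in>A. c x * \<phi> x m) p = (\<Sum>x\<in>A. c x * lin_ext (\<phi> x) p)"
  unfolding lin_ext_def sum_distrib_left by (subst sum.swap) (simp add: mult_ac)

definition mono_fact :: "('v \<Rightarrow>\<^sub>0 nat) \<Rightarrow> complex" where
  "mono_fact m = (\<Prod>v\<in>keys m. fact (lookup m v))"

lemma mono_fact_UNIV: "mono_fact m = (\<Prod>v\<in>UNIV. fact (lookup m v))" for m :: "'v::finite \<Rightarrow>\<^sub>0 nat"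
  unfolding mono_fact_def
  by (rule prod.mono_neutral_left) (auto simp: not_in_keys_iff_lookup_eq_zero)

lemma mono_fact_nonzero: "mono_fact m \<noteq> 0"
  by (simp add: mono_fact_def)

text \<open>Distinct monomials are orthogonal and a monomial pairs with itself to the product of the
  factorials of its exponents; by \<open>lookup_diffop_0\<close> this is the pairing in the inverse
  system.\<close>

definition apolar :: "'v mpoly \<Rightarrow> 'v mpoly \<Rightarrow> complex" where
  "apolar f g = lin_ext (\<lambda>m. lookup g m * mono_fact m) f"

lemma lookup_diffop_0: "lookup (diffop f g) 0 = apolar f g"
proof -
  have dm: "lookup (dmono m g) 0 = lookup g m * mono_fact m" for m
  proof -
    let ?S = "{m'\<in>keys g. \<forall>v. lookup m v \<le> lookup m' v}"
    let ?c = "\<lambda>m'. lookup g m' * (\<Prod>v\<in>keys m. of_nat (fact (lookup m' v) div fact (lookup m' v - lookup m v)))"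
    have "lookup (monom (m' - m) (?c m')) 0 = (if m' = m then ?c m else 0)" if "m' \<in> ?S" for m'
    proof -
      have "m' - m = 0 \<longleftrightarrow> m' = m"
      proof
        assume "m' - m = 0"
        then have "lookup m' v - lookup m v = 0" for v
          by (metis lookup_minus lookup_zero)
        with that show "m' = m" by (intro poly_mapping_eqI) (simp add: le_antisym)
      qed simp
      then show ?thesis by (auto simp: monom_def lookup_single when_def)
    qed
    then have "lookup (dmono m g) 0 = (\<Sum>m'\<in>?S. if m' = m then ?c m else 0)"
      unfolding dmono_def lookup_sum by (rule sum.cong[OF refl])
    also have "\<dots> = ?c m"
      by (auto simp: not_in_keys_iff_lookup_eq_zero)
    finally show ?thesis by (simp add: mono_fact_def)
  qed
  show ?thesis
    by (simp add: diffop_def lookup_sum lookup_Const_times dm apolar_def lin_ext_def)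
qed

lemma apolar_sum_right: "apolar f (\<Sum>x\<in>A. g x) = (\<Sum>x\<in>A. apolar f (g x))"
  unfolding apolar_def using lin_ext_comb[where c = "\<lambda>_. 1" and A = A and p = f and \<phi> = "\<lambda>x m. lookup (g x) m * mono_fact m"]
  by (simp add: lookup_sum sum_distrib_right)

lemma apolar_Const_right: "apolar f (Const c * g) = c * apolar f g"
  unfolding apolar_def lin_ext_def lookup_Const_times sum_distrib_left by (simp add: mult_ac)

lemma apolar_single: "apolar (single m c) g = c * (lookup g m * mono_fact m)"
  by (simp add: apolar_def lin_ext_single)

lemma apolar_sum_left: "apolar (\<Sum>x\<in>A. f x) g = (\<Sum>x\<in>A. apolar (f x) g)"
  by (simp add: apolar_def lin_ext_sum)

lemma tdeg_UNIV: "tdeg m = (\<Sum>v\<in>UNIV. lookup m v)" for m :: "'v::finite \<Rightarrow>\<^sub>0 nat"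
  unfolding tdeg_def by (rule sum.mono_neutral_left) (auto simp: not_in_keys_iff_lookup_eq_zero)

lemma tdeg_add: "tdeg (m + m') = tdeg m + tdeg m'" for m :: "'v::finite \<Rightarrow>\<^sub>0 nat"
  by (simp add: tdeg_UNIV lookup_add sum.distrib)

lemma tdeg_eq_0_iff: "tdeg m = 0 \<longleftrightarrow> m = 0" for m :: "'v::finite \<Rightarrow>\<^sub>0 nat"
  by (auto simp: tdeg_UNIV intro: poly_mapping_eqI)

definition lin_form :: "('v::finite \<Rightarrow> complex) \<Rightarrow> 'v mpoly" where
  "lin_form w = (\<Sum>v\<in>UNIV. Const (w v) * Var v)"

lemma lookup_Var_times:
  "lookup (Var v * p) b = (if lookup b v > 0 then lookup p (b - single v 1) else 0)"
proof (induction p rule: mpoly_induct)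
  case (monomial m c)
  have "single v 1 + m = b \<longleftrightarrow> lookup b v > 0 \<and> m = b - single v 1"
  proof
    assume "lookup b v > 0 \<and> m = b - single v 1"
    then show "single v 1 + m = b"
      by (intro poly_mapping_eqI) (auto simp: lookup_add lookup_minus lookup_single when_def)
  qed (auto simp: lookup_add)
  then show ?case by (auto simp: Var_def mult_single lookup_single when_def)
qed (simp add: distrib_left lookup_add)

text \<open>The multinomial theorem, by splitting off one factor: the contributions of the variables
  \<open>v\<close> carry weights \<open>lookup b v\<close>, which add up to
  \<open>tdeg b\<close>.\<close>

lemma mono_fact_lookup_lin_form_power:
  "mono_fact b * lookup (lin_form w ^ e) b = (if tdeg b = e then fact e * mono_val w b else 0)"
proof (induction e arbitrary: b)
  case 0
  show ?case by (auto simp: tdeg_eq_0_iff lookup_one when_def mono_fact_def)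
next
  case (Suc e)
  have step: "mono_fact b * (w v * lookup (Var v * lin_form w ^ e) b)
      = (if tdeg b = Suc e then fact e * mono_val w b * of_nat (lookup b v) else 0)" for v
  proof (cases "lookup b v > 0")
    case True
    define b' where "b' = b - single v 1"
    have b: "b = b' + single v 1"
      using True by (intro poly_mapping_eqI) (auto simp: b'_def lookup_add lookup_minus lookup_single when_def)
    have "mono_fact b = of_nat (lookup b v) * mono_fact b'"
    proof -
      have "(\<Prod>i\<in>UNIV - {v}. fact (lookup b i) :: complex) = (\<Prod>i\<in>UNIV - {v}. fact (lookup b' i))"
        by (rule prod.cong) (auto simp: b lookup_add lookup_single)
      then show ?thesis
        unfolding mono_fact_UNIV by (subst (1 2) prod.remove[of UNIV v]) (auto simp: b lookup_add)
    qed
    moreover have "mono_val w b = w v * mono_val w b'" by (simp add: b mono_val_add)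
    moreover have "tdeg b = Suc (tdeg b')" by (simp add: b tdeg_add) (simp add: tdeg_UNIV lookup_single when_def)
    moreover have "lookup (Var v * lin_form w ^ e) b = lookup (lin_form w ^ e) b'"
      using True by (simp add: lookup_Var_times b'_def)
    ultimately show ?thesis using Suc[of b'] by (auto simp: mult_ac)
  qed (simp add: lookup_Var_times)
  have "lin_form w ^ Suc e = (\<Sum>v\<in>UNIV. Const (w v) * (Var v * lin_form w ^ e))"
    by (simp add: lin_form_def[of w] sum_distrib_right mult.assoc)
  then have "mono_fact b * lookup (lin_form w ^ Suc e) b
      = (\<Sum>v\<in>UNIV. mono_fact b * (w v * lookup (Var v * lin_form w ^ e) b))"
    by (simp only: lookup_sum lookup_Const_times sum_distrib_left)
  also have "\<dots> = (if tdeg b = Suc e then fact e * mono_val w b * (\<Sum>v\<in>UNIV. of_nat (lookup b v)) else 0)"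
    unfolding step by (auto simp: sum_distrib_left)
  also have "(\<Sum>v\<in>UNIV. of_nat (lookup b v)) = (of_nat (tdeg b) :: complex)"
    by (simp add: tdeg_UNIV)
  finally show ?case by (auto simp: mult_ac)
qed

text \<open>Evaluation at \<open>w\<close> is apolar pairing with the exponential of the linear form
  \<open>w\<close>, truncated at the degree of \<open>F\<close>.\<close>

lemma evalp_eq_apolar:
  assumes "\<And>m. m \<in> keys F \<Longrightarrow> tdeg m \<le> n"
  shows "evalp w F = (\<Sum>e\<le>n. 1 / fact e * apolar F (lin_form w ^ e))"
proof -
  have "(\<Sum>e\<le>n. 1 / fact e * apolar F (lin_form w ^ e))
      = (\<Sum>m\<in>keys F. lookup F m * (\<Sum>e\<le>n. 1 / fact e * (lookup (lin_form w ^ e) m * mono_fact m)))"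
    unfolding apolar_def lin_ext_comb[symmetric] by (simp add: lin_ext_def)
  also have "\<dots> = (\<Sum>m\<in>keys F. lookup F m * mono_val w m)"
  proof (rule sum.cong[OF refl])
    fix m assume "m \<in> keys F"
    then have "tdeg m \<le> n" by (rule assms)
    have "1 / fact e * (lookup (lin_form w ^ e) m * mono_fact m) = (if e = tdeg m then mono_val w m else 0)" for e
      using mono_fact_lookup_lin_form_power[of m w e] by (simp add: mult.commute split: if_splits)
    with \<open>tdeg m \<le> n\<close> show "lookup F m * (\<Sum>e\<le>n. 1 / fact e * (lookup (lin_form w ^ e) m * mono_fact m))
        = lookup F m * mono_val w m" by simp
  qed
  finally show ?thesis by (simp add: evalp_def mono_val_def)
qed

definition exp_sum :: "('n::finite \<Rightarrow> nat) \<Rightarrow> nat" where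
  "exp_sum k = (\<Sum>i\<in>UNIV. k i)"

lemma mono_fun_mult: "mono_fun k (\<lambda>i. x i * y i) = mono_fun k x * mono_fun k y"
  for x y :: "'n::finite \<Rightarrow> 'b::comm_semiring_1"
  by (simp add: mono_fun_def power_mult_distrib prod.distrib)

lemma mono_fun_const: "mono_fun k (\<lambda>i. x) = x ^ exp_sum k"
  by (simp add: mono_fun_def exp_sum_def power_sum)

lemma fps_prod_nth_0: "fps_nth (\<Prod>i\<in>A. f i) 0 = (\<Prod>i\<in>A. fps_nth (f i) 0)"
  for f :: "'a \<Rightarrow> 'b::comm_ring_1 fps"
  by (induction A rule: infinite_finite_induct) simp_all

text \<open>Each factor is \<open>fps_X\<close> times a series with constant term
  \<open>c i\<close>, so the product begins in order \<open>exp_sum k\<close>.\<close>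

lemma mono_fun_fps_exp_minus_1:
  fixes c :: "'n::finite \<Rightarrow> complex"
  assumes "e \<le> exp_sum k"
  shows "fps_nth (mono_fun k (\<lambda>i. fps_exp (c i) - 1)) e = (if e = exp_sum k then mono_fun k c else 0)"
proof -
  define H where "H c = Abs_fps (\<lambda>n. c ^ Suc n / fact (Suc n))" for c :: complex
  have "fps_exp c - 1 = fps_X * H c" for c
    by (rule fps_ext) (simp add: H_def del: power_Suc fact_Suc split: nat.split)
  then have "mono_fun k (\<lambda>i. fps_exp (c i) - 1) = fps_X ^ exp_sum k * mono_fun k (\<lambda>i. H (c i))"
    by (simp add: mono_fun_mult mono_fun_const)
  moreover have "fps_nth (mono_fun k (\<lambda>i. H (c i))) 0 = mono_fun k c"
  proof -
    have "fps_nth (H c) 0 = c" for c by (simp add: H_def)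
    then show ?thesis by (simp add: mono_fun_def fps_prod_nth_0 fps_power_zeroth)
  qed
  ultimately show ?thesis using assms by (auto simp: fps_X_power_mult_nth)
qed

interpretation fp: insertion fps_const f for f :: "'v \<Rightarrow> complex fps"
  by unfold_locales auto

definition comb_point :: "('n::finite \<Rightarrow> 'v \<Rightarrow> complex) \<Rightarrow> ('n \<Rightarrow> nat) \<Rightarrow> 'v \<Rightarrow> complex" where
  "comb_point a j v = (\<Sum>i\<in>UNIV. of_nat (j i) * a i v)"

text \<open>A polynomial in the variables \<open>E\<^sub>i\<close> acts as a functional: the monomial \<open>E\<^sup>j\<close>
  is evaluation at the point \<open>\<Sum>i. j i * a i\<close>.\<close>

definition shift_act :: "('n::finite \<Rightarrow> 'v \<Rightarrow> complex) \<Rightarrow> 'n mpoly \<Rightarrow> 'v mpoly \<Rightarrow> complex" where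
  "shift_act a Q F = lin_ext (\<lambda>j. evalp (comb_point a (lookup j)) F) Q"

definition diff_mono :: "('n::finite \<Rightarrow> nat) \<Rightarrow> 'n mpoly" where
  "diff_mono k = mono_fun k (\<lambda>i. Var i - 1)"

text \<open>With evaluations written as pairings with exponentials, a product of factors
  \<open>E_i - 1\<close> corresponds to the product of the series of \<open>l_i\<close>, minus 1
  each. On polynomials of degree at most \<open>exp_sum k\<close> only the leading form of that
  product survives.\<close>

lemma shift_act_diff_mono:
  fixes a :: "'n::finite \<Rightarrow> 'v::finite \<Rightarrow> complex"
  assumes "\<And>m. m \<in> keys F \<Longrightarrow> tdeg m \<le> exp_sum k"
  shows "shift_act a (diff_mono k) F = apolar F (mono_fun k (\<lambda>i. lin_form (a i)))"
proof -
  define n where "n = exp_sum k"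
  define Q where "Q = (diff_mono k :: 'n mpoly)"
  define w where "w j = comb_point a (lookup j)" for j :: "'n \<Rightarrow>\<^sub>0 nat"
  \<comment> \<open>The homogeneous part of degree \<open>e\<close> of the combination of
    exponentials attached to \<open>Q\<close>.\<close>
  define R where "R e = (\<Sum>j\<in>keys Q. Const (lookup Q j * (1 / fact e)) * lin_form (w j) ^ e)" for e
  have R: "R e = (if e = n then mono_fun k (\<lambda>i. lin_form (a i)) else 0)" if "e \<le> n" for e
  proof -
    \<comment> \<open>Equality of polynomials is tested at points, where both sides become
      coefficients of a power series in one variable.\<close>
    have "evalp x (R e - (if e = n then mono_fun k (\<lambda>i. lin_form (a i)) else 0)) = 0" for x
    proof -
      define c where "c i = evalp x (lin_form (a i))" for i
      have cw: "evalp x (lin_form (w j)) = (\<Sum>i\<in>UNIV. of_nat (lookup j i) * c i)" for j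
      proof -
        have "evalp x (lin_form (w j)) = (\<Sum>v\<in>UNIV. \<Sum>i\<in>UNIV. of_nat (lookup j i) * a i v * x v)"
          by (simp add: lin_form_def ev.ins_simps w_def comb_point_def sum_distrib_right)
        also have "\<dots> = (\<Sum>i\<in>UNIV. \<Sum>v\<in>UNIV. of_nat (lookup j i) * a i v * x v)"
          by (rule sum.swap)
        finally show ?thesis
          by (simp add: c_def lin_form_def ev.ins_simps sum_distrib_left mult.assoc)
      qed
      have mv: "mono_val (\<lambda>i. fps_exp (c i)) j = fps_exp (\<Sum>i\<in>UNIV. of_nat (lookup j i) * c i)" for j
      proof -
        have "(\<Prod>i\<in>S. fps_exp (of_nat (lookup j i) * c i)) = fps_exp (\<Sum>i\<in>S. of_nat (lookup j i) * c i)" for S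
          by (induction S rule: infinite_finite_induct) (simp_all add: fps_exp_add_mult)
        then show ?thesis by (simp add: mono_val_UNIV fps_exp_power_mult)
      qed
      have "evalp x (R e) = (\<Sum>j\<in>keys Q. lookup Q j * (1 / fact e) * (\<Sum>i\<in>UNIV. of_nat (lookup j i) * c i) ^ e)"
        by (simp add: R_def ev.ins_simps cw)
      also have "\<dots> = fps_nth (fp.ins (\<lambda>i. fps_exp (c i)) Q) e"
        by (simp add: fp.ins_def mv fps_sum_nth)
      also have "fp.ins (\<lambda>i. fps_exp (c i)) Q = mono_fun k (\<lambda>i. fps_exp (c i) - 1)"
        by (simp add: Q_def diff_mono_def mono_fun_def fp.ins_simps)
      finally have "evalp x (R e) = (if e = n then mono_fun k c else 0)"
        using mono_fun_fps_exp_minus_1[of e k c] that by (simp add: n_def)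
      moreover have "evalp x (mono_fun k (\<lambda>i. lin_form (a i))) = mono_fun k c"
        by (simp add: mono_fun_def ev.ins_simps c_def)
      ultimately show ?thesis by (simp add: ev.ins_diff)
    qed
    then have "R e - (if e = n then mono_fun k (\<lambda>i. lin_form (a i)) else 0) = 0"
      by (rule mpoly_eq_0_if_evalp_0)
    then show ?thesis by simp
  qed
  have "shift_act a Q F = (\<Sum>j\<in>keys Q. lookup Q j * (\<Sum>e\<le>n. 1 / fact e * apolar F (lin_form (w j) ^ e)))"
    unfolding shift_act_def lin_ext_def w_def[symmetric]
    by (intro sum.cong refl arg_cong2[where f = "(*)"] evalp_eq_apolar) (simp add: assms n_def)
  also have "\<dots> = (\<Sum>e\<le>n. \<Sum>j\<in>keys Q. lookup Q j * (1 / fact e) * apolar F (lin_form (w j) ^ e))"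
    unfolding sum_distrib_left by (subst sum.swap) (simp add: mult.assoc)
  also have "\<dots> = (\<Sum>e\<le>n. apolar F (R e))"
    by (simp only: R_def apolar_sum_right apolar_Const_right)
  also have "\<dots> = (\<Sum>e\<le>n. if e = n then apolar F (mono_fun k (\<lambda>i. lin_form (a i))) else 0)"
    by (intro sum.cong refl) (simp add: R apolar_def lin_ext_def)
  finally show ?thesis by (simp add: Q_def)
qed

text \<open>The binomial expansion over the full box; vanishing binomial coefficients take care of
  the indices above \<open>k\<close>. With \<open>c = - 1\<close> it writes differences through
  evaluations, with \<open>c = 1\<close> the reverse, without leaving the box.\<close>

lemma mono_fun_plus_Const:
  fixes k :: "'n::finite \<Rightarrow> nat" and x :: "'n \<Rightarrow> 'w mpoly"
  assumes "\<And>i. k i \<le> m"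
  shows "mono_fun k (\<lambda>i. x i + Const c)
    = (\<Sum>j | \<forall>i. j i \<le> m. Const (\<Prod>i\<in>UNIV. of_nat (k i choose j i) * c ^ (k i - j i)) * mono_fun j x)"
proof -
  have Const_power: "Const (b ^ t) = (Const b :: 'w mpoly) ^ t" for b t
    by (induction t) (simp_all add: Const_mult)
  have Const_of_nat: "Const (of_nat t) = (of_nat t :: 'w mpoly)" for t
    by (induction t) (simp_all add: Const_add)
  have Const_prod: "Const (prod f A) = (\<Prod>x\<in>A. Const (f x) :: 'w mpoly)" for f and A :: "'n set"
    by (induction A rule: infinite_finite_induct) (simp_all add: Const_mult)
  have one: "(x i + Const c) ^ k i = (\<Sum>t\<le>m. Const (of_nat (k i choose t) * c ^ (k i - t)) * x i ^ t)" for i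
  proof -
    have "(x i + Const c) ^ k i = (\<Sum>t\<le>k i. of_nat (k i choose t) * x i ^ t * Const c ^ (k i - t))"
      by (rule binomial_ring)
    also have "\<dots> = (\<Sum>t\<le>m. of_nat (k i choose t) * x i ^ t * Const c ^ (k i - t))"
      by (rule sum.mono_neutral_left) (use assms[of i] in \<open>simp_all add: binomial_eq_0\<close>)
    finally show ?thesis by (simp add: Const_mult Const_power Const_of_nat mult_ac)
  qed
  have set: "{j. \<forall>i. j i \<le> m} = PiE (UNIV :: 'n set) (\<lambda>_. {..m})" by (auto simp: PiE_def)
  show ?thesis
    unfolding set mono_fun_def one by (subst prod_sum_PiE) (simp_all add: Const_prod prod.distrib Const_mult)
qed

text \<open>A functional that vanishes on the common kernel of finitely many functionals is a
  combination of them. The induction restricts \<open>W\<close> to the kernel of one functional at a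
  time.\<close>

lemma functional_in_span:
  fixes \<psi> :: "'w mpoly \<Rightarrow> complex" and \<phi> :: "'p \<Rightarrow> 'w mpoly \<Rightarrow> complex"
  assumes "finite P"
    and "\<And>f g. f \<in> W \<Longrightarrow> g \<in> W \<Longrightarrow> f + g \<in> W" "\<And>c f. f \<in> W \<Longrightarrow> Const c * f \<in> W"
    and "\<And>f g. \<psi> (f + g) = \<psi> f + \<psi> g" "\<And>c f. \<psi> (Const c * f) = c * \<psi> f"
    and "\<And>p f g. \<phi> p (f + g) = \<phi> p f + \<phi> p g" "\<And>p c f. \<phi> p (Const c * f) = c * \<phi> p f"
    and "\<And>f. f \<in> W \<Longrightarrow> (\<forall>p\<in>P. \<phi> p f = 0) \<Longrightarrow> \<psi> f = 0"
  obtains c where "\<And>f. f \<in> W \<Longrightarrow> \<psi> f = (\<Sum>p\<in>P. c p * \<phi> p f)"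
proof -
  have "\<exists>c. \<forall>f\<in>W. \<psi> f = (\<Sum>p\<in>P. c p * \<phi> p f)"
    using assms(1-3,8)
  proof (induction P arbitrary: W)
    case empty
    then show ?case by simp
  next
    case (insert p P)
    have "\<exists>c. \<forall>f\<in>{f\<in>W. \<phi> p f = 0}. \<psi> f = (\<Sum>p\<in>P. c p * \<phi> p f)"
      by (rule insert.IH) (use insert.prems assms(6,7) in auto)
    then obtain c where c: "\<And>f. f \<in> W \<Longrightarrow> \<phi> p f = 0 \<Longrightarrow> \<psi> f = (\<Sum>p\<in>P. c p * \<phi> p f)" by blast
    show ?case
    proof (cases "\<exists>f\<in>W. \<phi> p f \<noteq> 0")
      case False
      with c show ?thesis
        using insert.hyps by (intro exI[of _ c]) auto
    next
      case True
      then obtain u where u: "u \<in> W" "\<phi> p u \<noteq> 0" by blast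
      \<comment> \<open>The only coefficient that makes the formula correct at \<open>u\<close>; a
        general \<open>f\<close> is then moved along \<open>u\<close> into the kernel of
        \<open>\<phi> p\<close>.\<close>
      define b where "b = (\<psi> u - (\<Sum>p\<in>P. c p * \<phi> p u)) / \<phi> p u"
      have "\<psi> f = (\<Sum>q\<in>insert p P. (if q = p then b else c q) * \<phi> q f)" if f: "f \<in> W" for f
      proof -
        define s where "s = \<phi> p f / \<phi> p u"
        define f0 where "f0 = f + Const (- s) * u"
        have "f0 \<in> W" unfolding f0_def by (intro insert.prems f u)
        moreover have "\<phi> p f0 = 0" using u by (simp add: f0_def assms s_def)
        ultimately have "\<psi> f0 = (\<Sum>q\<in>P. c q * \<phi> q f0)" by (rule c)
        moreover have "\<psi> f0 = \<psi> f - s * \<psi> u" "\<phi> q f0 = \<phi> q f - s * \<phi> q u" for q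
          unfolding f0_def assms(4-7) by simp_all
        ultimately have "\<psi> f - s * \<psi> u = (\<Sum>q\<in>P. c q * \<phi> q f) - s * (\<Sum>q\<in>P. c q * \<phi> q u)"
          by (simp add: right_diff_distrib sum_subtractf sum_distrib_left mult_ac)
        then have "\<psi> f = (\<Sum>q\<in>P. c q * \<phi> q f) + s * (\<psi> u - (\<Sum>q\<in>P. c q * \<phi> q u))"
          by (simp add: algebra_simps)
        also have "s * (\<psi> u - (\<Sum>q\<in>P. c q * \<phi> q u)) = b * \<phi> p f"
          by (simp add: s_def b_def)
        also have "(\<Sum>q\<in>P. c q * \<phi> q f) = (\<Sum>q\<in>P. (if q = p then b else c q) * \<phi> q f)"
          using insert.hyps by (intro sum.cong) auto
        finally show ?thesis using insert.hyps by (simp add: add.commute)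
      qed
      then show ?thesis by (intro exI[of _ "\<lambda>q. if q = p then b else c q"] ballI)
    qed
  qed
  then obtain c where "\<forall>f\<in>W. \<psi> f = (\<Sum>p\<in>P. c p * \<phi> p f)" ..
  then show thesis by (intro that[of c]) simp
qed

section \<open>Unimodular matrices\<close>

lemma rowspaceC_I: "(\<lambda>j. \<Sum>i\<in>UNIV. c i * of_int (A i j)) \<in> rowspaceC A"
  unfolding rowspaceC_def by blast

lemma rowspaceC_row: "(\<lambda>j. of_int (A i j)) \<in> rowspaceC A" for i :: "'d::finite"
proof -
  have "(\<lambda>j. of_int (A i j)) = (\<lambda>j. \<Sum>i'\<in>UNIV. (if i' = i then 1 else 0) * of_int (A i' j) :: complex)"
    by (simp add: if_distrib[of "\<lambda>x. x * _"] cong: if_cong)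
  then show ?thesis using rowspaceC_I[of "\<lambda>i'. if i' = i then 1 else 0" A] by simp
qed

lemma det_in_Ints:
  fixes M :: "real^'d^'d"
  shows "(\<And>i j. M $ i $ j \<in> \<int>) \<Longrightarrow> det M \<in> \<int>"
  unfolding det_def by (intro Ints_sum Ints_mult Ints_prod) auto

text \<open>Lists a basis by the row index type to form a square matrix. Repetitions are allowed at
  this point; they are excluded later by a nonzero determinant.\<close>

lemma surj_from_finite:
  assumes "finite B" "b \<in> B" "card B \<le> CARD('d)"
  obtains g :: "'d::finite \<Rightarrow> 'b" where "range g = B"
proof -
  from card_le_inj[OF assms(1) finite[of "UNIV :: 'd set"] assms(3)]
  obtain f :: "'b \<Rightarrow> 'd" where f: "inj_on f B" by blast
  define g where "g x = (if x \<in> f ` B then inv_into B f x else b)" for x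
  have "range g = B"
  proof (intro equalityI subsetI)
    fix y assume "y \<in> range g"
    then show "y \<in> B" using assms(2) by (auto simp: g_def inv_into_into split: if_splits)
  next
    fix y assume "y \<in> B"
    then have "g (f y) = y" using f by (simp add: g_def inv_into_f_f)
    then show "y \<in> range g" by (metis rangeI)
  qed
  with that show thesis by blast
qed

text \<open>Pairing the relation with the vector of the row space dual to \<open>b0\<close> isolates
  \<open>x b0\<close>.\<close>

lemma rowspaceC_column_indep:
  fixes A :: "'d::finite \<Rightarrow> 'n::finite \<Rightarrow> int" and x :: "'n \<Rightarrow> real"
  assumes "coord_onto (rowspaceC A) B"
    and "\<And>i. (\<Sum>b\<in>B. x b * of_int (A i b)) = 0" and "b0 \<in> B"
  shows "x b0 = 0"
proof -
  obtain u where u: "\<And>j. u j \<in> rowspaceC A" "\<And>i j. i \<in> B \<Longrightarrow> u j i = (if i = j then 1 else 0)"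
    by (rule coord_onto_dual[OF assms(1)]) blast
  from u(1)[of b0] obtain c :: "'d \<Rightarrow> complex" where c: "u b0 = (\<lambda>j. \<Sum>i\<in>UNIV. c i * of_int (A i j))"
    unfolding rowspaceC_def by blast
  have "complex_of_real (x b0) = (\<Sum>b\<in>B. of_real (x b) * u b0 b)"
    using assms(3) u(2) by (simp add: if_distrib[of "(*) _"] cong: if_cong)
  also have "\<dots> = (\<Sum>b\<in>B. \<Sum>i\<in>UNIV. c i * (of_real (x b) * of_int (A i b)))"
    by (simp add: c sum_distrib_left mult_ac)
  also have "\<dots> = (\<Sum>i\<in>UNIV. c i * of_real (\<Sum>b\<in>B. x b * of_int (A i b)))"
    by (subst sum.swap) (simp add: sum_distrib_left)
  also have "\<dots> = 0" by (simp add: assms(2))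
  finally show ?thesis by simp
qed

lemma card_basis_le:
  fixes A :: "'d::finite \<Rightarrow> 'n::finite \<Rightarrow> int"
  assumes "coord_onto (rowspaceC A) B"
  shows "card B \<le> CARD('d)"
proof -
  define col :: "'n \<Rightarrow> real^'d" where "col b = (\<chi> i. of_int (A i b))" for b
  note indep = rowspaceC_column_indep[OF assms]
  have inj: "inj_on col B"
  proof (rule inj_onI, rule ccontr)
    fix b b' assume b: "b \<in> B" "b' \<in> B" "col b = col b'" "b \<noteq> b'"
    have "(\<Sum>x\<in>B. ((if x = b then 1 else 0) - (if x = b' then 1 else 0)) * real_of_int (A i x)) = 0" for i
    proof -
      have "(\<Sum>x\<in>B. ((if x = b then 1 else 0) - (if x = b' then 1 else 0)) * real_of_int (A i x))
          = (\<Sum>x\<in>B. (if x = b then real_of_int (A i x) else 0) - (if x = b' then real_of_int (A i x) else 0))"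
        by (rule sum.cong) auto
      also have "\<dots> = real_of_int (A i b) - real_of_int (A i b')"
        using b by (simp add: sum_subtractf)
      also have "\<dots> = 0"
        using b(3) by (simp add: col_def vec_eq_iff)
      finally show ?thesis .
    qed
    from indep[OF this b(1)] b(4) show False by simp
  qed
  have "independent (col ` B)"
  proof (rule ccontr)
    assume "\<not> independent (col ` B)"
    then obtain w v where w: "v \<in> col ` B" "w v \<noteq> 0" "(\<Sum>v\<in>col ` B. w v *\<^sub>R v) = 0"
      using dependent_finite[of "col ` B"] by auto
    then obtain b where b: "b \<in> B" "v = col b" by blast
    have "(\<Sum>x\<in>B. w (col x) *\<^sub>R col x) = 0"
      using w(3) by (simp add: sum.reindex[OF inj])
    then have "(\<Sum>x\<in>B. w (col x) *\<^sub>R col x) $ i = 0" for i by simp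
    then have "(\<Sum>x\<in>B. w (col x) * of_int (A i x)) = 0" for i by (simp add: col_def)
    from indep[OF this b(1)] w(2) b(2) show False by simp
  qed
  then have "card (col ` B) \<le> DIM(real^'d)" using independent_bound by blast
  then show ?thesis by (simp add: card_image[OF inj])
qed

text \<open>Cramer's rule, used twice. The covector dual to \<open>b\<close> is integral because the
  basis minor is \<open>1\<close> or \<open>- 1\<close>, and its value on any column is a quotient
  of two maximal minors.\<close>

lemma unimodular_dual_basis:
  fixes A :: "'d::finite \<Rightarrow> 'n::finite \<Rightarrow> int"
  assumes A: "unimodular A" and B: "coord_onto (rowspaceC A) B" "mclosure (rowspaceC A) B = UNIV"
    and b: "b \<in> B"
  obtains c :: "'d \<Rightarrow> int" where "\<And>b'. b' \<in> B \<Longrightarrow> (\<Sum>i\<in>UNIV. c i * A i b') = (if b' = b then 1 else 0)"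
    "\<And>j. (\<Sum>i\<in>UNIV. c i * A i j) \<in> {- 1, 0, 1}"
proof -
  obtain g :: "'d \<Rightarrow> 'n" where g: "range g = B"
    using surj_from_finite[OF finite b card_basis_le[OF B(1)]] .
  from b g obtain k0 where k0: "g k0 = b" by blast
  define N :: "real^'d^'d" where "N = (\<chi> i k. real_of_int (A i (g k)))"
  define M where "M = transpose N"
  have unim: "det (\<chi> i k. real_of_int (A i (h k)) :: real^'d^'d) \<in> {- 1, 0, 1}" for h :: "'d \<Rightarrow> 'n"
    using A unfolding unimodular_def by blast
  have M: "(M *v x) $ k = (\<Sum>i\<in>UNIV. x $ i * of_int (A i (g k)))" for x k
    by (simp add: M_def N_def matrix_vector_mult_def transpose_def mult.commute)
  \<comment> \<open>A row combination that vanishes on the basis columns vanishes on all columns by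
    closure, and then full row rank makes it trivial.\<close>
  have "x = 0" if x: "M *v x = 0" for x
  proof -
    define v where "v = (\<lambda>j. \<Sum>i\<in>UNIV. complex_of_real (x $ i) * of_int (A i j))"
    have v: "v j = of_real (\<Sum>i\<in>UNIV. x $ i * of_int (A i j))" for j
      by (simp add: v_def)
    have "v b' = 0" if "b' \<in> B" for b'
    proof -
      from that g obtain k where "b' = g k" by blast
      then show ?thesis using M[of x k] x by (simp add: v)
    qed
    moreover have "v \<in> rowspaceC A" unfolding v_def by (rule rowspaceC_I)
    ultimately have "v j = 0" for j
      using B(2) unfolding mclosure_def by blast
    then have "(\<Sum>i\<in>UNIV. x $ i * real_of_int (A i j)) = 0" for j
      by (simp only: v of_real_eq_0_iff)
    then have "\<forall>i. x $ i = 0"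
      using A unfolding unimodular_def full_row_rank_def by blast
    then show ?thesis by (simp add: vec_eq_iff)
  qed
  then obtain M' where "M' ** M = mat 1"
    using matrix_left_invertible_ker[of M] by blast
  then have "det M' * det M = 1" by (metis det_I det_mul)
  then have detM: "det M \<noteq> 0" by auto
  then have detN: "det N \<in> {- 1, 1}"
    using unim[of g] by (auto simp: M_def det_transpose N_def)
  then have detM': "det M \<in> {- 1, 1}" by (simp add: M_def det_transpose)
  define x where "x = (\<chi> k. det (\<chi> i j. if j = k then axis k0 1 $ i else M $ i $ j) / det M)"
  have Mx: "M *v x = axis k0 1" using cramer[OF detM] x_def by blast
  have "x $ i \<in> \<int>" for i
  proof -
    have "det (\<chi> i' j. if j = i then axis k0 1 $ i' else M $ i' $ j :: real^'d^'d) \<in> \<int>"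
      by (rule det_in_Ints) (auto simp: axis_def M_def N_def transpose_def)
    with detM' show ?thesis by (auto simp: x_def)
  qed
  then have "\<forall>i. \<exists>z. x $ i = of_int z" unfolding Ints_def by blast
  then obtain c :: "'d \<Rightarrow> int" where c: "\<And>i. x $ i = of_int (c i)" by metis
  have "real_of_int (\<Sum>i\<in>UNIV. c i * A i (g k)) = of_int (if k = k0 then 1 else 0)" for k
    using M[of x k, symmetric] by (simp add: Mx c axis_def)
  then have val: "(\<Sum>i\<in>UNIV. c i * A i (g k)) = (if k = k0 then 1 else 0)" for k
    by (simp only: of_int_eq_iff)
  have "(\<Sum>i\<in>UNIV. c i * A i b') = (if b' = b then 1 else 0)" if "b' \<in> B" for b'
  proof -
    from that g obtain k where k: "b' = g k" by blast
    have "k = k0" if "b' = b"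
    proof (rule ccontr)
      assume "k \<noteq> k0"
      moreover have "g k = g k0" using that k k0 by simp
      ultimately show False using val[of k] val[of k0] by simp
    qed
    moreover have "b' = b" if "k = k0" using that k k0 by simp
    ultimately have "b' = b \<longleftrightarrow> k = k0" by blast
    then show ?thesis using val[of k] k by simp
  qed
  moreover have "(\<Sum>i\<in>UNIV. c i * A i j) \<in> {- 1, 0, 1}" for j
  proof -
    \<comment> \<open>Expand column \<open>j\<close> in the basis columns. Its coefficient at
      \<open>k0\<close> is the value sought, and the numerator in Cramer's rule is the minor with
      column \<open>j\<close> put in position \<open>k0\<close>.\<close>
    define z :: "real^'d" where "z = (\<chi> i. of_int (A i j))"
    define y where "y = (\<chi> k. det (\<chi> i l. if l = k then z $ i else N $ i $ l) / det N)"
    have "det N \<noteq> 0" using detN by auto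
    then have Ny: "N *v y = z" using cramer y_def by blast
    have "(\<chi> i l. if l = k0 then z $ i else N $ i $ l) = (\<chi> i l. real_of_int (A i ((g(k0 := j)) l)) :: real^'d^'d)"
      by (simp add: vec_eq_iff z_def N_def)
    then have "y $ k0 \<in> {- 1, 0, 1}"
      using unim[of "g(k0 := j)"] detN by (auto simp: y_def)
    moreover have "real_of_int (\<Sum>i\<in>UNIV. c i * A i j) = y $ k0"
    proof -
      have "real_of_int (\<Sum>i\<in>UNIV. c i * A i j) = (\<Sum>i\<in>UNIV. x $ i * (N *v y) $ i)"
        by (simp add: Ny z_def c)
      also have "\<dots> = (\<Sum>i\<in>UNIV. \<Sum>k\<in>UNIV. y $ k * (x $ i * of_int (A i (g k))))"
        by (simp add: N_def matrix_vector_mult_def sum_distrib_left mult_ac)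
      also have "\<dots> = (\<Sum>k\<in>UNIV. y $ k * (M *v x) $ k)"
        unfolding M by (subst sum.swap) (simp add: sum_distrib_left)
      also have "\<dots> = y $ k0"
        by (simp add: Mx axis_def if_distrib cong: if_cong)
      finally show ?thesis .
    qed
    ultimately have "real_of_int (\<Sum>i\<in>UNIV. c i * A i j) \<in> real_of_int ` {- 1, 0, 1}" by simp
    then obtain z where "z \<in> {- 1, 0, 1}" "real_of_int (\<Sum>i\<in>UNIV. c i * A i j) = real_of_int z"
      by (rule imageE)
    then show ?thesis by (simp only: of_int_eq_iff)
  qed
  ultimately show thesis by (rule that)
qed

text \<open>Extend \<open>C - {c}\<close> to a basis. The covector dual to \<open>j\<close>, paired
  with the circuit, gives \<open>\<alpha> C j\<close> as \<open>\<alpha> C c\<close> times minus its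
  value at \<open>c\<close>; that value lies in \<open>{- 1, 0, 1}\<close> and is nonzero.\<close>

lemma unimodular_circuit_signs:
  fixes A :: "'d::finite \<Rightarrow> 'n::finite \<Rightarrow> int"
  assumes A: "unimodular A" and L: "csubspace (rowspaceC A)" and \<alpha>: "circuit_coeffs (rowspaceC A) \<alpha>"
    and C: "matroid_circuit (rowspaceC A) C"
  obtains \<epsilon> :: "'n \<Rightarrow> int" and \<gamma> where "\<And>i. i \<in> C \<Longrightarrow> \<epsilon> i = 1 \<or> \<epsilon> i = - 1"
    "\<And>i. i \<in> C \<Longrightarrow> \<alpha> C i = \<gamma> * of_int (\<epsilon> i)" "\<And>r. (\<Sum>i\<in>C. \<epsilon> i * A r i) = 0"
proof (cases "C = {}")
  case True
  with that show thesis by simp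
next
  case False
  then obtain c where c: "c \<in> C" by blast
  have \<alpha>0: "\<alpha> C i \<noteq> 0" if "i \<in> C" for i using \<alpha> C that by (simp add: circuit_coeffs_def)
  have \<alpha>rel: "(\<Sum>i\<in>C. \<alpha> C i * v i) = 0" if "v \<in> rowspaceC A" for v
    using \<alpha> C that by (simp add: circuit_coeffs_def)
  have "coord_onto (rowspaceC A) (C - {c})"
    using C c unfolding matroid_circuit_def matroid_indep_iff[OF L] by blast
  then obtain B where B: "C - {c} \<subseteq> B" "coord_onto (rowspaceC A) B" "mclosure (rowspaceC A) B = UNIV"
    by (rule coord_onto_maximal[OF L])
  have "\<exists>e::int. (e = 1 \<or> e = - 1) \<and> \<alpha> C j = \<alpha> C c * of_int e" if j: "j \<in> C" for j
  proof (cases "j = c")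
    case True
    then show ?thesis by (intro exI[of _ 1]) simp
  next
    case False
    with j B have jB: "j \<in> B" by blast
    obtain d :: "'d \<Rightarrow> int" where d: "\<And>b'. b' \<in> B \<Longrightarrow> (\<Sum>i\<in>UNIV. d i * A i b') = (if b' = j then 1 else 0)"
      "\<And>j. (\<Sum>i\<in>UNIV. d i * A i j) \<in> {- 1, 0, 1}"
      by (rule unimodular_dual_basis[OF A B(2,3) jB]) blast
    define u where "u k = (\<Sum>i\<in>UNIV. d i * A i k)" for k
    have u: "u b' = (if b' = j then 1 else 0)" if "b' \<in> B" for b'
      using d(1)[OF that] by (simp add: u_def)
    have "(\<lambda>k. complex_of_int (u k)) \<in> rowspaceC A"
      using rowspaceC_I[of "\<lambda>i. of_int (d i)" A] by (simp add: u_def)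
    then have "0 = (\<Sum>i\<in>C. \<alpha> C i * of_int (u i))" by (simp add: \<alpha>rel)
    also have "\<dots> = \<alpha> C c * of_int (u c) + (\<Sum>i\<in>C - {c}. \<alpha> C i * of_int (u i))"
      using c by (simp add: sum.remove)
    also have "(\<Sum>i\<in>C - {c}. \<alpha> C i * of_int (u i)) = (\<Sum>i\<in>C - {c}. if i = j then \<alpha> C j else 0)"
      using B(1) u by (intro sum.cong) (auto simp: subset_iff)
    also have "\<dots> = \<alpha> C j" using j False by simp
    finally have *: "\<alpha> C j = \<alpha> C c * of_int (- u c)" by (simp add: eq_neg_iff_add_eq_0 add.commute)
    with \<alpha>0[OF j] have "u c \<noteq> 0" by auto
    with d(2)[of c] have "- u c = 1 \<or> - u c = - 1" by (auto simp: u_def)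
    with * show ?thesis by blast
  qed
  then obtain \<epsilon> :: "'n \<Rightarrow> int" where \<epsilon>: "\<And>j. j \<in> C \<Longrightarrow> \<epsilon> j = 1 \<or> \<epsilon> j = - 1"
    "\<And>j. j \<in> C \<Longrightarrow> \<alpha> C j = \<alpha> C c * of_int (\<epsilon> j)" by metis
  have "(\<Sum>i\<in>C. \<epsilon> i * A r i) = 0" for r
  proof -
    have "0 = (\<Sum>i\<in>C. \<alpha> C i * of_int (A r i))" by (rule \<alpha>rel[OF rowspaceC_row, symmetric])
    also have "\<dots> = \<alpha> C c * of_int (\<Sum>i\<in>C. \<epsilon> i * A r i)"
      using \<epsilon>(2) by (simp add: sum_distrib_left mult.assoc)
    finally show ?thesis using \<alpha>0[OF c] by (metis mult_eq_0_iff of_int_eq_0_iff)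
  qed
  with \<epsilon> that show thesis by blast
qed

text \<open>A minimal dependent subset; it is nonempty because the empty set is independent.\<close>

lemma circuit_in_dependent:
  fixes L :: "('n::finite \<Rightarrow> complex) set"
  assumes L: "csubspace L" and F: "\<not> coord_onto L F"
  obtains C where "matroid_circuit L C" "C \<subseteq> F" "C \<noteq> {}"
proof -
  let ?F = "{C. C \<subseteq> F \<and> \<not> coord_onto L C}"
  have "finite ?F" "?F \<noteq> {}" using F by auto
  from finite_has_minimal[OF this] obtain C where "C \<in> ?F"
    and min: "\<forall>C'\<in>?F. C' \<subseteq> C \<longrightarrow> C = C'" by (rule bexE)
  then have C: "C \<subseteq> F" "\<not> coord_onto L C" by simp_all
  have "coord_onto L C'" if "C' \<subset> C" for C'
    using min that C(1) by blast
  with C have "matroid_circuit L C" by (simp add: matroid_circuit_def matroid_indep_iff[OF L])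
  moreover have "coord_onto L {}" using csubspace_zero[OF L] by (auto simp: coord_onto_def)
  ultimately show thesis using that C by blast
qed

text \<open>Integral decomposition, by induction on the number of non-integral coefficients. If
  their support is dependent, a shift along a circuit with signs as coefficients makes one of them
  integral; if it is independent, dual covectors show that all coefficients are integers.\<close>

lemma zono_pts_eq:
  fixes A :: "'d::finite \<Rightarrow> 'n::finite \<Rightarrow> int"
  assumes A: "unimodular A" and L: "csubspace (rowspaceC A)" and \<alpha>: "circuit_coeffs (rowspaceC A) \<alpha>"
  shows "zono_pts A m = (\<lambda>k r. \<Sum>i\<in>UNIV. int (k i) * A r i) ` {k. \<forall>i. k i \<le> m}"
proof (intro equalityI subsetI)
  fix p assume "p \<in> (\<lambda>k r. \<Sum>i\<in>UNIV. int (k i) * A r i) ` {k. \<forall>i. k i \<le> m}"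
  then obtain k where "\<forall>i. k i \<le> m" "p = (\<lambda>r. \<Sum>i\<in>UNIV. int (k i) * A r i)" by blast
  then show "p \<in> zono_pts A m"
    unfolding zono_pts_def by (intro CollectI exI[of _ "\<lambda>i. real (k i)"]) simp
next
  fix p assume "p \<in> zono_pts A m"
  then obtain t0 :: "'n \<Rightarrow> real" where t0: "\<And>i. 0 \<le> t0 i \<and> t0 i \<le> real m"
    "\<And>r. real_of_int (p r) = (\<Sum>i\<in>UNIV. t0 i * real_of_int (A r i))"
    unfolding zono_pts_def by blast
  have "\<exists>t. (\<forall>i. t i \<in> \<int> \<and> 0 \<le> t i \<and> t i \<le> real m) \<and> (\<forall>r. real_of_int (p r) = (\<Sum>i\<in>UNIV. t i * real_of_int (A r i)))"
    using t0
  proof (induction "card {i. t0 i \<notin> \<int>}" arbitrary: t0 rule: less_induct)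
    case (less t)
    define F where "F = {i. t i \<notin> \<int>}"
    show ?case
    proof (cases "coord_onto (rowspaceC A) F")
      case True
      then obtain B where B: "F \<subseteq> B" "coord_onto (rowspaceC A) B" "mclosure (rowspaceC A) B = UNIV"
        by (rule coord_onto_maximal[OF L])
      have "t b \<in> \<int>" for b
      proof (cases "b \<in> B")
        case False
        with B show ?thesis by (auto simp: F_def)
      next
        case b: True
        obtain c :: "'d \<Rightarrow> int" where c: "\<And>b'. b' \<in> B \<Longrightarrow> (\<Sum>i\<in>UNIV. c i * A i b') = (if b' = b then 1 else 0)"
          by (rule unimodular_dual_basis[OF A B(2,3) b]) blast
        define u where "u j = (\<Sum>i\<in>UNIV. c i * A i j)" for j
        have u: "u b' = (if b' = b then 1 else 0)" if "b' \<in> B" for b'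
          using c[OF that] by (simp add: u_def)
        have "real_of_int (\<Sum>r\<in>UNIV. c r * p r) = (\<Sum>j\<in>UNIV. t j * of_int (u j))"
        proof -
          have "real_of_int (\<Sum>r\<in>UNIV. c r * p r) = (\<Sum>r\<in>UNIV. \<Sum>j\<in>UNIV. of_int (c r) * (t j * of_int (A r j)))"
            by (simp add: less.prems(2) sum_distrib_left)
          also have "\<dots> = (\<Sum>j\<in>UNIV. t j * of_int (u j))"
            by (subst sum.swap) (simp add: u_def sum_distrib_left mult_ac)
          finally show ?thesis .
        qed
        also have "\<dots> = t b + (\<Sum>j\<in>UNIV - {b}. t j * of_int (u j))"
          using u[OF b] by (simp add: sum.remove[of UNIV b])
        \<comment> \<open>Every remaining term is an integer: other basis columns contribute zero,
          and coefficients off the basis are integral since \<open>F\<close> lies in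
          \<open>B\<close>.\<close>
        finally have "t b = real_of_int (\<Sum>r\<in>UNIV. c r * p r) - (\<Sum>j\<in>UNIV - {b}. t j * of_int (u j))"
          by simp
        also have "\<dots> \<in> \<int>"
        proof (intro Ints_diff Ints_sum)
          fix j assume j: "j \<in> UNIV - {b}"
          show "t j * of_int (u j) \<in> \<int>"
          proof (cases "j \<in> B")
            case True
            with u j show ?thesis by simp
          next
            case False
            then have "t j \<in> \<int>" using B by (auto simp: F_def)
            then show ?thesis by simp
          qed
        qed (rule Ints_of_int)
        finally show ?thesis .
      qed
      with less.prems show ?thesis by blast
    next
      case False
      then obtain C where C: "matroid_circuit (rowspaceC A) C" "C \<subseteq> F" "C \<noteq> {}"
        by (rule circuit_in_dependent[OF L])
      obtain \<epsilon> :: "'n \<Rightarrow> int" where \<epsilon>: "\<And>i. i \<in> C \<Longrightarrow> \<epsilon> i = 1 \<or> \<epsilon> i = - 1"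
        "\<And>r. (\<Sum>i\<in>C. \<epsilon> i * A r i) = 0"
        using unimodular_circuit_signs[OF A L \<alpha> C(1)] by metis
      \<comment> \<open>The distance coefficient \<open>i\<close> can move in its direction
        \<open>\<epsilon> i\<close> before reaching an integer; the smallest of these is the step
        length.\<close>
      define \<delta> where "\<delta> i = (if \<epsilon> i = 1 then of_int \<lceil>t i\<rceil> - t i else t i - of_int \<lfloor>t i\<rfloor>)" for i
      define s where "s = Min (\<delta> ` C)"
      have sle: "s \<le> \<delta> i" if "i \<in> C" for i using that by (simp add: s_def)
      have "s \<in> \<delta> ` C" unfolding s_def by (rule Min_in) (use C in auto)
      then obtain i0 where i0: "i0 \<in> C" "s = \<delta> i0" by blast
      have s0: "0 \<le> s" unfolding i0 by (simp add: \<delta>_def)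
      define t' where "t' i = (if i \<in> C then t i + s * of_int (\<epsilon> i) else t i)" for i
      have between: "of_int \<lfloor>t i\<rfloor> \<le> t' i \<and> t' i \<le> of_int \<lceil>t i\<rceil>" for i
      proof (cases "i \<in> C")
        case True
        have "of_int \<lfloor>t i\<rfloor> \<le> t i" "t i \<le> of_int \<lceil>t i\<rceil>" by simp_all
        with sle[OF True] s0 \<epsilon>(1)[OF True] True show ?thesis
          unfolding t'_def \<delta>_def by (auto simp del: of_int_floor_le le_of_int_ceiling)
      qed (simp add: t'_def)
      \<comment> \<open>The bounds \<open>0\<close> and \<open>m\<close> are integers, so the floor
        and the ceiling of \<open>t i\<close> already respect them.\<close>
      have bounds: "0 \<le> t' i \<and> t' i \<le> real m" for i
      proof -
        have "0 \<le> \<lfloor>t i\<rfloor>" "\<lceil>t i\<rceil> \<le> int m" using less.prems(1)[of i] by (simp_all add: ceiling_le_iff)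
        then have "0 \<le> real_of_int \<lfloor>t i\<rfloor>" "real_of_int \<lceil>t i\<rceil> \<le> real m" by simp_all
        with between[of i] show ?thesis by linarith
      qed
      have sum': "real_of_int (p r) = (\<Sum>i\<in>UNIV. t' i * real_of_int (A r i))" for r
      proof -
        have "(\<Sum>i\<in>UNIV. t' i * real_of_int (A r i))
            = (\<Sum>i\<in>UNIV. t i * real_of_int (A r i) + (if i \<in> C then s * (of_int (\<epsilon> i) * of_int (A r i)) else 0))"
          by (rule sum.cong) (auto simp: t'_def algebra_simps)
        also have "\<dots> = (\<Sum>i\<in>UNIV. t i * real_of_int (A r i)) + s * of_int (\<Sum>i\<in>C. \<epsilon> i * A r i)"
          by (simp add: sum.distrib sum.If_cases sum_distrib_left)
        finally show ?thesis by (simp add: \<epsilon>(2) less.prems(2))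
      qed
      have "{i. t' i \<notin> \<int>} \<subset> F"
      proof
        show "{i. t' i \<notin> \<int>} \<subseteq> F" using C(2) by (auto simp: F_def t'_def split: if_splits)
        have "t' i0 \<in> \<int>" using \<epsilon>(1)[OF i0(1)] i0 by (auto simp: t'_def \<delta>_def)
        moreover have "i0 \<in> F" using C i0 by blast
        ultimately show "{i. t' i \<notin> \<int>} \<noteq> F" by blast
      qed
      then have "card {i. t' i \<notin> \<int>} < card {i. t i \<notin> \<int>}"
        unfolding F_def by (intro psubset_card_mono) auto
      from less.hyps[OF this bounds sum'] show ?thesis .
    qed
  qed
  then obtain t where t: "\<And>i. t i \<in> \<int> \<and> 0 \<le> t i \<and> t i \<le> real m"
    "\<And>r. real_of_int (p r) = (\<Sum>i\<in>UNIV. t i * real_of_int (A r i))" by blast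
  define k where "k i = nat \<lfloor>t i\<rfloor>" for i
  have k: "t i = real (k i)" for i using t(1)[of i] by (auto simp: k_def elim!: Ints_cases)
  have "k i \<le> m" for i using t(1)[of i] by (simp add: k)
  moreover have "p r = (\<Sum>i\<in>UNIV. int (k i) * A r i)" for r
  proof -
    have "real_of_int (p r) = real_of_int (\<Sum>i\<in>UNIV. int (k i) * A r i)"
      by (simp add: t(2) k)
    then show ?thesis by (simp only: of_int_eq_iff)
  qed
  ultimately show "p \<in> (\<lambda>k r. \<Sum>i\<in>UNIV. int (k i) * A r i) ` {k. \<forall>i. k i \<le> m}"
    by (intro image_eqI[of _ _ k]) auto
qed

section \<open>The harmonic algebra\<close>

lemma keys_Const_Var: "keys (Const c * Var v) \<subseteq> (if c = 0 then {} else {single v 1})"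
  by (simp add: Var_def Const_times_single)

lemma bihom_mult:
  assumes "bihom a b p" "bihom a' b' q"
  shows "bihom (a + a') (b + b') (p * q)"
  unfolding bihom_def
proof
  fix m assume "m \<in> keys (p * q)"
  then obtain m1 m2 where "m = m1 + m2" "m1 \<in> keys p" "m2 \<in> keys q"
    using keys_mult[of p q] by blast
  then show "lookup m None = a + a' \<and> (\<Sum>i\<in>UNIV. lookup m (Some i)) = b + b'"
    using assms by (simp add: bihom_def lookup_add sum.distrib)
qed

lemma bihom_1: "bihom 0 0 1"
  by (simp add: bihom_def)

lemma bihom_prod:
  "(\<And>i. i \<in> S \<Longrightarrow> bihom (a i) (b i) (f i)) \<Longrightarrow> bihom (sum a S) (sum b S) (prod f S)"
  by (induction S rule: infinite_finite_induct) (simp_all add: bihom_1 bihom_mult)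

lemma bihom_power: "bihom a b p \<Longrightarrow> bihom (n * a) (n * b) (p ^ n)"
  by (induction n) (simp_all add: bihom_1 bihom_mult)

text \<open>The zero at \<open>None\<close> keeps \<open>x_0\<close> out of the linear form of the
  column.\<close>

definition col_pt :: "('d \<Rightarrow> 'n \<Rightarrow> int) \<Rightarrow> 'n \<Rightarrow> 'd option \<Rightarrow> complex" where
  "col_pt A i v = (case v of None \<Rightarrow> 0 | Some r \<Rightarrow> of_int (A r i))"

definition col_mono :: "('d::finite \<Rightarrow> 'n::finite \<Rightarrow> int) \<Rightarrow> ('n \<Rightarrow> nat) \<Rightarrow> 'd option mpoly" where
  "col_mono A k = mono_fun k (\<lambda>i. lin_form (col_pt A i))"

lemma bihom_lin_form_col_pt: "bihom 0 1 (lin_form (col_pt A i))"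
  unfolding bihom_def
proof
  fix m assume "m \<in> keys (lin_form (col_pt A i))"
  then obtain v where "m \<in> keys (Const (col_pt A i v) * Var v)"
    unfolding lin_form_def using keys_sum by fastforce
  then have "col_pt A i v \<noteq> 0" "m = single v 1"
    using keys_Const_Var[of "col_pt A i v" v] by (auto split: if_splits)
  then show "lookup m None = 0 \<and> (\<Sum>i\<in>UNIV. lookup m (Some i)) = 1"
    by (auto simp: col_pt_def lookup_single when_def split: option.splits)
qed

lemma bihom_col_mono: "bihom 0 (exp_sum k) (col_mono A k)"
proof -
  have "bihom (\<Sum>i\<in>UNIV. k i * 0) (\<Sum>i\<in>UNIV. k i * 1) (col_mono A k)"
    unfolding col_mono_def mono_fun_def
    by (intro bihom_prod bihom_power bihom_lin_form_col_pt)
  then show ?thesis by (simp add: exp_sum_def)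
qed

lemma tdeg_option: "tdeg m = lookup m None + (\<Sum>i\<in>UNIV. lookup m (Some i))"
  for m :: "'d::finite option \<Rightarrow>\<^sub>0 nat"
  by (simp add: tdeg_UNIV UNIV_option_conv sum.reindex)

lemma xpoly_col_mono: "xpoly (col_mono A k)"
  using bihom_col_mono[of k A] by (simp add: xpoly_def bihom_def)

lemma tdeg_col_mono: "m \<in> keys (col_mono A k) \<Longrightarrow> tdeg m = exp_sum k"
  using bihom_col_mono[of k A] by (simp add: tdeg_option bihom_def)

lemma lookup_col_mono_eq_0: "tdeg m \<noteq> exp_sum k \<Longrightarrow> lookup (col_mono A k) m = 0"
  using tdeg_col_mono by (metis not_in_keys_iff_lookup_eq_zero)

lemma xpoly_iff: "xpoly p \<longleftrightarrow> (\<forall>m. lookup m None > 0 \<longrightarrow> lookup p m = 0)"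
  unfolding xpoly_def by (metis in_keys_iff neq0_conv)

lemma xpoly_add: "xpoly p \<Longrightarrow> xpoly q \<Longrightarrow> xpoly (p + q)"
  by (simp add: xpoly_iff lookup_add)

lemma xpoly_Const_times: "xpoly p \<Longrightarrow> xpoly (Const c * p)"
  by (simp add: xpoly_iff lookup_Const_times)

lemma xpoly_0: "xpoly 0" and xpoly_1: "xpoly 1"
  by (simp_all add: xpoly_def)

lemma inv_system_0: "0 \<in> inv_system J"
  by (simp add: inv_system_def xpoly_0 lookup_diffop_0 apolar_def lin_ext_def)

lemma inv_system_add: "p \<in> inv_system J \<Longrightarrow> q \<in> inv_system J \<Longrightarrow> p + q \<in> inv_system J"
  using apolar_sum_right[of _ "\<lambda>b. if b then p else q" UNIV]
  by (simp add: inv_system_def xpoly_add lookup_diffop_0 UNIV_bool add.commute)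

lemma inv_system_Const_times: "p \<in> inv_system J \<Longrightarrow> Const c * p \<in> inv_system J"
  by (simp add: inv_system_def xpoly_Const_times lookup_diffop_0 apolar_Const_right)

definition hom_comp :: "nat \<Rightarrow> 'v mpoly \<Rightarrow> 'v mpoly" where
  "hom_comp e p = (\<Sum>m\<in>{m\<in>keys p. tdeg m = e}. monom m (lookup p m))"

lemma lookup_hom_comp: "lookup (hom_comp e p) m = (if tdeg m = e then lookup p m else 0)"
proof -
  have "lookup (hom_comp e p) m = (\<Sum>m'\<in>{m\<in>keys p. tdeg m = e}. if m' = m then lookup p m else 0)"
    unfolding hom_comp_def lookup_sum by (rule sum.cong) (auto simp: monom_def lookup_single when_def)
  then show ?thesis by (auto simp: not_in_keys_iff_lookup_eq_zero)
qed

lemma topcomp_eq: "topcomp f = hom_comp (Max (tdeg ` keys f)) f"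
  by (simp add: topcomp_def hom_comp_def)

lemma sum_hom_comp: "(\<Sum>e\<in>tdeg ` keys p. hom_comp e p) = p"
proof (rule poly_mapping_eqI)
  fix m
  have "lookup (\<Sum>e\<in>tdeg ` keys p. hom_comp e p) m
      = (\<Sum>e\<in>tdeg ` keys p. if e = tdeg m then lookup p m else 0)"
    unfolding lookup_sum by (rule sum.cong) (auto simp: lookup_hom_comp)
  then show "lookup (\<Sum>e\<in>tdeg ` keys p. hom_comp e p) m = lookup p m"
    by (cases "m \<in> keys p") (auto simp: not_in_keys_iff_lookup_eq_zero)
qed

lemma apolar_eq_0:
  assumes "\<And>m. m \<in> keys f \<Longrightarrow> lookup g m = 0"
  shows "apolar f g = 0"
  by (simp add: apolar_def lin_ext_def assms)

lemma apolar_add_left: "apolar (f + f') g = apolar f g + apolar f' g"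
  by (simp add: apolar_def lin_ext_add)

section \<open>Difference operators as functionals on polynomials\<close>

lemma mono_fun_Var: "mono_fun j Var = single (Abs_poly_mapping j) 1"
  by (simp add: single_eq_Const_mono_val mono_val_UNIV mono_fun_def)

lemma shift_act_mono_fun_Var: "shift_act a (mono_fun j Var) F = evalp (comb_point a j) F"
  by (simp add: shift_act_def mono_fun_Var lin_ext_single)

lemma shift_act_add: "shift_act a (P + Q) F = shift_act a P F + shift_act a Q F"
  and shift_act_diff: "shift_act a (P - Q) F = shift_act a P F - shift_act a Q F"
  and shift_act_0: "shift_act a 0 F = 0"
  and shift_act_Const_times: "shift_act a (Const c * P) F = c * shift_act a P F"
  and shift_act_sum: "shift_act a (sum R S) F = (\<Sum>x\<in>S. shift_act a (R x) F)"
  by (simp_all add: shift_act_def lin_ext_add lin_ext_diff lin_ext_Const_times lin_ext_sum)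

text \<open>Multiplying monomials adds the points at which they evaluate, so only the point of the
  left factor matters.\<close>

lemma shift_act_mult_cong:
  assumes "comb_point a j = comb_point a j'"
  shows "shift_act a (mono_fun j Var * Q) F = shift_act a (mono_fun j' Var * Q) F"
proof (induction Q rule: mpoly_induct)
  case (monomial m c)
  have "comb_point a (lookup (Abs_poly_mapping j + m)) = (\<lambda>v. comb_point a j v + comb_point a (lookup m) v)" for j
    by (simp add: fun_eq_iff comb_point_def lookup_add distrib_right sum.distrib)
  then show ?case
    by (simp add: mono_fun_Var mult_single shift_act_def lin_ext_single assms)
qed (simp add: distrib_left shift_act_add)

lemma diff_mono_exp_add_set: "diff_mono (exp_add_set k S) = (\<Prod>i\<in>S. Var i - 1) * diff_mono k"
  by (simp add: diff_mono_def mono_fun_exp_add_set mult.commute)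

lemma exp_add_set_singleton: "exp_add_set k {i} = exp_inc k i"
  by (auto simp: exp_add_set_def exp_inc_def)

lemma exp_sum_exp_add_set: "exp_sum (exp_add_set k S) = exp_sum k + card S"
proof -
  have "exp_sum (exp_add_set k S) = (\<Sum>i\<in>UNIV. k i + (if i \<in> S then 1 else 0))"
    unfolding exp_sum_def exp_add_set_def by (rule sum.cong) auto
  then show ?thesis by (simp add: sum.distrib exp_sum_def sum.If_cases)
qed

lemma exp_sum_exp_inc: "exp_sum (exp_inc k i) = Suc (exp_sum k)"
  using exp_sum_exp_add_set[of k "{i}"] by (simp add: exp_add_set_singleton)

text \<open>Expand each \<open>Var i\<close> as \<open>(Var i - 1) + 1\<close> and sort by the size
  of the subset: the last sum has order at least two more than \<open>diff_mono k\<close>.\<close>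

lemma prod_Var_times_diff_mono:
  "(\<Prod>i\<in>T. Var i) * diff_mono k = diff_mono k + (\<Sum>i\<in>T. diff_mono (exp_inc k i))
    + (\<Sum>S | S \<subseteq> T \<and> card S \<ge> 2. diff_mono (exp_add_set k S))"
  for T :: "'n::finite set"
proof -
  have "(\<Prod>i\<in>T. Var i) = (\<Prod>i\<in>T. (Var i - 1) + 1 :: 'n mpoly)" by simp
  also have "\<dots> = (\<Sum>S\<in>Pow T. \<Prod>i\<in>S. Var i - 1)" by (subst prod_add) simp_all
  finally have "(\<Prod>i\<in>T. Var i) * diff_mono k = (\<Sum>S\<in>Pow T. diff_mono (exp_add_set k S))"
    by (simp add: sum_distrib_right diff_mono_exp_add_set)
  also have "Pow T = insert {} ((\<lambda>i. {i}) ` T) \<union> {S. S \<subseteq> T \<and> card S \<ge> 2}"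
  proof (intro equalityI subsetI)
    fix S assume S: "S \<in> Pow T"
    consider "card S = 0" | "card S = 1" | "card S \<ge> 2" by linarith
    then show "S \<in> insert {} ((\<lambda>i. {i}) ` T) \<union> {S. S \<subseteq> T \<and> card S \<ge> 2}"
      by cases (use S in \<open>auto simp: card_1_singleton_iff\<close>)
  qed auto
  also have "(\<Sum>S\<in>\<dots>. diff_mono (exp_add_set k S)) =
      (\<Sum>S\<in>insert {} ((\<lambda>i. {i}) ` T). diff_mono (exp_add_set k S))
      + (\<Sum>S | S \<subseteq> T \<and> card S \<ge> 2. diff_mono (exp_add_set k S))"
    by (rule sum.union_disjoint) auto
  also have "(\<Sum>S\<in>insert {} ((\<lambda>i. {i}) ` T). diff_mono (exp_add_set k S))
      = diff_mono k + (\<Sum>i\<in>T. diff_mono (exp_inc k i))"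
  proof -
    have "exp_add_set k {} = k" by (simp add: fun_eq_iff exp_add_set_def)
    then show ?thesis
      by (subst sum.insert) (auto simp: sum.reindex exp_add_set_singleton)
  qed
  finally show ?thesis .
qed

text \<open>A linear relation between the top-order parts of difference operators lifts to a relation
  modulo operators of higher order: by unimodularity a circuit relation reads
  \<open>\<Sum>P. a = \<Sum>N. a\<close>, so that \<open>\<Prod>P. E\<close> and \<open>\<Prod>N. E\<close> act in the same way.\<close>

lemma diff_mono_relation_lift:
  fixes A :: "'d::finite \<Rightarrow> 'n::finite \<Rightarrow> int"
  assumes A: "unimodular A" and L: "csubspace (rowspaceC A)" and \<alpha>: "circuit_coeffs (rowspaceC A) \<alpha>"
    and rel0: "(\<Sum>k | (\<forall>i. k i \<le> m) \<and> exp_sum k = e. Const (d k) * col_mono A k) = 0"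
  obtains d' where "\<And>F. (\<Sum>k | (\<forall>i. k i \<le> m) \<and> exp_sum k = e. d k * shift_act (col_pt A) (diff_mono k) F)
    = (\<Sum>k | (\<forall>i. k i \<le> m) \<and> exp_sum k > e. d' k * shift_act (col_pt A) (diff_mono k) F)"
proof -
  let ?K = "{k :: 'n \<Rightarrow> nat. (\<forall>i. k i \<le> m) \<and> exp_sum k = e}"
  let ?K' = "{k :: 'n \<Rightarrow> nat. (\<forall>i. k i \<le> m) \<and> exp_sum k > e}"
  let ?act = "shift_act (col_pt A)"
  have fin: "finite ?K" "finite ?K'"
    by (rule finite_subset[OF _ finite_bounded_exps[of m]], blast)+
  \<comment> \<open>Operators whose action is that of a combination of higher order. Membership
    concerns the action only, as needed for closure under sums and scalars.\<close>
  define I where "I = {Q. \<exists>d'. \<forall>F. ?act Q F = (\<Sum>k\<in>?K'. d' k * ?act (diff_mono k) F)}"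
  have null: "Q \<in> I" if "\<And>F. ?act Q F = 0" for Q
    unfolding I_def using that by (intro CollectI exI[of _ "\<lambda>_. 0"]) simp
  have Iadd: "P + Q \<in> I" if PQ: "P \<in> I" "Q \<in> I" for P Q
  proof -
    from PQ obtain d1 d2 where "\<forall>F. ?act P F = (\<Sum>k\<in>?K'. d1 k * ?act (diff_mono k) F)"
      "\<forall>F. ?act Q F = (\<Sum>k\<in>?K'. d2 k * ?act (diff_mono k) F)" unfolding I_def by blast
    then show ?thesis
      unfolding I_def by (intro CollectI exI[of _ "\<lambda>k. d1 k + d2 k"])
        (simp add: shift_act_add distrib_right sum.distrib)
  qed
  have Iscale: "Const b * P \<in> I" if P: "P \<in> I" for b P
  proof -
    from P obtain d1 where "\<forall>F. ?act P F = (\<Sum>k\<in>?K'. d1 k * ?act (diff_mono k) F)"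
      unfolding I_def by blast
    then show ?thesis
      unfolding I_def by (intro CollectI exI[of _ "\<lambda>k. b * d1 k"])
        (simp add: shift_act_Const_times sum_distrib_left mult.assoc)
  qed
  have I0: "0 \<in> I" by (rule null) (simp add: shift_act_0)
  have Isum: "(\<Sum>x\<in>S. Q x) \<in> I" if "\<And>x. x \<in> S \<Longrightarrow> Q x \<in> I" for Q and S :: "'n set set"
    using that by (induction S rule: infinite_finite_induct) (simp_all add: I0 Iadd)
  have Idiff: "P - Q \<in> I" if "P \<in> I" "Q \<in> I" for P Q
    using Iadd[OF that(1) Iscale[OF that(2), of "- 1"]] by (simp add: Const_uminus)
  have Igen: "diff_mono k \<in> I" if "k \<in> ?K'" for k
    unfolding I_def
  proof (intro CollectI exI allI)
    fix F
    show "?act (diff_mono k) F = (\<Sum>k'\<in>?K'. (if k' = k then 1 else 0) * ?act (diff_mono k') F)"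
      using that fin(2) by (simp add: if_distrib[of "\<lambda>x. x * _"] cong: if_cong)
  qed
  have "(\<Sum>k\<in>?K. Const (d k) * diff_mono k) \<in> I"
  proof (rule monomial_relations_generated_by_circuits[OF L \<alpha> fin(1)])
    show "exp_inc k j \<in> ?K" if "exp_inc k c \<in> ?K" "j \<noteq> c" "k j < m" for k c j
    proof -
      have "k i \<le> m" for i
        using that(1) by (auto simp: exp_inc_def split: if_splits dest!: spec[of _ i])
      moreover have "exp_sum (exp_inc k j) = e" using that(1) by (simp add: exp_sum_exp_inc)
      ultimately show ?thesis using that(3) by (auto simp: exp_inc_def)
    qed
    \<comment> \<open>A vector of the row space lists the values of the column forms at its
      coefficient vector, so evaluating the polynomial relation there gives the claim.\<close>
    show "(\<Sum>k\<in>?K. d k * mono_fun k v) = 0" if "v \<in> rowspaceC A" for v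
    proof -
      from that obtain c :: "'d \<Rightarrow> complex" where v: "v = (\<lambda>j. \<Sum>i\<in>UNIV. c i * of_int (A i j))"
        unfolding rowspaceC_def by blast
      define x where "x = case_option 0 c"
      have "evalp x (lin_form (col_pt A i)) = v i" for i
        by (simp add: lin_form_def ev.ins_simps col_pt_def x_def v UNIV_option_conv sum.reindex mult.commute)
      then have "evalp x (col_mono A k) = mono_fun k v" for k
        by (simp add: col_mono_def mono_fun_def ev.ins_simps)
      then show ?thesis using arg_cong[OF rel0, of "evalp x"] by (simp add: ev.ins_simps)
    qed
    show "(\<Sum>i\<in>C. Const (\<alpha> C i) * diff_mono (exp_inc k i)) \<in> I"
      if C: "matroid_circuit (rowspaceC A) C" and k: "\<forall>i\<in>C. exp_inc k i \<in> ?K" for C k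
    proof (cases "C = {}")
      case True
      then show ?thesis by (simp add: I0)
    next
      case False
      obtain \<epsilon> :: "'n \<Rightarrow> int" and \<gamma> where \<epsilon>: "\<And>i. i \<in> C \<Longrightarrow> \<epsilon> i = 1 \<or> \<epsilon> i = - 1"
        "\<And>i. i \<in> C \<Longrightarrow> \<alpha> C i = \<gamma> * of_int (\<epsilon> i)" "\<And>r. (\<Sum>i\<in>C. \<epsilon> i * A r i) = 0"
        by (rule unimodular_circuit_signs[OF A L \<alpha> C]) blast
      \<comment> \<open>The two sides of the circuit relation, by sign. The columns of
        \<open>P\<close> and of \<open>N\<close> have equal sums.\<close>
      define P where "P = {i\<in>C. \<epsilon> i = 1}"
      define N where "N = {i\<in>C. \<epsilon> i = - 1}"
      have PN: "C = P \<union> N" "P \<inter> N = {}" using \<epsilon>(1) by (auto simp: P_def N_def)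
      have split: "(\<Sum>i\<in>C. f i) = (\<Sum>i\<in>P. f i) + (\<Sum>i\<in>N. f i)" for f :: "'n \<Rightarrow> 'b::comm_monoid_add"
        unfolding PN(1) using PN(2) by (intro sum.union_disjoint) auto
      have ind: "mono_fun (exp_add_set (\<lambda>_. 0) T) v = (\<Prod>i\<in>T. v i)" for T and v :: "'n \<Rightarrow> 'n mpoly"
        by (simp add: mono_fun_exp_add_set) (simp add: mono_fun_def)
      have comb: "comb_point (col_pt A) (exp_add_set (\<lambda>_. 0) T) v = (\<Sum>i\<in>T. col_pt A i v)" for T v
      proof -
        have "comb_point (col_pt A) (exp_add_set (\<lambda>_. 0) T) v = (\<Sum>i\<in>UNIV. if i \<in> T then col_pt A i v else 0)"
          unfolding comb_point_def by (rule sum.cong) (auto simp: exp_add_set_def)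
        then show ?thesis by (simp add: sum.If_cases)
      qed
      have "(\<Sum>i\<in>P. A r i) = (\<Sum>i\<in>N. A r i)" for r
      proof -
        have "(\<Sum>i\<in>P. A r i) - (\<Sum>i\<in>N. A r i) = (\<Sum>i\<in>C. \<epsilon> i * A r i)"
          unfolding split by (simp add: P_def N_def sum_negf)
        with \<epsilon>(3)[of r] show ?thesis by simp
      qed
      then have sumPN: "(\<Sum>i\<in>P. col_pt A i v) = (\<Sum>i\<in>N. col_pt A i v)" for v
        unfolding col_pt_def by (cases v) (simp_all flip: of_int_sum)
      have eqact: "?act ((\<Prod>i\<in>P. Var i) * diff_mono k) F = ?act ((\<Prod>i\<in>N. Var i) * diff_mono k) F" for F
        unfolding ind[symmetric] by (rule shift_act_mult_cong) (simp add: fun_eq_iff comb sumPN)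
      \<comment> \<open>Since \<open>exp_sum k + 1 = e\<close>, adding at least two factors yields
        order above \<open>e\<close>. The exponents stay in the box because each coordinate of
        \<open>C\<close> can be raised once.\<close>
      define R where "R T = (\<Sum>S | S \<subseteq> T \<and> card S \<ge> 2. diff_mono (exp_add_set k S))" for T
      have R: "R T \<in> I" if T: "T \<subseteq> C" for T
        unfolding R_def
      proof (intro Isum Igen)
        fix S assume "S \<in> {S. S \<subseteq> T \<and> 2 \<le> card S}"
        then have S: "S \<subseteq> C" "2 \<le> card S" using T by auto
        from False obtain i0 where i0: "i0 \<in> C" by blast
        have "exp_add_set k S i \<le> m" for i
        proof (cases "i \<in> S")
          case True
          with S k have "exp_inc k i \<in> ?K" by blast
          then have "exp_inc k i i \<le> m" by blast
          with True show ?thesis by (simp add: exp_add_set_def exp_inc_def)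
        next
          case False
          have "exp_inc k i0 i \<le> m" using k i0 by blast
          with False show ?thesis by (simp add: exp_add_set_def exp_inc_def split: if_splits)
        qed
        moreover have "exp_sum (exp_add_set k S) > e"
        proof -
          have "exp_sum (exp_inc k i0) = e" using k i0 by blast
          with S(2) show ?thesis by (simp add: exp_sum_exp_inc exp_sum_exp_add_set)
        qed
        ultimately show "exp_add_set k S \<in> ?K'" by blast
      qed
      \<comment> \<open>The two products act equally, their constant parts
        \<open>diff_mono k\<close> cancel, and removing the higher order tails leaves the circuit
        relation.\<close>
      have "Const \<gamma> * (((\<Prod>i\<in>P. Var i) * diff_mono k - (\<Prod>i\<in>N. Var i) * diff_mono k) - (R P - R N)) \<in> I"
        by (intro Iscale Idiff R null) (use PN(1) in \<open>auto simp: shift_act_diff eqact\<close>)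
      also have "((\<Prod>i\<in>P. Var i) * diff_mono k - (\<Prod>i\<in>N. Var i) * diff_mono k) - (R P - R N)
          = (\<Sum>i\<in>P. diff_mono (exp_inc k i)) - (\<Sum>i\<in>N. diff_mono (exp_inc k i))"
        unfolding prod_Var_times_diff_mono R_def by simp
      also have "Const \<gamma> * \<dots> = (\<Sum>i\<in>C. Const (\<alpha> C i) * diff_mono (exp_inc k i))"
      proof -
        have "(\<Sum>i\<in>P. Const (\<alpha> C i) * diff_mono (exp_inc k i)) = Const \<gamma> * (\<Sum>i\<in>P. diff_mono (exp_inc k i))"
          unfolding sum_distrib_left by (rule sum.cong) (auto simp: P_def \<epsilon>(2))
        moreover have "(\<Sum>i\<in>N. Const (\<alpha> C i) * diff_mono (exp_inc k i)) = - (Const \<gamma> * (\<Sum>i\<in>N. diff_mono (exp_inc k i)))"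
          unfolding sum_distrib_left sum_negf[symmetric]
          by (rule sum.cong) (auto simp: N_def \<epsilon>(2) Const_uminus)
        ultimately show ?thesis unfolding split by (simp add: right_diff_distrib)
      qed
      finally show ?thesis .
    qed
  qed (use I0 Iadd Iscale in auto)
  then obtain d' where d': "\<forall>F. ?act (\<Sum>k\<in>?K. Const (d k) * diff_mono k) F = (\<Sum>k\<in>?K'. d' k * ?act (diff_mono k) F)"
    unfolding I_def by blast
  show thesis
    by (rule that[of d']) (use d' in \<open>simp add: shift_act_sum shift_act_Const_times\<close>)
qed

lemma apolar_Const_left: "apolar (Const c * f) g = c * apolar f g"
  by (simp add: apolar_def lin_ext_Const_times)

lemma comb_point_col_pt:
  "comb_point (col_pt A) k = (\<lambda>v. case v of None \<Rightarrow> 0 | Some r \<Rightarrow> of_int (\<Sum>i\<in>UNIV. int (k i) * A r i))"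
  by (auto simp: fun_eq_iff comb_point_def col_pt_def split: option.splits)

lemma vanish_ideal_eq:
  fixes A :: "'d::finite \<Rightarrow> 'n::finite \<Rightarrow> int"
  assumes "unimodular A" "csubspace (rowspaceC A)" "circuit_coeffs (rowspaceC A) \<alpha>"
  shows "vanish_ideal A m = {f. xpoly f \<and> (\<forall>k. (\<forall>i. k i \<le> m) \<longrightarrow> evalp (comb_point (col_pt A) k) f = 0)}"
  unfolding vanish_ideal_def zono_pts_eq[OF assms] comb_point_col_pt by simp

lemma tdeg_le_Max: "m \<in> keys f \<Longrightarrow> tdeg m \<le> Max (tdeg ` keys f)"
  by simp

lemma keys_diff_topcomp:
  assumes "m \<in> keys (f - topcomp f)"
  shows "tdeg m < Max (tdeg ` keys f)"
proof -
  have m: "m \<in> keys f" "tdeg m \<noteq> Max (tdeg ` keys f)"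
    using assms by (auto simp: in_keys_iff lookup_minus topcomp_eq lookup_hom_comp split: if_splits)
  from tdeg_le_Max[OF m(1)] m(2) show ?thesis by linarith
qed

text \<open>The binomial expansion involves evaluations only at points with coefficients between
  \<open>0\<close> and \<open>m\<close>.\<close>

lemma shift_act_diff_mono_vanish:
  assumes "\<And>i. k i \<le> m" "\<And>j. (\<And>i. j i \<le> m) \<Longrightarrow> evalp (comb_point a j) F = 0"
  shows "shift_act a (diff_mono k) F = 0"
proof -
  have "diff_mono k = mono_fun k (\<lambda>i. Var i + Const (- 1))"
    by (simp add: diff_mono_def Const_uminus)
  also have "\<dots> = (\<Sum>j | \<forall>i. j i \<le> m. Const (\<Prod>i\<in>UNIV. of_nat (k i choose j i) * (- 1) ^ (k i - j i)) * mono_fun j Var)"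
    by (rule mono_fun_plus_Const) (rule assms(1))
  finally show ?thesis
    by (simp add: shift_act_sum shift_act_Const_times shift_act_mono_fun_Var assms(2))
qed

text \<open>By homogeneity only monomial multiples of leading forms in degree
  \<open>exp_sum k\<close> matter. There the leading form may be replaced by \<open>f\<close>
  itself, and the pairing becomes a difference operator applied to a polynomial that vanishes on the
  lattice points.\<close>

lemma col_mono_in_inv_system:
  fixes A :: "'d::finite \<Rightarrow> 'n::finite \<Rightarrow> int"
  assumes A: "unimodular A" "csubspace (rowspaceC A)" "circuit_coeffs (rowspaceC A) \<alpha>"
    and k: "\<And>i. k i \<le> m"
  shows "col_mono A k \<in> inv_system (grI A m)"
proof -
  have mono: "apolar (single b c * topcomp f) (col_mono A k) = 0" if f: "f \<in> vanish_ideal A m" for b c f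
  proof (cases "f = 0")
    case True
    then show ?thesis by (simp add: topcomp_def apolar_def lin_ext_def)
  next
    case False
    define D where "D = Max (tdeg ` keys f)"
    have keys: "\<exists>m'\<in>keys g. tdeg x = tdeg b + tdeg m'" if "x \<in> keys (single b c * g)" for x and g :: "'d option mpoly"
    proof -
      from that keys_mult[of "single b c" g] obtain x1 x2 where
        x: "x = x1 + x2" "x1 \<in> keys (single b c)" "x2 \<in> keys g" by blast
      then have "x1 = b" by (auto split: if_splits)
      with x show ?thesis by (auto simp: tdeg_add)
    qed
    show ?thesis
    proof (cases "tdeg b + D = exp_sum k")
      case False
      have "lookup (col_mono A k) x = 0" if "x \<in> keys (single b c * topcomp f)" for x
      proof (rule lookup_col_mono_eq_0)
        from keys[OF that] obtain m' where "m' \<in> keys (topcomp f)" "tdeg x = tdeg b + tdeg m'" by blast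
        then show "tdeg x \<noteq> exp_sum k"
          using False by (auto simp: topcomp_eq in_keys_iff lookup_hom_comp D_def split: if_splits)
      qed
      then show ?thesis by (rule apolar_eq_0)
    next
      case True
      have "apolar (single b c * f) (col_mono A k) = shift_act (col_pt A) (diff_mono k) (single b c * f)"
        unfolding col_mono_def
      proof (rule shift_act_diff_mono[symmetric])
        fix x assume "x \<in> keys (single b c * f)"
        from keys[OF this] obtain m' where "m' \<in> keys f" "tdeg x = tdeg b + tdeg m'" by blast
        with tdeg_le_Max[of m' f] True show "tdeg x \<le> exp_sum k" unfolding D_def by linarith
      qed
      also have "\<dots> = 0"
        using f by (intro shift_act_diff_mono_vanish[OF k]) (simp add: vanish_ideal_eq[OF A] ev.ins_mult)
      finally have "apolar (single b c * f) (col_mono A k) = 0" .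
      \<comment> \<open>The lower terms have degree below \<open>exp_sum k\<close>, so they pair to
        zero.\<close>
      moreover have "apolar (single b c * (f - topcomp f)) (col_mono A k) = 0"
      proof (rule apolar_eq_0, rule lookup_col_mono_eq_0)
        fix x assume "x \<in> keys (single b c * (f - topcomp f))"
        from keys[OF this] obtain m' where "m' \<in> keys (f - topcomp f)" "tdeg x = tdeg b + tdeg m'" by blast
        then show "tdeg x \<noteq> exp_sum k" using keys_diff_topcomp[of m' f] True by (simp add: D_def)
      qed
      ultimately show ?thesis
        using apolar_add_left[of "single b c * (f - topcomp f)" "single b c * topcomp f" "col_mono A k"]
        by (simp add: right_diff_distrib)
    qed
  qed
  have "apolar f (col_mono A k) = 0" if "f \<in> grI A m" for f
  proof -
    from that obtain G r where G: "G \<subseteq> topcomp ` vanish_ideal A m" "f = (\<Sum>g\<in>G. r g * g)"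
      unfolding grI_def gen_ideal_in_def by blast
    have "apolar (r g * g) (col_mono A k) = 0" if "g \<in> G" for g
    proof -
      from that G obtain f0 where f0: "f0 \<in> vanish_ideal A m" "g = topcomp f0" by blast
      have "r g * g = (\<Sum>b\<in>keys (r g). single b (lookup (r g) b) * topcomp f0)"
        by (simp add: sum_monomials f0(2) flip: sum_distrib_right)
      then show ?thesis by (simp only: apolar_sum_left mono[OF f0(1)] sum.neutral_const)
    qed
    then show ?thesis by (simp add: G(2) apolar_sum_left)
  qed
  then show ?thesis by (simp add: inv_system_def xpoly_col_mono lookup_diffop_0)
qed

text \<open>Pairing with a form of degree \<open>e\<close> sees only the degree \<open>e\<close>
  part of \<open>F\<close>, which is either zero or the leading form of \<open>F\<close>, an element
  of \<open>grI A m\<close>.\<close>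

lemma apolar_hom_comp_vanish:
  fixes A :: "'d::finite \<Rightarrow> 'n::finite \<Rightarrow> int"
  assumes g: "g \<in> inv_system (grI A m)" and F: "F \<in> vanish_ideal A m"
    and deg: "\<And>x. x \<in> keys F \<Longrightarrow> tdeg x \<le> e"
  shows "apolar F (hom_comp e g) = 0"
proof (cases "F = 0 \<or> Max (tdeg ` keys F) \<noteq> e")
  case True
  show ?thesis
  proof (rule apolar_eq_0)
    fix x assume x: "x \<in> keys F"
    then have "keys F \<noteq> {}" by blast
    then have "Max (tdeg ` keys F) \<in> tdeg ` keys F" by (intro Max_in) auto
    with deg have "Max (tdeg ` keys F) \<le> e" by auto
    moreover have "Max (tdeg ` keys F) \<noteq> e" using True x by auto
    ultimately have "tdeg x < e" using tdeg_le_Max[OF x] by linarith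
    then show "lookup (hom_comp e g) x = 0" by (simp add: lookup_hom_comp)
  qed
next
  case False
  then have e: "Max (tdeg ` keys F) = e" by blast
  have "topcomp F \<in> grI A m"
    unfolding grI_def gen_ideal_in_def
    by (intro CollectI exI[of _ "{topcomp F}"] exI[of _ "\<lambda>_. 1"]) (use F xpoly_1 in auto)
  with g have "apolar (topcomp F) g = 0" by (simp add: inv_system_def lookup_diffop_0)
  moreover have "apolar (topcomp F) (hom_comp e g) = apolar (topcomp F) g"
    unfolding apolar_def lin_ext_def
    by (rule sum.cong) (auto simp: in_keys_iff lookup_hom_comp topcomp_eq e split: if_splits)
  moreover have "apolar (F - topcomp F) (hom_comp e g) = 0"
    by (rule apolar_eq_0) (use keys_diff_topcomp[of _ F] e in \<open>force simp: lookup_hom_comp\<close>)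
  ultimately show ?thesis
    using apolar_add_left[of "F - topcomp F" "topcomp F" "hom_comp e g"] by simp
qed

text \<open>A monomial of degree \<open>e\<close> is annihilated by operators of order above
  \<open>e\<close>, and those of order \<open>e\<close> return the coefficient of their leading
  form.\<close>

lemma sum_shift_act_monomial:
  fixes A :: "'d::finite \<Rightarrow> 'n::finite \<Rightarrow> int"
  assumes "tdeg b = e"
  shows "(\<Sum>k | (\<forall>i. k i \<le> m) \<and> exp_sum k \<ge> e. d k * shift_act (col_pt A) (diff_mono k) (single b 1))
    = mono_fact b * lookup (\<Sum>k | (\<forall>i. k i \<le> m) \<and> exp_sum k = e. Const (d k) * col_mono A k) b"
proof -
  let ?K = "{k :: 'n \<Rightarrow> nat. (\<forall>i. k i \<le> m) \<and> exp_sum k \<ge> e}"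
  have fin: "finite ?K" by (rule finite_subset[OF _ finite_bounded_exps[of m]]) blast
  have act: "shift_act (col_pt A) (diff_mono k) (single b 1) = mono_fact b * lookup (col_mono A k) b"
    if "k \<in> ?K" for k
  proof -
    have "shift_act (col_pt A) (diff_mono k) (single b 1) = apolar (single b 1) (col_mono A k)"
      unfolding col_mono_def by (rule shift_act_diff_mono) (use that assms in simp)
    then show ?thesis by (simp add: apolar_single mult.commute)
  qed
  have "(\<Sum>k\<in>?K. d k * shift_act (col_pt A) (diff_mono k) (single b 1))
      = (\<Sum>k\<in>?K. mono_fact b * (d k * lookup (col_mono A k) b))"
    by (rule sum.cong) (auto simp: act)
  also have "\<dots> = (\<Sum>k | (\<forall>i. k i \<le> m) \<and> exp_sum k = e. mono_fact b * (d k * lookup (col_mono A k) b))"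
  proof (rule sum.mono_neutral_right[OF fin])
    show "\<forall>k\<in>?K - {k. (\<forall>i. k i \<le> m) \<and> exp_sum k = e}. mono_fact b * (d k * lookup (col_mono A k) b) = 0"
    proof
      fix k assume "k \<in> ?K - {k. (\<forall>i. k i \<le> m) \<and> exp_sum k = e}"
      then have "tdeg b \<noteq> exp_sum k" using assms by auto
      then show "mono_fact b * (d k * lookup (col_mono A k) b) = 0" by (simp add: lookup_col_mono_eq_0)
    qed
  qed auto
  finally show ?thesis by (simp add: lookup_sum lookup_Const_times sum_distrib_left)
qed

text \<open>Pairing with \<open>hom_comp e g\<close> on polynomials of degree at most
  \<open>e\<close> is a combination of lattice point evaluations, hence of difference operators.
  Their order is raised step by step to \<open>e\<close>, where the leading form can be read off on
  monomials.\<close>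

lemma hom_comp_in_span:
  fixes A :: "'d::finite \<Rightarrow> 'n::finite \<Rightarrow> int"
  assumes A: "unimodular A" "csubspace (rowspaceC A)" "circuit_coeffs (rowspaceC A) \<alpha>"
    and g: "g \<in> inv_system (grI A m)"
  obtains d where "hom_comp e g = (\<Sum>k | (\<forall>i. k i \<le> m) \<and> exp_sum k = e. Const (d k) * col_mono A k)"
proof -
  let ?act = "shift_act (col_pt A)"
  let ?B = "{k :: 'n \<Rightarrow> nat. \<forall>i. k i \<le> m}"
  let ?G = "\<lambda>e'. {k :: 'n \<Rightarrow> nat. (\<forall>i. k i \<le> m) \<and> exp_sum k \<ge> e'}"
  let ?E = "\<lambda>e'. {k :: 'n \<Rightarrow> nat. (\<forall>i. k i \<le> m) \<and> exp_sum k = e'}"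
  define W where "W = {F :: 'd option mpoly. xpoly F \<and> (\<forall>x\<in>keys F. tdeg x \<le> e)}"
  have gx: "xpoly g" using g by (simp add: inv_system_def)
  have finG: "finite (?G e')" for e'
    by (rule finite_subset[OF _ finite_bounded_exps[of m]]) blast
  have "\<exists>c. \<forall>F\<in>W. apolar F (hom_comp e g) = (\<Sum>k\<in>?B. c k * evalp (comb_point (col_pt A) k) F)"
  proof -
    have Wadd: "f + h \<in> W" if "f \<in> W" "h \<in> W" for f h
      using that keys_add[of f h] by (auto simp: W_def xpoly_add)
    have Wscale: "Const c * f \<in> W" if "f \<in> W" for c f
      using that keys_Const_times[of c f] by (auto simp: W_def xpoly_Const_times)
    have Wvanish: "apolar f (hom_comp e g) = 0"
      if "f \<in> W" "\<forall>k\<in>?B. evalp (comb_point (col_pt A) k) f = 0" for f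
    proof (rule apolar_hom_comp_vanish[OF g])
      show "f \<in> vanish_ideal A m" using that by (simp add: vanish_ideal_eq[OF A] W_def)
    qed (use that in \<open>auto simp: W_def\<close>)
    obtain c where "\<And>F. F \<in> W \<Longrightarrow> apolar F (hom_comp e g) = (\<Sum>k\<in>?B. c k * evalp (comb_point (col_pt A) k) F)"
      by (rule functional_in_span[of ?B W "\<lambda>F. apolar F (hom_comp e g)" "\<lambda>k. evalp (comb_point (col_pt A) k)"])
        (simp_all add: finite_bounded_exps Wadd Wscale Wvanish ev.ins_simps apolar_add_left apolar_Const_left)
    then show ?thesis by blast
  qed
  then obtain c where c: "\<And>F. F \<in> W \<Longrightarrow> apolar F (hom_comp e g) = (\<Sum>k\<in>?B. c k * evalp (comb_point (col_pt A) k) F)"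
    by blast
  \<comment> \<open>Induction on the least order \<open>e'\<close> allowed in the
    representation.\<close>
  have "\<exists>d. \<forall>F\<in>W. apolar F (hom_comp e g) = (\<Sum>k\<in>?G e'. d k * ?act (diff_mono k) F)" if "e' \<le> e" for e'
    using that
  proof (induction e')
    case 0
    define q where "q k j = (\<Prod>i\<in>UNIV. of_nat (k i choose j i) * 1 ^ (k i - j i) :: complex)" for k j :: "'n \<Rightarrow> nat"
    have ev: "evalp (comb_point (col_pt A) k) F = (\<Sum>j\<in>?B. q k j * ?act (diff_mono j) F)" if "k \<in> ?B" for k F
    proof -
      have "mono_fun k (\<lambda>i. (Var i - 1) + Const 1) = (\<Sum>j\<in>?B. Const (q k j) * diff_mono j)"
        unfolding q_def diff_mono_def by (rule mono_fun_plus_Const) (use that in blast)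
      then have "mono_fun k Var = (\<Sum>j\<in>?B. Const (q k j) * diff_mono j)" by simp
      then show ?thesis
        by (simp add: shift_act_sum shift_act_Const_times flip: shift_act_mono_fun_Var)
    qed
    have "apolar F (hom_comp e g) = (\<Sum>j\<in>?B. (\<Sum>k\<in>?B. c k * q k j) * ?act (diff_mono j) F)" if "F \<in> W" for F
    proof -
      have "apolar F (hom_comp e g) = (\<Sum>k\<in>?B. \<Sum>j\<in>?B. c k * q k j * ?act (diff_mono j) F)"
        unfolding c[OF that] by (rule sum.cong) (auto simp: ev sum_distrib_left mult.assoc)
      also have "\<dots> = (\<Sum>j\<in>?B. \<Sum>k\<in>?B. c k * q k j * ?act (diff_mono j) F)"
        by (rule sum.swap)
      finally show ?thesis by (simp add: sum_distrib_right)
    qed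
    then show ?case by (intro exI[of _ "\<lambda>j. \<Sum>k\<in>?B. c k * q k j"]) simp
  next
    case (Suc e')
    then obtain d where d: "\<And>F. F \<in> W \<Longrightarrow> apolar F (hom_comp e g) = (\<Sum>k\<in>?G e'. d k * ?act (diff_mono k) F)"
      by auto
    define H where "H = (\<Sum>k\<in>?E e'. Const (d k) * col_mono A k)"
    \<comment> \<open>Tested on monomials of degree \<open>e'\<close>: the pairing with a form of
      degree \<open>e > e'\<close> is zero, while the operators give the coefficients of
      \<open>H\<close>.\<close>
    have "H = 0"
    proof (rule poly_mapping_eqI)
      fix b
      show "lookup H b = lookup 0 b"
      proof (cases "tdeg b = e' \<and> lookup b None = 0")
        case False
        have "lookup (col_mono A k) b = 0" if "k \<in> ?E e'" for k
          using False that lookup_col_mono_eq_0[of b k A] xpoly_col_mono[of A k]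
          by (auto simp: xpoly_iff)
        then show ?thesis by (simp add: H_def lookup_sum lookup_Const_times)
      next
        case True
        then have W: "single b 1 \<in> W" using Suc.prems by (simp add: W_def xpoly_def)
        have "mono_fact b * lookup H b = apolar (single b 1) (hom_comp e g)"
          unfolding d[OF W] H_def by (rule sum_shift_act_monomial[symmetric]) (use True in simp)
        also have "\<dots> = 0" using True Suc.prems by (simp add: apolar_single lookup_hom_comp)
        finally show ?thesis using mono_fact_nonzero[of b] by simp
      qed
    qed
    \<comment> \<open>The leading forms in order \<open>e'\<close> cancel, so the lifting lemma
      moves this part into higher order.\<close>
    then obtain d' where d': "\<And>F. (\<Sum>k\<in>?E e'. d k * ?act (diff_mono k) F)
        = (\<Sum>k | (\<forall>i. k i \<le> m) \<and> exp_sum k > e'. d' k * ?act (diff_mono k) F)"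
      unfolding H_def by (rule diff_mono_relation_lift[OF A]) blast
    have "apolar F (hom_comp e g) = (\<Sum>k\<in>?G (Suc e'). (d k + d' k) * ?act (diff_mono k) F)" if "F \<in> W" for F
    proof -
      have G: "?G e' = ?E e' \<union> ?G (Suc e')" by auto
      have "apolar F (hom_comp e g) = (\<Sum>k\<in>?E e'. d k * ?act (diff_mono k) F) + (\<Sum>k\<in>?G (Suc e'). d k * ?act (diff_mono k) F)"
        unfolding d[OF that] G
        by (rule sum.union_disjoint) (use finG[of e'] finG[of "Suc e'"] G in \<open>auto intro: finite_subset\<close>)
      then show ?thesis
        by (simp add: d' Suc_le_eq distrib_right sum.distrib)
    qed
    then show ?case by (intro exI[of _ "\<lambda>k. d k + d' k"]) simp
  qed
  then obtain d where d: "\<And>F. F \<in> W \<Longrightarrow> apolar F (hom_comp e g) = (\<Sum>k\<in>?G e. d k * ?act (diff_mono k) F)"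
    by blast
  have "hom_comp e g = (\<Sum>k\<in>?E e. Const (d k) * col_mono A k)"
  proof (rule poly_mapping_eqI)
    fix b
    show "lookup (hom_comp e g) b = lookup (\<Sum>k\<in>?E e. Const (d k) * col_mono A k) b"
    proof (cases "tdeg b = e \<and> lookup b None = 0")
      case False
      have "lookup (col_mono A k) b = 0" if "k \<in> ?E e" for k
        using False that lookup_col_mono_eq_0[of b k A] xpoly_col_mono[of A k]
        by (auto simp: xpoly_iff)
      moreover have "lookup (hom_comp e g) b = 0"
        using False gx by (auto simp: lookup_hom_comp xpoly_iff)
      ultimately show ?thesis by (simp add: lookup_sum lookup_Const_times)
    next
      case True
      then have W: "single b 1 \<in> W" by (simp add: W_def xpoly_def)
      have "mono_fact b * lookup (\<Sum>k\<in>?E e. Const (d k) * col_mono A k) b = apolar (single b 1) (hom_comp e g)"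
        unfolding d[OF W] by (rule sum_shift_act_monomial[symmetric]) (use True in simp)
      also have "\<dots> = mono_fact b * lookup (hom_comp e g) b" by (simp add: apolar_single)
      finally show ?thesis using mono_fact_nonzero[of b] by simp
    qed
  qed
  with that show thesis by blast
qed

lemma inv_system_sum: "(\<And>x. x \<in> S \<Longrightarrow> f x \<in> inv_system J) \<Longrightarrow> sum f S \<in> inv_system J"
  by (induction S rule: infinite_finite_induct) (simp_all add: inv_system_0 inv_system_add)

text \<open>For the harder inclusion the homogeneous components are treated separately;
  \<open>exp_sum k\<close> decides which component supplies the coefficient of
  \<open>col_mono A k\<close>.\<close>

lemma inv_system_grI_eq:
  fixes A :: "'d::finite \<Rightarrow> 'n::finite \<Rightarrow> int"
  assumes A: "unimodular A" "csubspace (rowspaceC A)" "circuit_coeffs (rowspaceC A) \<alpha>"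
  shows "inv_system (grI A m) = {g. \<exists>d. g = (\<Sum>k | \<forall>i. k i \<le> m. Const (d k) * col_mono A k)}"
proof (intro equalityI subsetI)
  fix g assume "g \<in> {g. \<exists>d. g = (\<Sum>k | \<forall>i. k i \<le> m. Const (d k) * col_mono A k)}"
  then obtain d where d: "g = (\<Sum>k | \<forall>i. k i \<le> m. Const (d k) * col_mono A k)" by blast
  show "g \<in> inv_system (grI A m)"
    unfolding d by (intro inv_system_sum inv_system_Const_times col_mono_in_inv_system[OF A]) simp
next
  fix g assume g: "g \<in> inv_system (grI A m)"
  let ?E = "\<lambda>e. {k :: 'n \<Rightarrow> nat. (\<forall>i. k i \<le> m) \<and> exp_sum k = e}"
  have "\<exists>d. hom_comp e g = (\<Sum>k\<in>?E e. Const (d k) * col_mono A k)" for e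
    by (rule hom_comp_in_span[OF A g, of e]) (rule exI)
  then have "\<forall>e. \<exists>d. hom_comp e g = (\<Sum>k\<in>?E e. Const (d k) * col_mono A k)" by (rule allI)
  from choice[OF this] obtain d where d: "\<And>e. hom_comp e g = (\<Sum>k\<in>?E e. Const (d e k) * col_mono A k)"
    by (elim exE) simp
  let ?T = "tdeg ` keys g"
  have "g = (\<Sum>e\<in>?T. hom_comp e g)" by (simp only: sum_hom_comp)
  also have "\<dots> = (\<Sum>e\<in>?T. \<Sum>k | \<forall>i. k i \<le> m. if exp_sum k = e then Const (d e k) * col_mono A k else 0)"
    by (rule sum.cong) (simp_all add: d sum.If_cases finite_bounded_exps Collect_conj_eq)
  also have "\<dots> = (\<Sum>k | \<forall>i. k i \<le> m. \<Sum>e\<in>?T. if exp_sum k = e then Const (d e k) * col_mono A k else 0)"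
    by (rule sum.swap)
  also have "\<dots> = (\<Sum>k | \<forall>i. k i \<le> m. Const (if exp_sum k \<in> ?T then d (exp_sum k) k else 0) * col_mono A k)"
    by (rule sum.cong) auto
  finally show "g \<in> {g. \<exists>d. g = (\<Sum>k | \<forall>i. k i \<le> m. Const (d k) * col_mono A k)}"
    by (intro CollectI exI)
qed

section \<open>The Segre map onto the harmonic algebra\<close>

definition segre_gen :: "('d::finite \<Rightarrow> 'n::finite \<Rightarrow> int) \<Rightarrow> 'n set \<Rightarrow> 'd option mpoly" where
  "segre_gen A S = Var None * (\<Prod>i\<in>S. lin_form (col_pt A i))"

lemma bihom_segre_gen: "bihom 1 (card S) (segre_gen A S)"
proof -
  have "bihom 1 0 (Var None :: 'd::finite option mpoly)"
    by (simp add: bihom_def Var_def lookup_single when_def)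
  moreover have "bihom (\<Sum>i\<in>S. 0) (\<Sum>i\<in>S. 1) (\<Prod>i\<in>S. lin_form (col_pt A i))"
    by (intro bihom_prod bihom_lin_form_col_pt)
  ultimately show ?thesis
    using bihom_mult unfolding segre_gen_def by fastforce
qed

lemma subst_segre_gen_mono_val: "mono_val (segre_gen A) M = Var None ^ zdeg M * col_mono A (zexp M)"
  unfolding segre_gen_def[abs_def] col_mono_def by (rule mono_val_segre)

text \<open>The index \<open>i\<close> lies in exactly the first \<open>k i\<close> level sets, and
  the bound ensures that all of them occur among the \<open>m\<close> factors.\<close>

lemma subst_segre_gen_chain_mono:
  fixes A :: "'d::finite \<Rightarrow> 'n::finite \<Rightarrow> int"
  assumes "\<And>i. k i \<le> m"
  shows "subst (segre_gen A) (chain_mono m k) = Var None ^ m * col_mono A k"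
proof -
  have "(\<Prod>j\<in>{1..m}. \<Prod>i | j \<le> k i. lin_form (col_pt A i))
      = (\<Prod>j\<in>{1..m}. \<Prod>i\<in>UNIV. if j \<le> k i then lin_form (col_pt A i) else 1)"
    by (simp add: prod.If_cases)
  also have "\<dots> = (\<Prod>i\<in>UNIV. \<Prod>j\<in>{1..m}. if j \<le> k i then lin_form (col_pt A i) else 1)"
    by (rule prod.swap)
  also have "\<dots> = col_mono A k"
    unfolding col_mono_def mono_fun_def
  proof (rule prod.cong[OF refl])
    fix i :: 'n
    have "{1..m} \<inter> {j. j \<le> k i} = {1..k i}" using assms[of i] by auto
    then show "(\<Prod>j\<in>{1..m}. if j \<le> k i then lin_form (col_pt A i) else 1) = lin_form (col_pt A i) ^ k i"
      by (simp add: prod.If_cases)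
  qed
  finally show ?thesis
    by (simp add: chain_mono_def sb.ins_simps segre_gen_def prod.distrib)
qed

lemma evalp_subst_segre_gen:
  "evalp x (subst (segre_gen A) p)
    = evalp (\<lambda>S. x None * (\<Prod>i\<in>S. \<Sum>r\<in>UNIV. x (Some r) * of_int (A r i))) p"
proof -
  have "evalp x (lin_form (col_pt A i)) = (\<Sum>r\<in>UNIV. x (Some r) * of_int (A r i))" for i
    by (simp add: lin_form_def ev.ins_simps col_pt_def UNIV_option_conv sum.reindex mult.commute)
  then show ?thesis by (simp add: evalp_subst segre_gen_def ev.ins_simps)
qed

text \<open>The values of the generators at \<open>x\<close> are the cone coordinates of a point of
  the row space with scalar \<open>x None\<close>, and every cone point arises so. Polynomials are
  determined by their values.\<close>

lemma subst_segre_gen_eq_0_iff: "subst (segre_gen A) p = 0 \<longleftrightarrow> p \<in> IY (rowspaceC A)"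
proof
  assume 0: "subst (segre_gen A) p = 0"
  show "p \<in> IY (rowspaceC A)"
    unfolding IY_def
  proof (intro CollectI ballI allI)
    fix a and t :: complex assume "a \<in> rowspaceC A"
    then obtain c where "a = (\<lambda>j. \<Sum>i\<in>UNIV. c i * of_int (A i j))" unfolding rowspaceC_def by blast
    then show "evalp (\<lambda>S. t * (\<Prod>i\<in>S. a i)) p = 0"
      using evalp_subst_segre_gen[of "case_option t c" A p] by (simp add: 0)
  qed
next
  assume p: "p \<in> IY (rowspaceC A)"
  show "subst (segre_gen A) p = 0"
  proof (rule mpoly_eq_0_if_evalp_0)
    fix x
    have "(\<lambda>i. \<Sum>r\<in>UNIV. x (Some r) * of_int (A r i)) \<in> rowspaceC A" by (rule rowspaceC_I)
    with p have "\<forall>t. evalp (\<lambda>S. t * (\<Prod>i\<in>S. \<Sum>r\<in>UNIV. x (Some r) * of_int (A r i))) p = 0"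
      unfolding IY_def by blast
    then show "evalp x (subst (segre_gen A) p) = 0"
      unfolding evalp_subst_segre_gen by (rule spec)
  qed
qed

text \<open>A monomial of degree \<open>m\<close> has exponents at most \<open>m\<close>, so its
  image lies in the graded piece of degree \<open>m\<close>; conversely
  \<open>chain_mono m k\<close> is a preimage of each spanning element.\<close>

lemma range_subst_segre_gen:
  fixes A :: "'d::finite \<Rightarrow> 'n::finite \<Rightarrow> int"
  assumes A: "unimodular A" "csubspace (rowspaceC A)" "circuit_coeffs (rowspaceC A) \<alpha>"
  shows "range (subst (segre_gen A)) = harmonic_algebra A"
proof (intro equalityI subsetI)
  fix h assume "h \<in> range (subst (segre_gen A))"
  then obtain p where h: "h = subst (segre_gen A) p" by blast
  define g where "g k = (\<Sum>M | M \<in> keys p \<and> zdeg M = k. Const (lookup p M) * col_mono A (zexp M))" for k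
  have "g k \<in> inv_system (grI A k)" for k
    unfolding g_def
    by (intro inv_system_sum inv_system_Const_times col_mono_in_inv_system[OF A]) (use zexp_le_zdeg in auto)
  moreover have "h = (\<Sum>k\<le>Max (insert 0 (zdeg ` keys p)). Var None ^ k * g k)"
  proof -
    have "h = (\<Sum>M\<in>keys p. Const (lookup p M) * (Var None ^ zdeg M * col_mono A (zexp M)))"
      unfolding h subst_def mono_val_def[symmetric] subst_segre_gen_mono_val ..
    also have "\<dots> = (\<Sum>k\<le>Max (insert 0 (zdeg ` keys p)). \<Sum>M | M \<in> keys p \<and> zdeg M = k.
        Const (lookup p M) * (Var None ^ zdeg M * col_mono A (zexp M)))"
      by (rule sum.group[symmetric]) auto
    also have "\<dots> = (\<Sum>k\<le>Max (insert 0 (zdeg ` keys p)). Var None ^ k * g k)"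
      unfolding g_def sum_distrib_left by (intro sum.cong refl) (auto simp: mult_ac)
    finally show ?thesis .
  qed
  ultimately show "h \<in> harmonic_algebra A"
    unfolding harmonic_algebra_def by blast
next
  fix h assume "h \<in> harmonic_algebra A"
  then obtain g N where g: "\<And>k. g k \<in> inv_system (grI A k)" "h = (\<Sum>k\<le>N. Var None ^ k * g k)"
    unfolding harmonic_algebra_def by blast
  have "\<forall>m. \<exists>d. g m = (\<Sum>k | \<forall>i. k i \<le> m. Const (d k) * col_mono A k)"
    using g(1) unfolding inv_system_grI_eq[OF A] by blast
  from choice[OF this] obtain d where
    d: "\<And>m. g m = (\<Sum>k | \<forall>i. k i \<le> m. Const (d m k) * col_mono A k)"
    by (elim exE) simp
  have "subst (segre_gen A) (\<Sum>m\<le>N. \<Sum>k | \<forall>i. k i \<le> m. Const (d m k) * chain_mono m k)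
      = (\<Sum>m\<le>N. \<Sum>k | \<forall>i. k i \<le> m. Const (d m k) * (Var None ^ m * col_mono A k))"
    unfolding sb.ins_sum sb.ins_mult sb.ins_Const
    by (intro sum.cong refl) (simp add: subst_segre_gen_chain_mono)
  then have "h = subst (segre_gen A) (\<Sum>m\<le>N. \<Sum>k | \<forall>i. k i \<le> m. Const (d m k) * chain_mono m k)"
    by (simp add: g(2) d sum_distrib_left mult.left_commute)
  then show "h \<in> range (subst (segre_gen A))" by blast
qed

theorem theorem5p12:
  fixes L :: "('n::finite \<Rightarrow> complex) set"
    and \<alpha> :: "'n set \<Rightarrow> 'n \<Rightarrow> complex"
  assumes "csubspace L"
    and "circuit_coeffs L \<alpha>"
  shows "{p. subst phiL p \<in> Itilde L \<alpha>} = ISE L \<alpha>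
    \<and> IY L = ISE L \<alpha>
    \<and> (\<forall>A :: 'd::finite \<Rightarrow> 'n \<Rightarrow> int. unimodular A \<and> L = rowspaceC A \<longrightarrow>
         (\<exists>\<sigma> :: 'n set \<Rightarrow> 'd option mpoly.
            (\<forall>S. bihom 1 (card S) (\<sigma> S))
            \<and> range (subst \<sigma>) = harmonic_algebra A
            \<and> {p. subst \<sigma> p = 0} = ISE L \<alpha>))"
proof -
  \<comment> \<open>The three inclusions form a cycle: vanishing ideal into \<open>ISE\<close>,
    \<open>ISE\<close> into the kernel of \<open>phiL\<close> modulo \<open>Itilde\<close>, and that
    kernel into the vanishing ideal.\<close>
  have IY: "IY L = ISE L \<alpha>"
    using IY_subset_ISE[OF assms] subst_phiL_ISE Itilde_kernel_subset_IY[OF _ assms(2)] by blast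
  moreover have "{p. subst phiL p \<in> Itilde L \<alpha>} = ISE L \<alpha>"
    using IY_subset_ISE[OF assms] subst_phiL_ISE Itilde_kernel_subset_IY[OF _ assms(2)] by blast
  moreover have "\<exists>\<sigma> :: 'n set \<Rightarrow> 'd option mpoly. (\<forall>S. bihom 1 (card S) (\<sigma> S))
      \<and> range (subst \<sigma>) = harmonic_algebra A \<and> {p. subst \<sigma> p = 0} = ISE L \<alpha>"
    if A: "unimodular A" "L = rowspaceC A" for A :: "'d::finite \<Rightarrow> 'n \<Rightarrow> int"
  proof (intro exI conjI allI)
    show "bihom 1 (card S) (segre_gen A S)" for S by (rule bihom_segre_gen)
    show "range (subst (segre_gen A)) = harmonic_algebra A"
      using range_subst_segre_gen A assms by blast
    show "{p. subst (segre_gen A) p = 0} = ISE L \<alpha>"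
      using IY A(2) by (simp add: subst_segre_gen_eq_0_iff)
  qed
  ultimately show ?thesis by blast
qed

end
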